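(* Let $r,c$ be positive integers, $\epsilon>0$, and let $\pi^{(1)}\in\mathbb{R}^r$, $\pi^{(2)}\in\mathbb{R}^c$ be probability vectors with all components positive. For each $n$, let $(U_\ell,V_\ell)_{\ell=1}^n$ be i.i.d. pairs with $U_\ell\sim\mathrm{Multinomial}(1,\pi^{(1)})$ and $V_\ell\sim\mathrm{Multinomial}(1,\pi^{(2)})$, and let $X_\ell\in\{0,1\}^{r\times c}$ be the matrix with $(X_\ell)_{i,j}=\mathbf{1}\{U_{\ell,i}=1,\ V_{\ell,j}=1\}$. Let $\tilde H=\sum_{\ell=1}^n\mathcal{M}_{\mathrm{bit}}(X_\ell,\epsilon)$, with independent randomness for each $\ell$. Let $\alpha_\epsilon=\frac{e^{\epsilon/2}-1}{e^{\epsilon/2}+1}$, and for $a\in\mathbb{R}^r,b\in\mathbb{R}^c$ let $\tilde p(a,b)=\alpha_\epsilon\,ab^\top+\frac1{e^{\epsilon/2}+1}\mathbf{1}$. For $q\in\mathbb{R}^{rc}$ let $$\Sigma(q)=\alpha_\epsilon^2\left[\mathrm{Diag}(q)-qq^\top\right]+\frac{e^{\epsilon/2}}{(e^{\epsilon/2}+1)^2}I_{rc}.$$ Define $$\tilde\pi^{(1)}=\frac1{\alpha_\epsilon}\left(\frac{\tilde H_{i,\cdot}}n-\frac c{e^{\epsilon/2}+1}:i\in[r]\right),\qquad\tilde\pi^{(2)}=\frac1{\alpha_\epsilon}\left(\frac{\tilde H_{\cdot,j}}n-\frac r{e^{\epsilon/2}+1}:j\in[c]\right),$$ $\tilde M=\Pi\,\Sigma\big(\tilde\pi^{(1)}(\tilde\pi^{(2)})^\top\big)^{-1}\Pi$,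 and $$\tilde T^{(n)}_{\mathrm{BitFlip}}(\theta^{(1)},\theta^{(2)};\epsilon)=\frac1n\left(\tilde H-n\tilde p(\theta^{(1)},\theta^{(2)})\right)^\top\tilde M\left(\tilde H-n\tilde p(\theta^{(1)},\theta^{(2)})\right).$$ If $U$ and $V$ are independent (i.e. $U_\ell$ and $V_\ell$ are independent for each $\ell$), then as $n\to\infty$, $$\min_{\theta^{(1)},\theta^{(2)}}\tilde T^{(n)}_{\mathrm{BitFlip}}(\theta^{(1)},\theta^{(2)};\epsilon)\xrightarrow{D}\chi^2_{(r-1)(c-1)},$$ the minimum being over probability vectors $\theta^{(1)}\in\mathbb{R}^r_{>0}$ and $\theta^{(2)}\in\mathbb{R}^c_{>0}$.
   Context: $r\times c$ tables (including $ab^\top$, $\tilde H$, $\tilde p(a,b)$) are identified with vectors in $\mathbb{R}^{rc}$ by flattening; $\mathbf{1}$ is the all-ones table/vector and $\Pi=I_{rc}-\frac1{rc}\mathbf{1}\mathbf{1}^\top$. $\tilde H_{i,\cdot}=\sum_j\tilde H_{i,j}$, $\tilde H_{\cdot,j}=\sum_i\tilde H_{i,j}$. A $\mathrm{Multinomial}(1,\pi)$ variable is the standard basis vector $e_j$ with probability $\pi_j$. The mechanism $\mathcal{M}_{\mathrm{bit}}(x,\epsilon)$ takes $x\in\{0,1\}^{r\times c}$ with exactly one entry equal to 1 and outputs $z\in\{0,1\}^{r\times c}$ where, independently for each cell, $z_{i,j}=x_{i,j}$ with probability $\frac{e^{\epsilon/2}}{e^{\epsilon/2}+1}$ and $z_{i,j}=1-x_{i,j}$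 otherwise. $\chi^2_\nu$ is the chi-square distribution with $\nu$ degrees of freedom; $\xrightarrow{D}$ is convergence in distribution. The minimum is read as an infimum if it is not attained, and the statistic may be given any fixed value on the event where the matrix to be inverted is singular. *)

theory Defs
  imports "HOL-Probability.Probability"
begin

text \<open>
  An \<open>r \<times> c\<close> table is a vector \<open>real^('r \<times> 'c)\<close> with entry \<open>H $ (i, j)\<close>, where \<open>r = CARD('r)\<close> and
  \<open>c = CARD('c)\<close>; the flattening is thus built into the index type. The all-ones table is the library's
  \<open>1 :: real^('r \<times> 'c)\<close>.
\<close>

definition pos_prob_vectors :: "(real^'k) set" where
  "pos_prob_vectors = {p. (\<forall>i. 0 < p $ i) \<and> (\<Sum>i\<in>UNIV. p $ i) = 1}"

text \<open>\<open>U \<sim> Multinomial(1, p)\<close>, for a probability vector \<open>p\<close>.\<close>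

definition multinomial1_rv :: "'a measure \<Rightarrow> real^'k \<Rightarrow> ('a \<Rightarrow> real^'k) \<Rightarrow> bool" where
  "multinomial1_rv M p U \<longleftrightarrow> U \<in> borel_measurable M \<and>
     (\<forall>j. measure M {\<omega> \<in> space M. U \<omega> = axis j 1} = p $ j)"

definition iid_vars :: "'a measure \<Rightarrow> 'b measure \<Rightarrow> ('i \<Rightarrow> 'a \<Rightarrow> 'b) \<Rightarrow> 'i set \<Rightarrow> bool" where
  "iid_vars M N X I \<longleftrightarrow> prob_space.indep_vars M (\<lambda>_. N) X I \<and>
     (\<forall>i\<in>I. \<forall>j\<in>I. distr M N (X i) = distr M N (X j))"

text \<open>Independence of two random variables of possibly different types; the library's \<open>indep_var\<close> requires
  both to have the same type.\<close>

definition indep_pair :: "'a measure \<Rightarrow> 'b measure \<Rightarrow> ('a \<Rightarrow> 'b) \<Rightarrow> 'd measure \<Rightarrow> ('a \<Rightarrow> 'd) \<Rightarrow> bool" where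
  "indep_pair M N\<^sub>1 X N\<^sub>2 Y \<longleftrightarrow> X \<in> measurable M N\<^sub>1 \<and> Y \<in> measurable M N\<^sub>2 \<and>
     prob_space.indep_set M {X -` A \<inter> space M | A. A \<in> sets N\<^sub>1} {Y -` B \<inter> space M | B. B \<in> sets N\<^sub>2}"

text \<open>The chi-square distribution with \<open>\<nu>\<close> degrees of freedom is the law of the sum of squares of \<open>\<nu>\<close>
  independent standard normals; for \<open>\<nu> = 0\<close> this is the point mass at \<open>0\<close>.\<close>

definition chi_square_distribution :: "nat \<Rightarrow> real measure" where
  "chi_square_distribution \<nu> =
     distr (Pi\<^sub>M {..<\<nu>} (\<lambda>_. std_normal_distribution)) borel (\<lambda>x. \<Sum>i<\<nu>. (x i)\<^sup>2)"

definition cell_table :: "real^'r \<Rightarrow> real^'c \<Rightarrow> real^('r \<times> 'c)" where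
  "cell_table u v = (\<chi> k. of_bool (u $ fst k = 1 \<and> v $ snd k = 1))"

text \<open>The output distribution of the bit-flip mechanism; the second argument of \<open>Pi_pmf\<close> is irrelevant
  because the index set is \<open>UNIV\<close>. Only one-hot 0/1 tables \<open>x\<close> are meaningful inputs.\<close>

definition bit_mech :: "real^'k \<Rightarrow> real \<Rightarrow> (real^'k) pmf" where
  "bit_mech x \<epsilon> = map_pmf vec_lambda (Pi_pmf UNIV 0
     (\<lambda>k. map_pmf (\<lambda>keep. if keep then x $ k else 1 - x $ k)
            (bernoulli_pmf (exp (\<epsilon>/2) / (exp (\<epsilon>/2) + 1)))))"

text \<open>Conditionally on the (almost surely discrete) inputs \<open>X l\<close>, \<open>l \<in> I\<close>, the outputs \<open>Z l\<close> are
  independent with \<open>Z l\<close> distributed as \<open>K (X l)\<close>; that is, the randomised mechanism \<open>K\<close> is applied to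
  every \<open>X l\<close> with independent randomness.\<close>

definition mechanism_outputs ::
    "'a measure \<Rightarrow> ('b \<Rightarrow> 'd pmf) \<Rightarrow> ('i \<Rightarrow> 'a \<Rightarrow> 'b) \<Rightarrow> ('i \<Rightarrow> 'a \<Rightarrow> 'd) \<Rightarrow> 'i set \<Rightarrow> bool" where
  "mechanism_outputs M K X Z I \<longleftrightarrow>
     (\<forall>x z. measure M {\<omega> \<in> space M. \<forall>l\<in>I. X l \<omega> = x l \<and> Z l \<omega> = z l} =
            measure M {\<omega> \<in> space M. \<forall>l\<in>I. X l \<omega> = x l} * (\<Prod>l\<in>I. pmf (K (x l)) (z l)))"

definition outer :: "real^'r \<Rightarrow> real^'c \<Rightarrow> real^('r \<times> 'c)" where
  "outer a b = (\<chi> k. a $ fst k * b $ snd k)"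

definition alpha :: "real \<Rightarrow> real" where
  "alpha \<epsilon> = (exp (\<epsilon>/2) - 1) / (exp (\<epsilon>/2) + 1)"

definition p_tilde :: "real \<Rightarrow> real^'r \<Rightarrow> real^'c \<Rightarrow> real^('r \<times> 'c)" where
  "p_tilde \<epsilon> a b = alpha \<epsilon> *\<^sub>R outer a b + (1 / (exp (\<epsilon>/2) + 1)) *\<^sub>R 1"

definition Diag :: "real^'k \<Rightarrow> real^'k^'k" where
  "Diag q = (\<chi> k l. if k = l then q $ k else 0)"

definition Sigma_bit :: "real \<Rightarrow> real^'k \<Rightarrow> real^'k^'k" where
  "Sigma_bit \<epsilon> q = (alpha \<epsilon>)\<^sup>2 *\<^sub>R (Diag q - (\<chi> k l. q $ k * q $ l))
     + (exp (\<epsilon>/2) / (exp (\<epsilon>/2) + 1)\<^sup>2) *\<^sub>R mat 1"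

definition Pi_proj :: "real^'k^'k" where
  "Pi_proj = mat 1 - (1 / real CARD('k)) *\<^sub>R (\<chi> k l. 1)"

definition pi1_tilde :: "real \<Rightarrow> nat \<Rightarrow> real^('r::finite \<times> 'c::finite) \<Rightarrow> real^'r" where
  "pi1_tilde \<epsilon> n H = (1 / alpha \<epsilon>) *\<^sub>R
     (\<chi> i. (\<Sum>j\<in>UNIV. H $ (i, j)) / real n - real CARD('c) / (exp (\<epsilon>/2) + 1))"

definition pi2_tilde :: "real \<Rightarrow> nat \<Rightarrow> real^('r::finite \<times> 'c::finite) \<Rightarrow> real^'c" where
  "pi2_tilde \<epsilon> n H = (1 / alpha \<epsilon>) *\<^sub>R
     (\<chi> j. (\<Sum>i\<in>UNIV. H $ (i, j)) / real n - real CARD('r) / (exp (\<epsilon>/2) + 1))"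

definition Sigma_tilde ::
    "real \<Rightarrow> nat \<Rightarrow> real^('r::finite \<times> 'c::finite) \<Rightarrow> real^('r \<times> 'c)^('r \<times> 'c)" where
  "Sigma_tilde \<epsilon> n H = Sigma_bit \<epsilon> (outer (pi1_tilde \<epsilon> n H) (pi2_tilde \<epsilon> n H))"

definition M_tilde ::
    "real \<Rightarrow> nat \<Rightarrow> real^('r::finite \<times> 'c::finite) \<Rightarrow> real^('r \<times> 'c)^('r \<times> 'c)" where
  "M_tilde \<epsilon> n H = Pi_proj ** matrix_inv (Sigma_tilde \<epsilon> n H) ** Pi_proj"

text \<open>The statistic is set to \<open>0\<close> where the matrix to be inverted is singular.\<close>

definition T_bitflip ::
    "real \<Rightarrow> nat \<Rightarrow> real^('r::finite \<times> 'c::finite) \<Rightarrow> real^'r \<Rightarrow> real^'c \<Rightarrow> real" where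
  "T_bitflip \<epsilon> n H \<theta>1 \<theta>2 =
     (if invertible (Sigma_tilde \<epsilon> n H)
      then (1 / real n) * ((H - real n *\<^sub>R p_tilde \<epsilon> \<theta>1 \<theta>2) \<bullet>
             (M_tilde \<epsilon> n H *v (H - real n *\<^sub>R p_tilde \<epsilon> \<theta>1 \<theta>2)))
      else 0)"

end

theory Submission
  imports Defs
begin

text \<open>
  Write \<open>H = n p + sqrt n Y\<close>, where \<open>p\<close> is the mean of one privatized table. The covariance \<open>A\<close> of a privatized
  table is at least a positive multiple of the identity and has \<open>1\<close> as an eigenvector. Uniformly over bounded \<open>Y\<close>,
  the minimized statistic differs by \<open>o(1)\<close> from the squared \<open>A\<inverse>\<close>-distance of \<open>Y\<close> to the space \<open>W\<close> spanned by the
  tangent space of the independence model and by \<open>1\<close>: far away parameters make the statistic large because the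
  quadratic form is coercive modulo \<open>1\<close>, and nearby ones are linearized. That squared distance is
  \<open>\<Sum>i<\<nu>. (l i \<bullet> Y)\<^sup>2\<close> for an \<open>A\<close>-orthonormal basis \<open>l\<close> of the orthogonal complement of \<open>W\<close>, whose dimension is
  \<open>\<nu> = (r - 1) (c - 1)\<close>.

  The limit law needs no multivariate central limit theorem. The function \<open>exp (- k |y|\<^sup>2)\<close> is the average of
  \<open>exp (\<i> sqrt (2 k) x \<bullet> y)\<close> over a standard normal \<open>x\<close>, so convergence of the characteristic functions of \<open>Y\<close> gives
  convergence of the Laplace transform of the sum of squares, and Weierstrass approximation by polynomials in
  \<open>exp (- q)\<close> passes from Laplace transforms to continuous step functions. Boundedness of second moments makes the
  event of large \<open>Y\<close> negligible.
\<close>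

section \<open>Characteristic functions of standardized i.i.d. sums\<close>

text \<open>The matrix that is inverted is estimated from the table itself and can be singular or
  indefinite, so it is compared with \<open>A\<close> only for \<open>Y\<close> in a fixed ball,
  uniformly there. No minimizer is ever constructed: the infimum is squeezed between a bound valid
  for every parameter and the value at one explicit parameter. The vector \<open>1\<close> belongs
  to \<open>W\<close> because \<open>Pi_proj\<close> annihilates it, so the statistic cannot see
  multiples of \<open>1\<close>. As \<open>1\<close> is an eigenvector of \<open>A\<close>, it is
  orthogonal to the sum-zero tables in the metric of the inverse of \<open>A\<close> too; projecting
  with \<open>Pi_proj\<close> is thus the same as minimizing over multiples of \<open>1\<close>.
  This makes the dimension count rc - (r-1) - (c-1) - 1 = (r-1)(c-1). The given probability spaces
  enter only through the law of the sum of the outputs. That law comes from a product of finitely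
  supported distributions, where every function is integrable and expectations are finite
  sums.\<close>

lemma expectation_prod_Pi_pmf_field:
  fixes f :: "'a \<Rightarrow> 'b \<Rightarrow> 'c :: {real_normed_field, banach, second_countable_topology}"
  assumes fin: "finite I" and int: "\<And>i. i \<in> I \<Longrightarrow> integrable (measure_pmf (p i)) (f i)"
  shows "measure_pmf.expectation (Pi_pmf I d p) (\<lambda>z. \<Prod>i\<in>I. f i (z i)) =
           (\<Prod>i\<in>I. measure_pmf.expectation (p i) (f i))"
proof -
  have comp: "map_pmf (\<lambda>z. z i) (Pi_pmf I d p) = p i" if "i \<in> I" for i
    using Pi_pmf_component[OF fin, of i d p] that by simp
  have indep: "prob_space.indep_vars (measure_pmf (Pi_pmf I d p)) (\<lambda>_. borel) (\<lambda>i z. f i (z i)) I"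
    by (rule prob_space.indep_vars_compose2[OF measure_pmf.prob_space_axioms indep_vars_Pi_pmf[OF fin]]) simp
  have "integrable (measure_pmf (map_pmf (\<lambda>z. z i) (Pi_pmf I d p))) (f i)" if "i \<in> I" for i
    using int[OF that] by (simp only: comp[OF that])
  then have "integrable (measure_pmf (Pi_pmf I d p)) (\<lambda>z. f i (z i))" if "i \<in> I" for i
    using that by simp
  then have "measure_pmf.expectation (Pi_pmf I d p) (\<lambda>z. \<Prod>i\<in>I. f i (z i)) =
      (\<Prod>i\<in>I. measure_pmf.expectation (Pi_pmf I d p) (\<lambda>z. f i (z i)))"
    by (intro prob_space.indep_vars_lebesgue_integral[OF measure_pmf.prob_space_axioms] fin indep) 
  also have "\<dots> = (\<Prod>i\<in>I. measure_pmf.expectation (map_pmf (\<lambda>z. z i) (Pi_pmf I d p)) (f i))"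
    by simp
  also have "\<dots> = (\<Prod>i\<in>I. measure_pmf.expectation (p i) (f i))"
    by (intro prod.cong refl) (simp only: comp)
  finally show ?thesis .
qed

text \<open>The expectation is the n-th power of a characteristic function at 1/sqrt n, which a
  second-order Taylor expansion compares with 1 - v/(2n). The variance \<open>v\<close> is not
  normalized and may be 0, so every linear combination of coordinates can be inserted.\<close>

lemma char_clt_Pi_pmf:
  fixes f :: "'b \<Rightarrow> real" and \<mu> :: "'b pmf"
  assumes fin: "finite (set_pmf \<mu>)"
    and mean: "measure_pmf.expectation \<mu> f = 0"
    and var: "measure_pmf.expectation \<mu> (\<lambda>z. (f z)\<^sup>2) = v"
  shows "(\<lambda>n::nat. measure_pmf.expectation (Pi_pmf {1..n::nat} d (\<lambda>_. \<mu>))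
            (\<lambda>z. iexp ((\<Sum>l=1..n::nat. f (z l)) / sqrt n))) \<longlonglongrightarrow> complex_of_real (exp (- v / 2))"
proof -
  note [simp] = integrable_measure_pmf_finite[OF fin]
  define \<nu> where "\<nu> = distr (measure_pmf \<mu>) borel f"
  interpret \<nu>: real_distribution \<nu>
    unfolding \<nu>_def by (rule prob_space.real_distribution_distr[OF measure_pmf.prob_space_axioms]) simp
  define \<phi> where "\<phi> n = char \<nu> (1 / sqrt (real n))" for n :: nat
  \<comment> \<open>The Taylor remainder at 1/sqrt n. Its minimum with the second moment supplies
    the dominating function under which it tends to 0.\<close>
  define r where "r n = measure_pmf.expectation \<mu> (\<lambda>z. min (6 * (f z)\<^sup>2) (\<bar>1 / sqrt (real n)\<bar> * \<bar>f z\<bar> ^ 3))" for n :: nat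
  have v0: "v \<ge> 0"
    unfolding var[symmetric] by (rule Bochner_Integration.integral_nonneg) simp
  have char_eq: "measure_pmf.expectation (Pi_pmf {1..n::nat} d (\<lambda>_. \<mu>))
            (\<lambda>z. iexp ((\<Sum>l=1..n::nat. f (z l)) / sqrt n)) = \<phi> n ^ n" for n :: nat
  proof -
    have "measure_pmf.expectation (Pi_pmf {1..n::nat} d (\<lambda>_. \<mu>)) (\<lambda>z. iexp ((\<Sum>l=1..n::nat. f (z l)) / sqrt n))
       = measure_pmf.expectation (Pi_pmf {1..n::nat} d (\<lambda>_. \<mu>)) (\<lambda>z. \<Prod>l=1..n. iexp (f (z l) / sqrt n))"
      by (simp add: exp_sum[symmetric] sum_divide_distrib sum_distrib_left)
    also have "\<dots> = (\<Prod>l=1..n. measure_pmf.expectation \<mu> (\<lambda>z. iexp (f z / sqrt n)))"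
      by (rule expectation_prod_Pi_pmf_field) auto
    also have "\<dots> = \<phi> n ^ n"
      by (simp add: \<phi>_def char_def \<nu>_def integral_distr mult.commute)
    finally show ?thesis .
  qed
  have approx: "cmod (\<phi> n - (1 - v / 2 / n)) \<le> 1 / (6 * n) * r n" if "n \<ge> 1" for n
  proof -
    have "cmod (\<phi> n - (1 - (1 / sqrt (real n))\<^sup>2 * v / 2)) \<le> (1 / sqrt (real n))\<^sup>2 / 6 * r n"
      unfolding \<phi>_def r_def
      by (rule prob_space.char_approx3'[OF measure_pmf.prob_space_axioms]) (use mean var in \<open>auto simp: \<nu>_def\<close>)
    then show ?thesis using that by (simp add: power_divide mult.commute)
  qed
  \<comment> \<open>For n at least \<open>v\<close> the number 1 - v/(2n) lies in the unit disc, as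
    \<open>\<phi> n\<close> does; there n-th powers differ by at most n times the difference of the
    bases.\<close>
  have bound: "cmod (\<phi> n ^ n - (complex_of_real (1 + (- v / 2) / n)) ^ n) \<le> r n / 6"
    if n: "n \<ge> 1" "real n \<ge> v" for n
  proof -
    have "cmod (\<phi> n ^ n - (complex_of_real (1 + (- v / 2) / n)) ^ n)
        \<le> n * cmod (\<phi> n - complex_of_real (1 + (- v / 2) / n))"
      using n v0
      by (intro norm_power_diff) (auto simp: \<phi>_def \<nu>.cmod_char_le_1 abs_le_iff field_simps simp del: of_real_add of_real_divide)
    also have "\<dots> \<le> n * (1 / (6 * n) * r n)"
      using approx[OF n(1)] by (intro mult_left_mono) auto
    finally show ?thesis using n by simp
  qed
  have "(\<lambda>n. r n) \<longlonglongrightarrow> measure_pmf.expectation \<mu> (\<lambda>z. 0)"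
    unfolding r_def
  proof (rule integral_dominated_convergence[where w = "\<lambda>z. 6 * (f z)\<^sup>2"])
    show "AE z in measure_pmf \<mu>. (\<lambda>n. min (6 * (f z)\<^sup>2) (\<bar>1 / sqrt (real n)\<bar> * \<bar>f z\<bar> ^ 3)) \<longlonglongrightarrow> 0"
    proof (rule AE_I2)
      fix z
      have "(\<lambda>n. min (6 * (f z)\<^sup>2) (\<bar>1 / sqrt (real n)\<bar> * \<bar>f z\<bar> ^ 3)) \<longlonglongrightarrow> min (6 * (f z)\<^sup>2) (\<bar>0\<bar> * \<bar>f z\<bar> ^ 3)"
        by (intro tendsto_intros tendsto_divide_0[OF tendsto_const]
              filterlim_at_top_imp_at_infinity filterlim_compose[OF sqrt_at_top] filterlim_real_sequentially)
      then show "(\<lambda>n. min (6 * (f z)\<^sup>2) (\<bar>1 / sqrt (real n)\<bar> * \<bar>f z\<bar> ^ 3)) \<longlonglongrightarrow> 0"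
        by (simp add: min_absorb2)
    qed
  qed auto
  then have r: "(\<lambda>n. r n / 6) \<longlonglongrightarrow> 0"
    by (auto intro: tendsto_divide_zero)
  have lim: "(\<lambda>n. complex_of_real ((1 + (- v / 2) / n) ^ n)) \<longlonglongrightarrow> complex_of_real (exp (- v / 2))"
    by (rule isCont_tendsto_compose[OF _ tendsto_exp_limit_sequentially]) auto
  have "(\<lambda>n. \<phi> n ^ n - complex_of_real ((1 + (- v / 2) / n) ^ n)) \<longlonglongrightarrow> 0"
  proof (rule Lim_null_comparison[OF _ r])
    show "\<forall>\<^sub>F n in sequentially. cmod (\<phi> n ^ n - complex_of_real ((1 + (- v / 2) / n) ^ n)) \<le> r n / 6"
      using eventually_ge_at_top[of 1] eventually_ge_at_top[of "nat \<lceil>v\<rceil>"]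
      by eventually_elim (use bound in \<open>auto simp: nat_ceiling_le_eq\<close>)
  qed
  from Lim_transform[OF lim this] show ?thesis
    unfolding char_eq by simp
qed

section \<open>From characteristic functions to sums of squares\<close>

lemma product_prob_space_std_normal: "product_prob_space (\<lambda>_. std_normal_distribution)"
  using prob_space_normal_density[of 1 0]
  by (intro product_prob_spaceI) (auto simp: std_normal_density_def)

lemma char_std_normal_product:
  fixes c :: "nat \<Rightarrow> real"
  shows "(LINT x|Pi\<^sub>M {..<\<nu>} (\<lambda>_. std_normal_distribution). iexp (\<Sum>i<\<nu>. c i * x i))
           = complex_of_real (exp (- (\<Sum>i<\<nu>. (c i)\<^sup>2) / 2))"
proof -
  interpret product_prob_space "\<lambda>_::nat. std_normal_distribution"
    by (rule product_prob_space_std_normal)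
  have int: "integrable std_normal_distribution (\<lambda>x. iexp (t * x))" for t :: real
    by (rule finite_measure.integrable_const_bound[of _ _ 1])
       (auto intro!: prob_space.finite_measure prob_space_normal_density)
  have "(LINT x|Pi\<^sub>M {..<\<nu>} (\<lambda>_. std_normal_distribution). iexp (\<Sum>i<\<nu>. c i * x i))
      = (LINT x|Pi\<^sub>M {..<\<nu>} (\<lambda>_. std_normal_distribution). (\<Prod>i<\<nu>. iexp (c i * x i)))"
    by (simp add: exp_sum[symmetric] sum_distrib_left)
  also have "\<dots> = (\<Prod>i<\<nu>. LINT x|std_normal_distribution. iexp (c i * x))"
    by (rule product_integral_prod) (use int in auto)
  also have "\<dots> = (\<Prod>i<\<nu>. char std_normal_distribution (c i))"
    by (simp add: char_def)
  also have "\<dots> = complex_of_real (exp (- (\<Sum>i<\<nu>. (c i)\<^sup>2) / 2))"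
    by (simp add: char_std_normal_distribution exp_sum[symmetric] sum_negf sum_divide_distrib flip: of_real_prod)
  finally show ?thesis .
qed

text \<open>The hypothesis is used at the frequencies \<open>s * x i\<close> and then integrated
  over a Gaussian \<open>x\<close>. On the left this averages the exponential into the Laplace
  transform of the sum of squares of \<open>y\<close>; on the right the limiting characteristic
  function, read as a function of \<open>x\<close>, is already the integrand of the chi-square
  Laplace transform. No closed form of that transform is computed.\<close>

lemma laplace_sum_squares_tendsto:
  fixes P :: "nat \<Rightarrow> 'b pmf" and y :: "nat \<Rightarrow> 'b \<Rightarrow> nat \<Rightarrow> real"
  assumes fin: "\<And>n. finite (set_pmf (P n))"
    and char: "\<And>c. (\<lambda>n. measure_pmf.expectation (P n) (\<lambda>z. iexp (\<Sum>i<\<nu>. c i * y n z i)))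
                 \<longlonglongrightarrow> complex_of_real (exp (- (\<Sum>i<\<nu>. (c i)\<^sup>2) / 2))"
    and k: "k \<ge> 0"
  shows "(\<lambda>n. measure_pmf.expectation (P n) (\<lambda>z. exp (- k * (\<Sum>i<\<nu>. (y n z i)\<^sup>2))))
      \<longlonglongrightarrow> (LINT x|Pi\<^sub>M {..<\<nu>} (\<lambda>_. std_normal_distribution). exp (- k * (\<Sum>i<\<nu>. (x i)\<^sup>2)))"
proof -
  let ?N = "Pi\<^sub>M {..<\<nu>} (\<lambda>_. std_normal_distribution)"
  interpret product_prob_space "\<lambda>_::nat. std_normal_distribution"
    by (rule product_prob_space_std_normal)
  interpret N: prob_space ?N
    by (rule prob_space_PiM) (rule prob_space)
  \<comment> \<open>Chosen so that the Gaussian exponent (s t)^2 / 2 becomes k t^2.\<close>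
  define s where "s = sqrt (2 * k)"
  have s2: "s\<^sup>2 = 2 * k" using k by (simp add: s_def)
  have [measurable]: "(\<lambda>x. x i) \<in> borel_measurable ?N" if "i < \<nu>" for i
    using measurable_component_singleton[of i "{..<\<nu>}" "\<lambda>_. std_normal_distribution"] that by simp
  have meas: "(\<lambda>x. iexp (\<Sum>i<\<nu>. c i * x i)) \<in> borel_measurable ?N" for c :: "nat \<Rightarrow> real"
    by (intro borel_measurable_continuous_on[of "\<lambda>t. exp t"] continuous_intros borel_measurable_times
        borel_measurable_const borel_measurable_of_real borel_measurable_sum) auto
  have int: "integrable ?N (\<lambda>x. iexp (\<Sum>i<\<nu>. c i * x i))" for c :: "nat \<Rightarrow> real"
    by (rule N.integrable_const_bound[of _ 1]) (auto simp: meas)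
  define E where "E n x = measure_pmf.expectation (P n) (\<lambda>z. iexp (\<Sum>i<\<nu>. (s * x i) * y n z i))" for n x
  have E_sum: "E n x = (\<Sum>z\<in>set_pmf (P n). pmf (P n) z * iexp (\<Sum>i<\<nu>. (s * x i) * y n z i))" for n x
    unfolding E_def by (subst integral_measure_pmf[OF fin]) (auto simp: scaleR_conv_of_real)
  have E_sum': "E n x = (\<Sum>z\<in>set_pmf (P n). pmf (P n) z * iexp (\<Sum>i<\<nu>. (s * y n z i) * x i))" for n x
    unfolding E_sum by (simp add: ac_simps)
  \<comment> \<open>The interchange of integrals is linearity over the finite support of
    \<open>P n\<close>.\<close>
  have swap: "complex_of_real (measure_pmf.expectation (P n) (\<lambda>z. exp (- k * (\<Sum>i<\<nu>. (y n z i)\<^sup>2)))) = (LINT x|?N. E n x)" for n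
  proof -
    have "(LINT x|?N. E n x) = (\<Sum>z\<in>set_pmf (P n). pmf (P n) z * (LINT x|?N. iexp (\<Sum>i<\<nu>. (s * y n z i) * x i)))"
      unfolding E_sum'
    proof (subst Bochner_Integration.integral_sum)
      show "integrable ?N (\<lambda>x. complex_of_real (pmf (P n) z) * iexp (\<Sum>i<\<nu>. (s * y n z i) * x i))" for z
        by (rule integrable_mult_right[OF int])
    qed simp
    also have "\<dots> = (\<Sum>z\<in>set_pmf (P n). pmf (P n) z * complex_of_real (exp (- k * (\<Sum>i<\<nu>. (y n z i)\<^sup>2))))"
      by (subst char_std_normal_product) (simp add: power_mult_distrib s2 sum_distrib_left sum_divide_distrib mult.assoc sum_negf)
    finally show ?thesis
      by (subst integral_measure_pmf[OF fin]) auto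
  qed
  have "(\<lambda>n. LINT x|?N. E n x) \<longlonglongrightarrow> (LINT x|?N. complex_of_real (exp (- (\<Sum>i<\<nu>. (s * x i)\<^sup>2) / 2)))"
  proof (rule integral_dominated_convergence[where w = "\<lambda>_. 1"])
    show "E n \<in> borel_measurable ?N" for n
      unfolding E_sum' by (intro borel_measurable_sum borel_measurable_times borel_measurable_const meas)
    show "AE x in ?N. (\<lambda>n. E n x) \<longlonglongrightarrow> complex_of_real (exp (- (\<Sum>i<\<nu>. (s * x i)\<^sup>2) / 2))"
      unfolding E_def by (intro AE_I2 char)
    show "AE x in ?N. cmod (E n x) \<le> 1" for n
    proof (rule AE_I2)
      fix x
      have "cmod (E n x) \<le> measure_pmf.expectation (P n) (\<lambda>z. cmod (iexp (\<Sum>i<\<nu>. (s * x i) * y n z i)))"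
        unfolding E_def by (rule integral_norm_bound)
      then show "cmod (E n x) \<le> 1" by simp
    qed
    show "(\<lambda>x. complex_of_real (exp (- (\<Sum>i<\<nu>. (s * x i)\<^sup>2) / 2))) \<in> borel_measurable ?N"
      by measurable
  qed auto
  also have "(LINT x|?N. complex_of_real (exp (- (\<Sum>i<\<nu>. (s * x i)\<^sup>2) / 2)))
      = complex_of_real (LINT x|?N. exp (- k * (\<Sum>i<\<nu>. (x i)\<^sup>2)))"
    by (simp add: power_mult_distrib s2 sum_distrib_left[symmetric] mult.assoc)
  finally show ?thesis
    unfolding swap[symmetric] tendsto_of_real_iff .
qed

lemma cts_step_sum_squares_tendsto:
  fixes P :: "nat \<Rightarrow> 'b pmf" and y :: "nat \<Rightarrow> 'b \<Rightarrow> nat \<Rightarrow> real"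
  assumes fin: "\<And>n. finite (set_pmf (P n))"
    and char: "\<And>c. (\<lambda>n. measure_pmf.expectation (P n) (\<lambda>z. iexp (\<Sum>i<\<nu>. c i * y n z i)))
                 \<longlonglongrightarrow> complex_of_real (exp (- (\<Sum>i<\<nu>. (c i)\<^sup>2) / 2))"
    and ab: "a < b"
  shows "(\<lambda>n. measure_pmf.expectation (P n) (\<lambda>z. cts_step a b (\<Sum>i<\<nu>. (y n z i)\<^sup>2)))
      \<longlonglongrightarrow> integral\<^sup>L (chi_square_distribution \<nu>) (cts_step a b)"
proof -
  let ?N = "Pi\<^sub>M {..<\<nu>} (\<lambda>_. std_normal_distribution)"
  interpret product_prob_space "\<lambda>_::nat. std_normal_distribution"
    by (rule product_prob_space_std_normal)
  interpret N: prob_space ?N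
    by (rule prob_space_PiM) (rule prob_space)
  have comp [measurable]: "(\<lambda>x. x i) \<in> borel_measurable ?N" if "i < \<nu>" for i
    using measurable_component_singleton[of i "{..<\<nu>}" "\<lambda>_. std_normal_distribution"] that by simp
  have q_meas [measurable]: "(\<lambda>x. \<Sum>i<\<nu>. (x i)\<^sup>2) \<in> borel_measurable ?N"
    by measurable
  note [simp] = integrable_measure_pmf_finite[OF fin]
  \<comment> \<open>The step function in the variable w = exp (- q). It vanishes from
    \<open>b\<close> onwards, so cutting w off at exp (- b) changes nothing for w > 0 and extends
    \<open>G\<close> continuously to w = 0. Approximation on the compact interval therefore controls
    all q >= 0, and no tightness is required.\<close>
  define G where "G w = cts_step a b (- ln (max w (exp (- b))))" for w :: real
  have step_meas [measurable]: "cts_step a b \<in> borel_measurable borel"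
    unfolding cts_step_def[abs_def] by measurable
  have G: "G (exp (- q)) = cts_step a b q" for q
    using ab by (auto simp: G_def max_def cts_step_def)
  have "continuous_on UNIV (cts_step a b)"
    using cts_step_uniformly_continuous[OF ab] by (rule uniformly_continuous_imp_continuous)
  then have contG: "continuous_on {0..1} G"
    unfolding G_def
    by (rule continuous_on_compose2)
       (intro continuous_intros, auto simp: less_max_iff_disj intro!: less_imp_neq[THEN not_sym])
  define qn where "qn n z = (\<Sum>i<\<nu>. (y n z i)\<^sup>2)" for n z
  have qn0: "qn n z \<ge> 0" for n z by (auto simp: qn_def intro: sum_nonneg)
  define q where "q x = (\<Sum>i<\<nu>. (x i)\<^sup>2)" for x :: "nat \<Rightarrow> real"
  have q0: "q x \<ge> 0" for x by (auto simp: q_def intro: sum_nonneg)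
  have q_meas' [measurable]: "q \<in> borel_measurable ?N"
    unfolding q_def[abs_def] by measurable
  have chi: "integral\<^sup>L (chi_square_distribution \<nu>) (cts_step a b) = (LINT x|?N. cts_step a b (q x))"
    unfolding chi_square_distribution_def q_def by (rule integral_distr) measurable
  have int_exp: "integrable ?N (\<lambda>x. exp (- q x) ^ m)" for m
    by (rule N.integrable_const_bound[of _ 1]) (auto simp: power_le_one q0)
  have int_step: "integrable ?N (\<lambda>x. cts_step a b (q x))"
    by (rule N.integrable_const_bound[of _ 1]) (use ab in \<open>auto simp: cts_step_def field_simps\<close>)
  \<comment> \<open>The m-th power of exp (- q) is the Laplace kernel at k = m, so polynomials need
    integer arguments only.\<close>
  have mom: "(\<lambda>n. measure_pmf.expectation (P n) (\<lambda>z. exp (- qn n z) ^ m)) \<longlonglongrightarrow> (LINT x|?N. exp (- q x) ^ m)" for m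
    using laplace_sum_squares_tendsto[OF fin char, of "real m"]
    by (simp add: qn_def q_def flip: exp_of_nat_mult)
  show ?thesis
    unfolding chi LIMSEQ_iff
  proof (intro allI impI)
    fix e :: real assume e: "e > 0"
    obtain p where p: "real_polynomial_function p" "\<And>w. w \<in> {0..1} \<Longrightarrow> \<bar>G w - p w\<bar> < e / 4"
      using Stone_Weierstrass_real_polynomial_function[OF _ contG, of "e / 4"] e by auto
    obtain c :: "nat \<Rightarrow> real" and d where pc: "p = (\<lambda>w. \<Sum>m\<le>d. c m * w ^ m)"
      using p(1) unfolding real_polynomial_function_iff_sum by blast
    have close: "\<bar>cts_step a b t - p (exp (- t))\<bar> \<le> e / 4" if "t \<ge> 0" for t
      using p(2)[of "exp (- t)"] that by (auto simp: G less_imp_le)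
    have int_p: "integrable ?N (\<lambda>x. p (exp (- q x)))"
      unfolding pc by (intro Bochner_Integration.integrable_sum integrable_mult_right int_exp)
    have "(\<lambda>n. measure_pmf.expectation (P n) (\<lambda>z. p (exp (- qn n z)))) \<longlonglongrightarrow> (LINT x|?N. p (exp (- q x)))"
      unfolding pc using int_exp mom by (subst Bochner_Integration.integral_sum; auto intro!: tendsto_sum tendsto_mult_left)+
    then obtain n0 where n0: "\<And>n. n \<ge> n0 \<Longrightarrow>
        \<bar>measure_pmf.expectation (P n) (\<lambda>z. p (exp (- qn n z))) - (LINT x|?N. p (exp (- q x)))\<bar> < e / 4"
      unfolding LIMSEQ_iff using e by (metis divide_pos_pos real_norm_def zero_less_numeral)
    have N: "\<bar>(LINT x|?N. cts_step a b (q x)) - (LINT x|?N. p (exp (- q x)))\<bar> \<le> e / 4"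
    proof -
      have "\<bar>(LINT x|?N. cts_step a b (q x)) - (LINT x|?N. p (exp (- q x)))\<bar>
          = \<bar>LINT x|?N. cts_step a b (q x) - p (exp (- q x))\<bar>"
        using int_step int_p by simp
      also have "\<dots> \<le> (LINT x|?N. \<bar>cts_step a b (q x) - p (exp (- q x))\<bar>)"
        by (rule integral_abs_bound)
      also have "\<dots> \<le> e / 4"
        by (intro N.integral_le_const AE_I2 close q0 integrable_abs Bochner_Integration.integrable_diff int_step int_p)
      finally show ?thesis .
    qed
    have P: "\<bar>measure_pmf.expectation (P n) (\<lambda>z. cts_step a b (qn n z)) - measure_pmf.expectation (P n) (\<lambda>z. p (exp (- qn n z)))\<bar> \<le> e / 4" for n
    proof -
      have "\<bar>measure_pmf.expectation (P n) (\<lambda>z. cts_step a b (qn n z)) - measure_pmf.expectation (P n) (\<lambda>z. p (exp (- qn n z)))\<bar>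
         = \<bar>measure_pmf.expectation (P n) (\<lambda>z. cts_step a b (qn n z) - p (exp (- qn n z)))\<bar>"
        by simp
      also have "\<dots> \<le> measure_pmf.expectation (P n) (\<lambda>z. \<bar>cts_step a b (qn n z) - p (exp (- qn n z))\<bar>)"
        by (rule integral_abs_bound)
      also have "\<dots> \<le> e / 4"
        by (intro measure_pmf.integral_le_const AE_I2 close qn0) simp
      finally show ?thesis .
    qed
    have "\<bar>measure_pmf.expectation (P n) (\<lambda>z. cts_step a b (qn n z)) - (LINT x|?N. cts_step a b (q x))\<bar> < e" if "n \<ge> n0" for n
      using n0[OF that] N P[of n] e by arith
    then show "\<exists>no. \<forall>n\<ge>no. norm (measure_pmf.expectation (P n) (\<lambda>z. cts_step a b (\<Sum>i<\<nu>. (y n z i)\<^sup>2))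
         - (LINT x|?N. cts_step a b (q x))) < e"
      by (auto simp: qn_def)
  qed
qed

section \<open>Matrices\<close>

lemma tendsto_det:
  fixes f :: "'b \<Rightarrow> real^'k^'k"
  assumes "(f \<longlongrightarrow> A) F"
  shows "((\<lambda>x. det (f x)) \<longlongrightarrow> det A) F"
  unfolding det_def by (intro tendsto_intros assms)

text \<open>Cramer's rule writes every entry of the inverse as a quotient of determinants, from
  which continuity of inversion can be read off.\<close>

lemma matrix_inv_cramer:
  fixes A :: "real^'k^'k"
  assumes "invertible A"
  shows "matrix_inv A = (\<chi> i j. det (\<chi> i' j'. if j' = i then axis j 1 $ i' else A $ i' $ j') / det A)"
proof -
  have d: "det A \<noteq> 0" using assms invertible_det_nz by blast
  have "A ** matrix_inv A = mat 1"
    unfolding matrix_inv_def by (rule someI2_ex) (use assms in \<open>auto simp: invertible_def\<close>)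
  then have "A *v (matrix_inv A *v axis j 1) = axis j 1" for j
    by (simp add: matrix_vector_mul_assoc)
  then have "matrix_inv A *v axis j 1 = (\<chi> k. det (\<chi> i' j'. if j' = k then axis j 1 $ i' else A $ i' $ j') / det A)" for j
    using cramer[OF d] by blast
  then have "matrix_inv A $ i $ j = (\<chi> k. det (\<chi> i' j'. if j' = k then axis j 1 $ i' else A $ i' $ j') / det A) $ i" for i j
    by (metis column_def matrix_vector_mul_component matrix_vector_mult_basis vec_lambda_beta)
  then show ?thesis
    by (simp add: vec_eq_iff)
qed

lemma matrix_inv_right_left:
  fixes A :: "real^'k^'k"
  assumes "invertible A"
  shows "A ** matrix_inv A = mat 1" "matrix_inv A ** A = mat 1"
proof -
  have "A ** matrix_inv A = mat 1 \<and> matrix_inv A ** A = mat 1"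
    unfolding matrix_inv_def by (rule someI_ex) (use assms in \<open>auto simp: invertible_def\<close>)
  then show "A ** matrix_inv A = mat 1" "matrix_inv A ** A = mat 1" by auto
qed

lemma tendsto_matrix_inv:
  fixes f :: "'b \<Rightarrow> real^'k^'k"
  assumes f: "(f \<longlongrightarrow> A) F" and A: "invertible A"
  shows "\<forall>\<^sub>F x in F. invertible (f x)" "((\<lambda>x. matrix_inv (f x)) \<longlongrightarrow> matrix_inv A) F"
proof -
  have d: "det A \<noteq> 0" using A invertible_det_nz by blast
  show ev: "\<forall>\<^sub>F x in F. invertible (f x)"
    using tendsto_imp_eventually_ne[OF tendsto_det[OF f] d] by (simp add: invertible_det_nz)
  have "((\<lambda>x. (\<chi> i j. det (\<chi> i' j'. if j' = i then axis j 1 $ i' else f x $ i' $ j') / det (f x)) :: real^'k^'k)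
      \<longlongrightarrow> (\<chi> i j. det (\<chi> i' j'. if j' = i then axis j 1 $ i' else A $ i' $ j') / det A)) F"
  proof (intro tendsto_vec_lambda tendsto_divide tendsto_det d f)
    fix i j i' j' :: 'k
    show "((\<lambda>x. if j' = i then axis j 1 $ i' else f x $ i' $ j') \<longlongrightarrow>
        (if j' = i then axis j 1 $ i' else A $ i' $ j')) F"
      using f by (auto intro!: tendsto_intros)
  qed
  then show "((\<lambda>x. matrix_inv (f x)) \<longlongrightarrow> matrix_inv A) F"
    unfolding matrix_inv_cramer[OF A]
    by (rule Lim_transform_eventually) (use ev in eventually_elim, simp add: matrix_inv_cramer)
qed

text \<open>Gram-Schmidt for the inner product \<open>x \<bullet> (A *v y)\<close>: fewer than
  \<open>dim N\<close> vectors cannot span \<open>N\<close>, so another one can be orthogonalized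
  and added. The family is indexed by the naturals below \<open>dim N\<close> to match the index set
  of the chi-square law; dimension 0 is allowed.\<close>

lemma orthonormal_basis_wrt:
  fixes A :: "real^'k^'k" and N :: "(real^'k) set"
  assumes sym: "\<And>x y. x \<bullet> (A *v y) = (A *v x) \<bullet> y" and pos: "\<And>x. x \<noteq> 0 \<Longrightarrow> x \<bullet> (A *v x) > 0"
    and N: "subspace N"
  obtains l :: "nat \<Rightarrow> real^'k" where
    "\<And>i j. i < dim N \<Longrightarrow> j < dim N \<Longrightarrow> l i \<bullet> (A *v l j) = of_bool (i = j)"
    "span (l ` {..<dim N}) = N"
proof -
  have ex: "\<exists>l :: nat \<Rightarrow> real^'k. (\<forall>i<m. l i \<in> N) \<and> (\<forall>i<m. \<forall>j<m. l i \<bullet> (A *v l j) = of_bool (i = j))"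
    if "m \<le> dim N" for m
    using that
  proof (induction m)
    case (Suc m)
    then obtain l :: "nat \<Rightarrow> real^'k" where l: "\<And>i. i < m \<Longrightarrow> l i \<in> N"
      "\<And>i j. i < m \<Longrightarrow> j < m \<Longrightarrow> l i \<bullet> (A *v l j) = of_bool (i = j)"
      by (metis Suc_leD)
    have "dim (l ` {..<m}) \<le> card (l ` {..<m})" by (rule dim_le_card') simp
    also have "\<dots> \<le> m" using card_image_le[of "{..<m}" l] by simp
    finally have "\<not> N \<subseteq> span (l ` {..<m})"
      using Suc.prems dim_subset[of N "span (l ` {..<m})"] by auto
    then obtain y where y: "y \<in> N" "y \<notin> span (l ` {..<m})" by blast
    define y' where "y' = y - (\<Sum>i<m. (l i \<bullet> (A *v y)) *\<^sub>R l i)"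
    have sp: "(\<Sum>i<m. (l i \<bullet> (A *v y)) *\<^sub>R l i) \<in> span (l ` {..<m})"
      by (intro span_sum span_scale span_base) auto
    then have y'0: "y' \<noteq> 0" using y(2) by (auto simp: y'_def)
    have y'N: "y' \<in> N"
      unfolding y'_def by (intro subspace_diff subspace_sum subspace_scale N y l) auto
    have orth: "l j \<bullet> (A *v y') = 0" if "j < m" for j
    proof -
      have "l j \<bullet> (A *v y') = l j \<bullet> (A *v y) - (\<Sum>i<m. (l i \<bullet> (A *v y)) * (l j \<bullet> (A *v l i)))"
        by (simp add: y'_def matrix_vector_mult_diff_distrib inner_diff_right linear_sum[OF matrix_vector_mul_linear]
            matrix_vector_mult_scaleR inner_sum_right)
      also have "(\<Sum>i<m. (l i \<bullet> (A *v y)) * (l j \<bullet> (A *v l i))) = (\<Sum>i<m. if i = j then l j \<bullet> (A *v y) else 0)"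
        by (intro sum.cong) (use l that in auto)
      finally show ?thesis using that by simp
    qed
    define s where "s = y' \<bullet> (A *v y')"
    have s: "s > 0" using pos[OF y'0] by (simp add: s_def)
    define l' where "l' = l(m := (1 / sqrt s) *\<^sub>R y')"
    have orth': "y' \<bullet> (A *v l j) = 0" if "j < m" for j
      using orth[OF that] sym[of y' "l j"] by (simp add: inner_commute)
    have "(\<forall>i<Suc m. l' i \<in> N)"
      using l y'N N by (auto simp: l'_def less_Suc_eq intro: subspace_scale)
    moreover have "\<forall>i<Suc m. \<forall>j<Suc m. l' i \<bullet> (A *v l' j) = of_bool (i = j)"
      using l orth orth' s by (auto simp: l'_def less_Suc_eq matrix_vector_mult_scaleR s_def[symmetric])
    ultimately show ?case by blast
  qed auto
  obtain l :: "nat \<Rightarrow> real^'k" where l: "\<And>i. i < dim N \<Longrightarrow> l i \<in> N"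
      "\<And>i j. i < dim N \<Longrightarrow> j < dim N \<Longrightarrow> l i \<bullet> (A *v l j) = of_bool (i = j)"
    using ex[of "dim N"] by blast
  \<comment> \<open>Pairing a vanishing combination with \<open>A *v l j\<close> isolates its j-th
    coefficient.\<close>
  have coeff: "c j = 0" if "(\<Sum>i<dim N. c i *\<^sub>R l i) = 0" "j < dim N" for c j
  proof -
    have "0 = l j \<bullet> (A *v (\<Sum>i<dim N. c i *\<^sub>R l i))"
      unfolding that(1) by simp
    also have "\<dots> = (\<Sum>i<dim N. c i * (l j \<bullet> (A *v l i)))"
      by (simp add: linear_sum[OF matrix_vector_mul_linear] matrix_vector_mult_scaleR inner_sum_right)
    also have "\<dots> = (\<Sum>i<dim N. if i = j then c j else 0)"
      by (intro sum.cong) (use l that in auto)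
    finally show ?thesis using that by simp
  qed
  have inj: "inj_on l {..<dim N}"
    by (rule inj_onI) (metis l(2) lessThan_iff of_bool_eq(2) of_bool_eq(1) zero_neq_one)
  have "independent (l ` {..<dim N})"
  proof (rule independent_if_scalars_zero)
    fix f x assume *: "(\<Sum>x\<in>l ` {..<dim N}. f x *\<^sub>R x) = 0" "x \<in> l ` {..<dim N}"
    then obtain j where j: "j < dim N" "x = l j" by auto
    show "f x = 0"
      using coeff[of "\<lambda>i. f (l i)" j] * j by (simp add: sum.reindex[OF inj])
  qed simp
  then have "N \<subseteq> span (l ` {..<dim N})"
    by (intro card_ge_dim_independent) (use l in \<open>auto simp: card_image[OF inj]\<close>)
  moreover have "span (l ` {..<dim N}) \<subseteq> N"
    by (intro span_minimal N) (use l in auto)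
  ultimately show thesis using l(2) that by blast
qed

section \<open>Moments of the mechanism\<close>

lemma expectation_square_sum_Pi_pmf:
  fixes f :: "'a \<Rightarrow> 'b \<Rightarrow> real"
  assumes fin: "finite I" and fin_p: "\<And>i. i \<in> I \<Longrightarrow> finite (set_pmf (p i))"
    and mean: "\<And>i. i \<in> I \<Longrightarrow> measure_pmf.expectation (p i) (f i) = 0"
  shows "measure_pmf.expectation (Pi_pmf I d p) (\<lambda>z. (\<Sum>i\<in>I. f i (z i))\<^sup>2) =
           (\<Sum>i\<in>I. measure_pmf.expectation (p i) (\<lambda>x. (f i x)\<^sup>2))"
proof -
  have int: "integrable (measure_pmf (Pi_pmf I d p)) g" for g :: "('a \<Rightarrow> 'b) \<Rightarrow> real"
    by (rule integrable_measure_pmf_finite) (auto simp: set_Pi_pmf[OF fin] intro!: finite_PiE_dflt fin fin_p)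
  have prod: "measure_pmf.expectation (Pi_pmf I d p) (\<lambda>z. f i (z i) * f j (z j)) =
      (if i = j then measure_pmf.expectation (p i) (\<lambda>x. (f i x)\<^sup>2) else 0)" if ij: "i \<in> I" "j \<in> I" for i j
  proof -
    \<comment> \<open>The product of two coordinates is written as a product over all of
      \<open>I\<close> of one-coordinate functions, so that the product formula applies both for i =
      j and for distinct indices.\<close>
    define g where "g k x = (if k = i then f i x else 1) * (if k = j then f j x else 1)" for k x
    have "(\<lambda>z. f i (z i) * f j (z j)) = (\<lambda>z. \<Prod>k\<in>I. g k (z k))"
    proof
      fix z
      have "(\<Prod>k\<in>I. if k = i then f i (z k) else 1) = (\<Prod>k\<in>I. if k = i then f i (z i) else 1)"
        "(\<Prod>k\<in>I. if k = j then f j (z k) else 1) = (\<Prod>k\<in>I. if k = j then f j (z j) else 1)"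
        by (intro prod.cong; simp)+
      then show "f i (z i) * f j (z j) = (\<Prod>k\<in>I. g k (z k))"
        using ij fin by (simp add: g_def prod.distrib)
    qed
    then have "measure_pmf.expectation (Pi_pmf I d p) (\<lambda>z. f i (z i) * f j (z j))
        = measure_pmf.expectation (Pi_pmf I d p) (\<lambda>z. \<Prod>k\<in>I. g k (z k))"
      by simp
    also have "\<dots> = (\<Prod>k\<in>I. measure_pmf.expectation (p k) (g k))"
      by (intro expectation_prod_Pi_pmf_field fin integrable_measure_pmf_finite fin_p)
    also have "\<dots> = (if i = j then measure_pmf.expectation (p i) (\<lambda>x. (f i x)\<^sup>2) else 0)"
    proof (cases "i = j")
      case True
      have "(\<Prod>k\<in>I. measure_pmf.expectation (p k) (g k)) = (\<Prod>k\<in>I. if k = i then measure_pmf.expectation (p i) (\<lambda>x. (f i x)\<^sup>2) else 1)"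
        by (intro prod.cong) (auto simp: g_def[abs_def] True power2_eq_square)
      then show ?thesis using True ij fin by simp
    next
      case False
      then have "measure_pmf.expectation (p i) (g i) = 0"
        using mean[OF ij(1)] by (simp add: g_def[abs_def])
      then show ?thesis using False ij fin by auto
    qed
    finally show ?thesis .
  qed
  have "measure_pmf.expectation (Pi_pmf I d p) (\<lambda>z. (\<Sum>i\<in>I. f i (z i))\<^sup>2)
      = (\<Sum>i\<in>I. \<Sum>j\<in>I. measure_pmf.expectation (Pi_pmf I d p) (\<lambda>z. f i (z i) * f j (z j)))"
    by (simp add: power2_eq_square sum_product Bochner_Integration.integral_sum int)
  also have "\<dots> = (\<Sum>i\<in>I. measure_pmf.expectation (p i) (\<lambda>x. (f i x)\<^sup>2))"
    using fin by (intro sum.cong refl) (simp add: prod)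
  finally show ?thesis .
qed

lemma finite_set_bit_mech: "finite (set_pmf (bit_mech x \<epsilon>))"
  unfolding bit_mech_def by (auto simp: set_Pi_pmf intro!: finite_PiE_dflt)

text \<open>The law of one privatized record: a mixture over the true cell, drawn from
  \<open>P\<close>. Indexing by cells instead of one-hot tables keeps the mixture finite.\<close>

definition bit_output :: "real \<Rightarrow> 'k pmf \<Rightarrow> (real^'k) pmf" where
  "bit_output \<epsilon> P = bind_pmf P (\<lambda>k. bit_mech (axis k 1) \<epsilon>)"

lemma finite_set_bit_output: "finite (set_pmf (bit_output \<epsilon> (P :: 'k::finite pmf)))"
  unfolding bit_output_def by (auto simp: finite_set_bit_mech)

text \<open>\<open>\<kappa>\<close> is the probability of keeping a bit. In terms of it the
  constants of the mechanism become a bias, a flip probability and a Bernoulli variance.\<close>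

lemma exp_over_exp_plus_1:
  fixes \<epsilon> :: real
  defines "\<kappa> \<equiv> exp (\<epsilon>/2) / (exp (\<epsilon>/2) + 1 :: real)"
  shows "0 \<le> \<kappa>" "\<kappa> \<le> 1" "alpha \<epsilon> = 2 * \<kappa> - 1" "1 / (exp (\<epsilon>/2) + 1) = 1 - \<kappa>"
    "exp (\<epsilon>/2) / (exp (\<epsilon>/2) + 1)\<^sup>2 = \<kappa> * (1 - \<kappa>)"
proof -
  have "exp (\<epsilon>/2) + 1 > 0" by (simp add: add_pos_pos)
  then show "0 \<le> \<kappa>" "\<kappa> \<le> 1" "alpha \<epsilon> = 2 * \<kappa> - 1" "1 / (exp (\<epsilon>/2) + 1) = 1 - \<kappa>"
    "exp (\<epsilon>/2) / (exp (\<epsilon>/2) + 1)\<^sup>2 = \<kappa> * (1 - \<kappa>)"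
    by (auto simp: \<kappa>_def alpha_def field_simps power2_eq_square)
qed

text \<open>Given the input, the output bits are independent, and each has the variance of a
  Bernoulli variable whichever value the input bit takes. The conditional covariance is therefore a
  multiple of the identity, the second summand of \<open>Sigma_bit\<close>. The conditional mean is
  affine in the input because its entries are 0 or 1.\<close>

lemma bit_mech_moments:
  fixes v :: "real^'k" and \<epsilon> :: real
  assumes x: "\<And>k. x $ k \<in> {0, 1}"
  defines "m \<equiv> alpha \<epsilon> *\<^sub>R x + (1 / (exp (\<epsilon>/2) + 1)) *\<^sub>R 1"
  shows "measure_pmf.expectation (bit_mech x \<epsilon>) (\<lambda>z. v \<bullet> (z - m)) = 0"
    and "measure_pmf.expectation (bit_mech x \<epsilon>) (\<lambda>z. (v \<bullet> (z - m))\<^sup>2) =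
      exp (\<epsilon>/2) / (exp (\<epsilon>/2) + 1)\<^sup>2 * (v \<bullet> v)"
proof -
  define \<kappa> where "\<kappa> = exp (\<epsilon>/2) / (exp (\<epsilon>/2) + 1)"
  note \<kappa> = exp_over_exp_plus_1[of \<epsilon>, folded \<kappa>_def]
  define D where "D k = map_pmf (\<lambda>keep. if keep then x $ k else 1 - x $ k) (bernoulli_pmf \<kappa>)" for k
  define f where "f k t = v $ k * (t - m $ k)" for k t
  have finD: "finite (set_pmf (D k))" for k by (simp add: D_def)
  have m: "m $ k = (2 * \<kappa> - 1) * x $ k + (1 - \<kappa>)" for k
    by (simp add: m_def \<kappa>)
  have mean: "measure_pmf.expectation (D k) (f k) = 0" for k
    using x[of k] \<kappa>(1,2) by (auto simp: D_def f_def m algebra_simps)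
  have sq: "measure_pmf.expectation (D k) (\<lambda>t. (f k t)\<^sup>2) = \<kappa> * (1 - \<kappa>) * (v $ k)\<^sup>2" for k
    using x[of k] \<kappa>(1,2) by (auto simp: D_def f_def m algebra_simps power2_eq_square)
  have mech: "bit_mech x \<epsilon> = map_pmf vec_lambda (Pi_pmf UNIV 0 D)"
    by (simp add: bit_mech_def D_def[abs_def] \<kappa>_def)
  have ip: "v \<bullet> (vec_lambda w - m) = (\<Sum>k\<in>UNIV. f k (w k))" for w
    by (simp add: inner_vec_def f_def)
  have int: "integrable (measure_pmf (Pi_pmf UNIV 0 D)) g" for g :: "('k \<Rightarrow> real) \<Rightarrow> real"
    by (rule integrable_measure_pmf_finite) (auto simp: set_Pi_pmf intro!: finite_PiE_dflt finD)
  have comp: "measure_pmf.expectation (Pi_pmf UNIV 0 D) (\<lambda>w. f k (w k)) = 0" for k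
  proof -
    have "measure_pmf.expectation (Pi_pmf UNIV 0 D) (\<lambda>w. f k (w k))
       = measure_pmf.expectation (map_pmf (\<lambda>w. w k) (Pi_pmf UNIV 0 D)) (f k)"
      by simp
    also have "map_pmf (\<lambda>w. w k) (Pi_pmf UNIV 0 D) = D k"
      by (subst Pi_pmf_component) auto
    finally show ?thesis using mean by simp
  qed
  show "measure_pmf.expectation (bit_mech x \<epsilon>) (\<lambda>z. v \<bullet> (z - m)) = 0"
    by (simp add: mech ip Bochner_Integration.integral_sum int comp)
  have "measure_pmf.expectation (Pi_pmf UNIV 0 D) (\<lambda>w. (\<Sum>k\<in>UNIV. f k (w k))\<^sup>2) = (\<Sum>k\<in>UNIV. \<kappa> * (1 - \<kappa>) * (v $ k)\<^sup>2)"
    by (subst expectation_square_sum_Pi_pmf) (auto simp: finD mean sq)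
  then show "measure_pmf.expectation (bit_mech x \<epsilon>) (\<lambda>z. (v \<bullet> (z - m))\<^sup>2) =
      exp (\<epsilon>/2) / (exp (\<epsilon>/2) + 1)\<^sup>2 * (v \<bullet> v)"
    unfolding \<kappa>(5) by (simp add: mech ip inner_vec_def[of v v] sum_distrib_left power2_eq_square)
qed

lemma Sigma_bit_mult:
  fixes q v :: "real^'k"
  shows "Sigma_bit \<epsilon> q *v v = (alpha \<epsilon>)\<^sup>2 *\<^sub>R ((\<chi> k. q $ k * v $ k) - (q \<bullet> v) *\<^sub>R q)
     + (exp (\<epsilon>/2) / (exp (\<epsilon>/2) + 1)\<^sup>2) *\<^sub>R v"
proof -
  have "(\<Sum>j\<in>UNIV. (if i = j then q $ i else 0) * v $ j) = q $ i * v $ i" for i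
    by (simp add: if_distrib[of "\<lambda>x. x * _"] cong: if_cong)
  then have "Diag q *v v = (\<chi> k. q $ k * v $ k)"
    by (simp add: vec_eq_iff matrix_vector_mult_def Diag_def)
  moreover have "(\<chi> k l. q $ k * q $ l) *v v = (q \<bullet> v) *\<^sub>R q"
    by (simp add: vec_eq_iff matrix_vector_mult_def inner_vec_def sum_distrib_left mult_ac)
  ultimately show ?thesis
    by (simp add: Sigma_bit_def matrix_vector_mult_add_rdistrib matrix_vector_mult_diff_rdistrib
        scaleR_matrix_vector_assoc[symmetric])
qed

text \<open>The law of total variance: the conditional variance given the cell contributes the
  identity part, and the conditional mean, linear in the one-hot table, contributes
  \<open>(alpha \<epsilon>)\<^sup>2\<close> times the multinomial covariance.\<close>

lemma bit_output_moments:
  fixes P :: "'k::finite pmf" and v :: "real^'k" and \<epsilon> :: real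
  defines "p \<equiv> \<chi> k. pmf P k"
  defines "m \<equiv> alpha \<epsilon> *\<^sub>R p + (1 / (exp (\<epsilon>/2) + 1)) *\<^sub>R 1"
  shows "measure_pmf.expectation (bit_output \<epsilon> P) (\<lambda>z. v \<bullet> (z - m)) = 0"
    and "measure_pmf.expectation (bit_output \<epsilon> P) (\<lambda>z. (v \<bullet> (z - m))\<^sup>2) = v \<bullet> (Sigma_bit \<epsilon> p *v v)"
proof -
  define s where "s = exp (\<epsilon>/2) / (exp (\<epsilon>/2) + 1)\<^sup>2"
  define mx where "mx k = alpha \<epsilon> *\<^sub>R axis k 1 + (1 / (exp (\<epsilon>/2) + 1)) *\<^sub>R (1::real^'k)" for k :: 'k
  note [simp] = integrable_measure_pmf_finite[OF finite_set_bit_mech]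
  have p1: "(\<Sum>k\<in>UNIV. p $ k) = 1"
    using sum_pmf_eq_1[of UNIV P] by (simp add: p_def)
  \<comment> \<open>Noise given the true cell \<open>k\<close>, plus the deviation of the
    conditional mean from the overall mean.\<close>
  have split: "v \<bullet> (z - m) = v \<bullet> (z - mx k) + alpha \<epsilon> * (v $ k - p \<bullet> v)" for z k
    by (simp add: m_def mx_def inner_diff_right inner_add_right algebra_simps inner_axis inner_commute[of v p])
  have E1: "measure_pmf.expectation (bit_mech (axis k 1) \<epsilon>) (\<lambda>z. v \<bullet> (z - mx k)) = 0"
    and E2: "measure_pmf.expectation (bit_mech (axis k 1) \<epsilon>) (\<lambda>z. (v \<bullet> (z - mx k))\<^sup>2) = s * (v \<bullet> v)" for k
    unfolding mx_def s_def by (rule bit_mech_moments; simp add: axis_def)+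
  have bind: "measure_pmf.expectation (bit_output \<epsilon> P) h
      = (\<Sum>k\<in>UNIV. p $ k * measure_pmf.expectation (bit_mech (axis k 1) \<epsilon>) h)" for h :: "_ \<Rightarrow> real"
    unfolding bit_output_def p_def
    by (subst pmf_expectation_bind[of UNIV]) (auto simp: finite_set_bit_mech)
  have pv: "(\<Sum>k\<in>UNIV. p $ k * v $ k) = p \<bullet> v"
    by (simp add: inner_vec_def)
  have mean_k: "measure_pmf.expectation (bit_mech (axis k 1) \<epsilon>) (\<lambda>z. v \<bullet> (z - m)) = alpha \<epsilon> * (v $ k - p \<bullet> v)" for k
    unfolding split[of _ k] using E1[of k] by simp
  have "measure_pmf.expectation (bit_output \<epsilon> P) (\<lambda>z. v \<bullet> (z - m)) = (\<Sum>k\<in>UNIV. alpha \<epsilon> * (p $ k * v $ k - (p \<bullet> v) * p $ k))"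
    unfolding bind mean_k by (simp add: algebra_simps)
  also have "\<dots> = 0"
    by (simp add: sum_distrib_left[symmetric] sum_subtractf pv p1)
  finally show "measure_pmf.expectation (bit_output \<epsilon> P) (\<lambda>z. v \<bullet> (z - m)) = 0" .
  have square_k: "measure_pmf.expectation (bit_mech (axis k 1) \<epsilon>) (\<lambda>z. (v \<bullet> (z - m))\<^sup>2)
      = s * (v \<bullet> v) + (alpha \<epsilon>)\<^sup>2 * (v $ k - p \<bullet> v)\<^sup>2" for k
  proof -
    let ?E = "measure_pmf.expectation (bit_mech (axis k 1) \<epsilon>)"
    have "?E (\<lambda>z. (v \<bullet> (z - m))\<^sup>2) = ?E (\<lambda>z. (v \<bullet> (z - mx k))\<^sup>2 + (2 * (alpha \<epsilon> * (v $ k - p \<bullet> v))) * (v \<bullet> (z - mx k))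
        + (alpha \<epsilon> * (v $ k - p \<bullet> v))\<^sup>2)"
      by (intro Bochner_Integration.integral_cong) (simp_all only: split[of _ k] power2_sum mult_ac add_ac)
    also have "\<dots> = ?E (\<lambda>z. (v \<bullet> (z - mx k))\<^sup>2) + (2 * (alpha \<epsilon> * (v $ k - p \<bullet> v))) * ?E (\<lambda>z. v \<bullet> (z - mx k))
        + (alpha \<epsilon> * (v $ k - p \<bullet> v))\<^sup>2"
      by (subst Bochner_Integration.integral_add, simp, simp, subst Bochner_Integration.integral_add, simp, simp,
          subst Bochner_Integration.integral_mult_right_zero, simp)
    finally show ?thesis unfolding E1 E2 by (simp add: power_mult_distrib)
  qed
  have "measure_pmf.expectation (bit_output \<epsilon> P) (\<lambda>z. (v \<bullet> (z - m))\<^sup>2)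
      = (\<Sum>k\<in>UNIV. s * (v \<bullet> v) * p $ k + (alpha \<epsilon>)\<^sup>2 * (p $ k * (v $ k)\<^sup>2 - 2 * (p \<bullet> v) * (p $ k * v $ k) + (p \<bullet> v)\<^sup>2 * p $ k))"
    unfolding bind square_k by (simp add: algebra_simps power2_eq_square)
  also have "\<dots> = s * (v \<bullet> v) + (alpha \<epsilon>)\<^sup>2 * ((\<Sum>k\<in>UNIV. p $ k * (v $ k)\<^sup>2) - (p \<bullet> v)\<^sup>2)"
    unfolding sum.distrib sum_subtractf sum_distrib_left[symmetric] pv p1 by (simp add: power2_eq_square)
  also have "\<dots> = v \<bullet> (Sigma_bit \<epsilon> p *v v)"
    unfolding Sigma_bit_mult s_def[symmetric]
    by (simp add: inner_add_right inner_diff_right inner_commute[of v p] power2_eq_square)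
       (simp add: inner_vec_def mult_ac)
  finally show "measure_pmf.expectation (bit_output \<epsilon> P) (\<lambda>z. (v \<bullet> (z - m))\<^sup>2) = v \<bullet> (Sigma_bit \<epsilon> p *v v)" .
qed

section \<open>The law of the privatized table\<close>

text \<open>The events need not exhaust the space; total probability 1 makes them exhaust it up to a
  null set.\<close>

lemma (in prob_space) expectation_finite_partition:
  fixes G :: "'a \<Rightarrow> real"
  assumes fin: "finite S" and D: "\<And>z. z \<in> S \<Longrightarrow> D z \<in> events" and disj: "disjoint_family_on D S"
    and total: "(\<Sum>z\<in>S. prob (D z)) = 1"
    and G: "G \<in> borel_measurable M" "\<And>z \<omega>. z \<in> S \<Longrightarrow> \<omega> \<in> D z \<Longrightarrow> G \<omega> = g z"
  shows "expectation G = (\<Sum>z\<in>S. prob (D z) * g z)"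
proof -
  have "prob (\<Union>z\<in>S. D z) = 1"
    using finite_measure_finite_Union[of S D] fin D disj total by auto
  then have cover: "AE \<omega> in M. \<omega> \<in> (\<Union>z\<in>S. D z)"
    by (subst AE_in_set_eq_1) (use fin D in auto)
  have "expectation G = expectation (\<lambda>\<omega>. \<Sum>z\<in>S. indicator (D z) \<omega> * g z)"
  proof (rule integral_cong_AE)
    show "(\<lambda>\<omega>. \<Sum>z\<in>S. indicator (D z) \<omega> * g z) \<in> borel_measurable M"
      using D by (intro borel_measurable_sum borel_measurable_times borel_measurable_const borel_measurable_indicator)
    show "AE \<omega> in M. G \<omega> = (\<Sum>z\<in>S. indicator (D z) \<omega> * g z)"
      using cover
    proof eventually_elim
      case (elim \<omega>)
      then obtain z where z: "z \<in> S" "\<omega> \<in> D z" by auto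
      have "(\<Sum>z'\<in>S. indicator (D z') \<omega> * g z') = (\<Sum>z'\<in>S. if z' = z then g z else 0)"
        using disj z by (intro sum.cong) (auto simp: disjoint_family_on_def indicator_def)
      then show ?case using z fin G(2) by simp
    qed
  qed fact
  also have "\<dots> = (\<Sum>z\<in>S. prob (D z) * g z)"
  proof (subst Bochner_Integration.integral_sum)
    show "integrable M (\<lambda>\<omega>. indicator (D z) \<omega> * g z)" if "z \<in> S" for z
      using D[OF that] by (intro integrable_mult_left) (auto simp: emeasure_eq_measure)
  qed (use D in auto)
  finally show ?thesis .
qed

text \<open>\<open>multinomial1_rv\<close> prescribes the probabilities of the basis vectors only.
  They add up to 1, which leaves probability 0 for all other values.\<close>

lemma (in prob_space) multinomial1_rv_AE:
  assumes U: "multinomial1_rv M p U" and p: "p \<in> pos_prob_vectors"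
  shows "AE \<omega> in M. \<exists>i. U \<omega> = axis i 1"
proof -
  have [measurable]: "U \<in> borel_measurable M" using U by (simp add: multinomial1_rv_def)
  define A where "A i = {\<omega> \<in> space M. U \<omega> = axis i 1}" for i
  have A: "A i \<in> events" for i unfolding A_def by measurable
  have "prob (\<Union>i\<in>UNIV. A i) = (\<Sum>i\<in>UNIV. prob (A i))"
    by (rule finite_measure_finite_Union) (use A in \<open>auto simp: disjoint_family_on_def A_def axis_eq_axis\<close>)
  also have "\<dots> = 1"
    using U p by (simp add: A_def multinomial1_rv_def pos_prob_vectors_def)
  finally have "AE \<omega> in M. \<omega> \<in> (\<Union>i\<in>UNIV. A i)"
    by (subst AE_in_set_eq_1) (use A in auto)
  then show ?thesis by eventually_elim (auto simp: A_def)
qed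

lemma cell_table_axis: "cell_table (axis i 1) (axis j 1) = axis (i, j) 1"
  by (auto simp: cell_table_def axis_def vec_eq_iff)

lemma borel_measurable_vec_nth [measurable (raw)]:
  fixes f :: "'a \<Rightarrow> real^'k"
  shows "f \<in> borel_measurable M \<Longrightarrow> (\<lambda>x. f x $ i) \<in> borel_measurable M"
  by (rule borel_measurable_continuous_on[where f="\<lambda>v. v $ i"]) (intro continuous_intros)

lemma borel_measurable_cell_table:
  assumes [measurable]: "U \<in> borel_measurable M" "V \<in> borel_measurable M"
  shows "(\<lambda>\<omega>. cell_table (U \<omega>) (V \<omega>)) \<in> borel_measurable M"
proof -
  have "(\<lambda>\<omega>. of_bool (U \<omega> $ i = 1 \<and> V \<omega> $ j = 1) :: real) \<in> borel_measurable M" for i j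
    unfolding of_bool_def by measurable
  then show ?thesis
    by (subst borel_measurable_euclidean_space) (auto simp: Basis_vec_def inner_axis cell_table_def)
qed

lemma pos_prob_vectors_pmf:
  assumes "p \<in> pos_prob_vectors"
  obtains P :: "'k::finite pmf" where "\<And>k. pmf P k = p $ k"
proof -
  have "pmf (embed_pmf (\<lambda>k. p $ k)) k = p $ k" for k
  proof (rule pmf_embed_pmf)
    show "(\<integral>\<^sup>+ x. ennreal (p $ x) \<partial>count_space UNIV) = 1"
      using assms by (simp add: nn_integral_count_space_finite pos_prob_vectors_def sum_ennreal less_imp_le)
  qed (use assms in \<open>simp add: pos_prob_vectors_def less_imp_le\<close>)
  then show thesis by (rule that)
qed

lemma sum_UNIV_prod:
  fixes f :: "'r::finite \<times> 'c::finite \<Rightarrow> 'd::comm_monoid_add"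
  shows "(\<Sum>k\<in>UNIV. f k) = (\<Sum>i\<in>UNIV. \<Sum>j\<in>UNIV. f (i, j))"
  by (simp add: sum.cartesian_product flip: UNIV_Times_UNIV)

lemma outer_pos_prob_vectors:
  "a \<in> pos_prob_vectors \<Longrightarrow> b \<in> pos_prob_vectors \<Longrightarrow> outer a b \<in> pos_prob_vectors"
  by (auto simp: pos_prob_vectors_def outer_def sum_UNIV_prod sum_distrib_left[symmetric])

text \<open>Independence acts at two levels: \<open>indep_vars\<close> factors the probability over
  the records, and \<open>indep_pair\<close> factors each record into its row and column
  probabilities.\<close>

lemma (in prob_space) prob_cell_tables:
  fixes U :: "nat \<Rightarrow> 'a \<Rightarrow> real^'r" and V :: "nat \<Rightarrow> 'a \<Rightarrow> real^'c"
  assumes I: "finite I" "I \<noteq> {}"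
    and pi1: "\<pi>1 \<in> pos_prob_vectors" and pi2: "\<pi>2 \<in> pos_prob_vectors"
    and indep: "indep_vars (\<lambda>_. borel) (\<lambda>l \<omega>. (U l \<omega>, V l \<omega>)) I"
    and U: "\<And>l. l \<in> I \<Longrightarrow> multinomial1_rv M \<pi>1 (U l)"
    and V: "\<And>l. l \<in> I \<Longrightarrow> multinomial1_rv M \<pi>2 (V l)"
    and UV: "\<And>l. l \<in> I \<Longrightarrow> indep_pair M borel (U l) borel (V l)"
  shows "prob {\<omega> \<in> space M. \<forall>l\<in>I. cell_table (U l \<omega>) (V l \<omega>) = axis (x l) 1} = (\<Prod>l\<in>I. outer \<pi>1 \<pi>2 $ x l)"
proof -
  have [measurable]: "U l \<in> borel_measurable M" "V l \<in> borel_measurable M" if "l \<in> I" for l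
    using U V that by (auto simp: multinomial1_rv_def)
  have ct [measurable]: "(\<lambda>\<omega>. cell_table (U l \<omega>) (V l \<omega>)) \<in> borel_measurable M" if "l \<in> I" for l
    using that by (intro borel_measurable_cell_table) auto
  define W where "W l = {(axis (fst (x l)) 1 :: real^'r, axis (snd (x l)) 1 :: real^'c)}" for l
  have W: "W l \<in> sets borel" for l by (simp add: W_def)
  \<comment> \<open>Vectors that are not one-hot, such as one with the entries 1 and 2, can give the
    same table, so the two events below agree only up to a null set.\<close>
  have AE_UV: "AE \<omega> in M. \<forall>l\<in>I. (\<exists>i. U l \<omega> = axis i 1) \<and> (\<exists>j. V l \<omega> = axis j 1)"
    using I U V pi1 pi2 by (subst AE_finite_all; auto intro!: multinomial1_rv_AE)
  have meas: "{\<omega> \<in> space M. \<forall>l\<in>I. cell_table (U l \<omega>) (V l \<omega>) = axis (x l) 1} \<in> events"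
    using I(1) ct by measurable
  have UVm: "(\<lambda>\<omega>. (U l \<omega>, V l \<omega>)) \<in> borel_measurable M" if "l \<in> I" for l
    using indep that by (simp add: indep_vars_def2)
  have "prob {\<omega> \<in> space M. \<forall>l\<in>I. cell_table (U l \<omega>) (V l \<omega>) = axis (x l) 1}
      = prob (\<Inter>l\<in>I. (\<lambda>\<omega>. (U l \<omega>, V l \<omega>)) -` W l \<inter> space M)"
  proof (rule finite_measure_eq_AE)
    show "AE \<omega> in M. \<omega> \<in> {\<omega> \<in> space M. \<forall>l\<in>I. cell_table (U l \<omega>) (V l \<omega>) = axis (x l) 1} \<longleftrightarrow>
        \<omega> \<in> (\<Inter>l\<in>I. (\<lambda>\<omega>. (U l \<omega>, V l \<omega>)) -` W l \<inter> space M)"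
      using AE_UV
    proof eventually_elim
      case (elim \<omega>)
      have "cell_table (U l \<omega>) (V l \<omega>) = axis (x l) 1 \<longleftrightarrow> (U l \<omega>, V l \<omega>) \<in> W l" if l: "l \<in> I" for l
      proof -
        obtain i j where "U l \<omega> = axis i 1" "V l \<omega> = axis j 1" using elim l by blast
        then show ?thesis by (cases "x l") (auto simp: cell_table_axis W_def axis_eq_axis)
      qed
      then show ?case using I(2) by auto
    qed
    show "(\<Inter>l\<in>I. (\<lambda>\<omega>. (U l \<omega>, V l \<omega>)) -` W l \<inter> space M) \<in> events"
      using I W by (intro sets.finite_INT measurable_sets[OF UVm]) auto
  qed (fact meas)
  also have "\<dots> = (\<Prod>l\<in>I. prob ((\<lambda>\<omega>. (U l \<omega>, V l \<omega>)) -` W l \<inter> space M))"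
    using indep I W by (intro indep_varsD_finite) auto
  also have "\<dots> = (\<Prod>l\<in>I. outer \<pi>1 \<pi>2 $ x l)"
  proof (rule prod.cong)
    fix l assume l: "l \<in> I"
    have set: "indep_set {U l -` A \<inter> space M | A. A \<in> sets borel} {V l -` B \<inter> space M | B. B \<in> sets borel}"
      using UV[OF l] by (simp add: indep_pair_def)
    have "prob ((U l -` {axis (fst (x l)) 1} \<inter> space M) \<inter> (V l -` {axis (snd (x l)) 1} \<inter> space M))
       = prob (U l -` {axis (fst (x l)) 1} \<inter> space M) * prob (V l -` {axis (snd (x l)) 1} \<inter> space M)"
      by (rule indep_setD[OF set]) auto
    moreover have "prob (U l -` {axis (fst (x l)) 1} \<inter> space M) = \<pi>1 $ fst (x l)"
      "prob (V l -` {axis (snd (x l)) 1} \<inter> space M) = \<pi>2 $ snd (x l)"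
      using U[OF l] V[OF l] by (auto simp: multinomial1_rv_def vimage_def Int_def conj_commute)
    moreover have "(\<lambda>\<omega>. (U l \<omega>, V l \<omega>)) -` W l \<inter> space M =
       (U l -` {axis (fst (x l)) 1} \<inter> space M) \<inter> (V l -` {axis (snd (x l)) 1} \<inter> space M)"
      by (auto simp: W_def)
    ultimately show "prob ((\<lambda>\<omega>. (U l \<omega>, V l \<omega>)) -` W l \<inter> space M) = outer \<pi>1 \<pi>2 $ x l"
      by (simp add: outer_def)
  qed simp
  finally show ?thesis .
qed

text \<open>Transfers every expectation of a function of the summed table to a product of finitely
  supported distributions. The inputs have a product law and the mechanism acts record by record, so
  the outputs have a product law whose factors are the mixtures \<open>bit_output\<close>.\<close>

lemma (in prob_space) expectation_mechanism_outputs: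
  fixes U :: "nat \<Rightarrow> 'a \<Rightarrow> real^'r" and V :: "nat \<Rightarrow> 'a \<Rightarrow> real^'c" and Z :: "nat \<Rightarrow> 'a \<Rightarrow> real^('r \<times> 'c)"
    and P :: "('r \<times> 'c) pmf"
  assumes I: "finite I" "I \<noteq> {}"
    and pi1: "\<pi>1 \<in> pos_prob_vectors" and pi2: "\<pi>2 \<in> pos_prob_vectors"
    and indep: "indep_vars (\<lambda>_. borel) (\<lambda>l \<omega>. (U l \<omega>, V l \<omega>)) I"
    and U: "\<And>l. l \<in> I \<Longrightarrow> multinomial1_rv M \<pi>1 (U l)"
    and V: "\<And>l. l \<in> I \<Longrightarrow> multinomial1_rv M \<pi>2 (V l)"
    and UV: "\<And>l. l \<in> I \<Longrightarrow> indep_pair M borel (U l) borel (V l)"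
    and Z: "\<And>l. l \<in> I \<Longrightarrow> Z l \<in> borel_measurable M"
    and mech: "mechanism_outputs M (\<lambda>x. bit_mech x \<epsilon>) (\<lambda>l \<omega>. cell_table (U l \<omega>) (V l \<omega>)) Z I"
    and P: "\<And>k. pmf P k = outer \<pi>1 \<pi>2 $ k"
    and F: "F \<in> borel_measurable borel"
  shows "expectation (\<lambda>\<omega>. F (\<Sum>l\<in>I. Z l \<omega>)) =
    measure_pmf.expectation (Pi_pmf I d (\<lambda>_. bit_output \<epsilon> P)) (\<lambda>z. F (\<Sum>l\<in>I. z l) :: real)"
proof -
  let ?X = "\<lambda>l \<omega>. cell_table (U l \<omega>) (V l \<omega>)"
  let ?Q = "Pi_pmf I d (\<lambda>_. bit_output \<epsilon> P)"
  have ct [measurable]: "?X l \<in> borel_measurable M" if "l \<in> I" for l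
    using U V that by (intro borel_measurable_cell_table) (auto simp: multinomial1_rv_def)
  note [measurable] = Z
  define D where "D z = {\<omega> \<in> space M. \<forall>l\<in>I. Z l \<omega> = z l}" for z
  have D: "D z \<in> events" for z
    unfolding D_def using I(1) by measurable
  define E where "E x = {\<omega> \<in> space M. \<forall>l\<in>I. ?X l \<omega> = axis (x l) 1}" for x
  have E: "E x \<in> events" for x
    unfolding E_def using I(1) by measurable
  have prob_E: "prob (E x) = (\<Prod>l\<in>I. pmf P (x l))" for x
    unfolding E_def using prob_cell_tables[OF I pi1 pi2 indep U V UV] by (simp add: P)
  let ?S = "PiE I (\<lambda>_. UNIV :: ('r \<times> 'c) set)"
  have finS: "finite ?S" using I by (intro finite_PiE) auto
  have disjE: "disjoint_family_on E ?S"
  proof (unfold disjoint_family_on_def, safe)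
    fix x y \<omega> assume xy: "x \<in> ?S" "y \<in> ?S" "x \<noteq> y" "\<omega> \<in> E x" "\<omega> \<in> E y"
    then have "x l = y l" if "l \<in> I" for l
      using that by (force simp: E_def axis_eq_axis)
    with xy have "x = y" by (intro PiE_ext[of x I _ y]) auto
    then show "\<omega> \<in> {}" using xy by simp
  qed
  have "(\<Sum>x\<in>?S. prob (E x)) = (\<Prod>l\<in>I. \<Sum>k\<in>UNIV. pmf P k)"
    unfolding prob_E by (subst prod_sum_PiE) (use I in auto)
  then have sumE: "(\<Sum>x\<in>?S. prob (E x)) = 1"
    by (simp add: sum_pmf_eq_1)
  have "prob (\<Union>x\<in>?S. E x) = 1"
    using finite_measure_finite_Union[OF finS _ disjE] E sumE by auto
  then have cover: "AE \<omega> in M. \<omega> \<in> (\<Union>x\<in>?S. E x)"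
    by (subst AE_in_set_eq_1) (use finS E in auto)
  have prob_D: "prob (D z) = (\<Prod>l\<in>I. pmf (bit_output \<epsilon> P) (z l))" for z
  proof -
    have "prob (D z) = prob (\<Union>x\<in>?S. E x \<inter> D z)"
    proof (rule finite_measure_eq_AE)
      show "AE \<omega> in M. \<omega> \<in> D z \<longleftrightarrow> \<omega> \<in> (\<Union>x\<in>?S. E x \<inter> D z)"
        using cover by eventually_elim auto
      show "(\<Union>x\<in>?S. E x \<inter> D z) \<in> events"
        using finS E D by (intro sets.finite_UN sets.Int) auto
    qed (rule D)
    also have "\<dots> = (\<Sum>x\<in>?S. prob (E x \<inter> D z))"
    proof (rule finite_measure_finite_Union[OF finS])
      show "(\<lambda>x. E x \<inter> D z) ` ?S \<subseteq> events"
        using E D by auto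
      show "disjoint_family_on (\<lambda>x. E x \<inter> D z) ?S"
        using disjE unfolding disjoint_family_on_def by blast
    qed
    also have "\<dots> = (\<Sum>x\<in>?S. (\<Prod>l\<in>I. pmf P (x l) * pmf (bit_mech (axis (x l) 1) \<epsilon>) (z l)))"
    proof (rule sum.cong)
      fix x
      have "E x \<inter> D z = {\<omega> \<in> space M. \<forall>l\<in>I. ?X l \<omega> = axis (x l) 1 \<and> Z l \<omega> = z l}"
        by (auto simp: E_def D_def)
      then have "prob (E x \<inter> D z) = prob (E x) * (\<Prod>l\<in>I. pmf (bit_mech (axis (x l) 1) \<epsilon>) (z l))"
        using mech[unfolded mechanism_outputs_def, rule_format, of "\<lambda>l. axis (x l) 1" z] by (simp add: E_def)
      then show "prob (E x \<inter> D z) = (\<Prod>l\<in>I. pmf P (x l) * pmf (bit_mech (axis (x l) 1) \<epsilon>) (z l))"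
        by (simp add: prob_E prod.distrib)
    qed simp
    \<comment> \<open>Distributivity: summing products over all choices of one cell per record gives
      the product of the sums over cells.\<close>
    also have "\<dots> = (\<Prod>l\<in>I. \<Sum>k\<in>UNIV. pmf P k * pmf (bit_mech (axis k 1) \<epsilon>) (z l))"
      by (subst prod_sum_PiE) (use I in auto)
    also have "\<dots> = (\<Prod>l\<in>I. pmf (bit_output \<epsilon> P) (z l))"
      unfolding bit_output_def pmf_bind by (subst integral_measure_pmf[of UNIV]) auto
    finally show ?thesis .
  qed
  have finQ: "finite (set_pmf ?Q)"
    using I by (auto simp: set_Pi_pmf finite_set_bit_output intro!: finite_PiE_dflt)
  \<comment> \<open>Support points agree outside \<open>I\<close>, so distinct ones already differ
    on \<open>I\<close>; this makes the events \<open>D z\<close> disjoint.\<close>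
  have dflt: "z l = d" if "z \<in> set_pmf ?Q" "l \<notin> I" for z l
    using that I by (auto simp: set_Pi_pmf PiE_dflt_def)
  have prob_D': "prob (D z) = pmf ?Q z" if "z \<in> set_pmf ?Q" for z
    unfolding prob_D using I dflt[OF that] by (subst pmf_Pi) auto
  have "expectation (\<lambda>\<omega>. F (\<Sum>l\<in>I. Z l \<omega>)) = (\<Sum>z\<in>set_pmf ?Q. prob (D z) * F (\<Sum>l\<in>I. z l))"
  proof (rule expectation_finite_partition[OF finQ D])
    show "disjoint_family_on D (set_pmf ?Q)"
    proof (unfold disjoint_family_on_def, safe)
      fix x y \<omega> assume xy: "x \<in> set_pmf ?Q" "y \<in> set_pmf ?Q" "x \<noteq> y" "\<omega> \<in> D x" "\<omega> \<in> D y"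
      have "x l = y l" for l
        using xy dflt[of x l] dflt[of y l] by (cases "l \<in> I") (auto simp: D_def)
      then show "\<omega> \<in> {}" using xy by blast
    qed
    show "(\<Sum>z\<in>set_pmf ?Q. prob (D z)) = 1"
      using sum_pmf_eq_1[OF finQ] by (simp add: prob_D' cong: sum.cong)
    show "(\<lambda>\<omega>. F (\<Sum>l\<in>I. Z l \<omega>)) \<in> borel_measurable M"
      using F by measurable
    show "F (\<Sum>l\<in>I. Z l \<omega>) = F (\<Sum>l\<in>I. z l)" if "\<omega> \<in> D z" for z \<omega>
      using that by (intro arg_cong[where f=F] sum.cong) (auto simp: D_def)
  qed
  also have "\<dots> = measure_pmf.expectation ?Q (\<lambda>z. F (\<Sum>l\<in>I. z l))"
    by (subst integral_measure_pmf[OF finQ]) (auto simp: prob_D' cong: sum.cong)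
  finally show ?thesis .
qed

section \<open>Covariance matrix and tangent space of the independence model\<close>

lemma outer_nth [simp]: "outer a b $ (i, j) = a $ i * b $ j"
  by (simp add: outer_def)

lemma norm_outer: "norm (outer a b) = norm a * norm b"
proof -
  have "(norm (outer a b))\<^sup>2 = (norm a)\<^sup>2 * (norm b)\<^sup>2"
    by (simp add: power2_norm_eq_inner inner_vec_def sum_UNIV_prod sum_product mult_ac)
  then show ?thesis
    by (metis norm_ge_zero power2_eq_imp_eq power_mult_distrib mult_nonneg_nonneg)
qed

lemma outer_add_left: "outer (a + a') b = outer a b + outer a' b"
  and outer_add_right: "outer a (b + b') = outer a b + outer a b'"
  and outer_scale_left: "outer (k *\<^sub>R a) b = k *\<^sub>R outer a b"
  and outer_scale_right: "outer a (k *\<^sub>R b) = k *\<^sub>R outer a b"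
  by (auto simp: outer_def vec_eq_iff algebra_simps)

text \<open>A crude bound through the l1 norm. Rows and columns get the same factor rc, so one
  constant \<open>m\<close> serves both margins later.\<close>

lemma norm_row_sums: "norm (\<chi> i. \<Sum>j\<in>UNIV. x $ (i, j)) \<le> real (CARD('r) * CARD('c)) * norm (x :: real^('r::finite \<times> 'c::finite))"
  (is "norm ?y \<le> _")
proof -
  have "norm ?y \<le> (\<Sum>i\<in>UNIV. \<bar>?y $ i\<bar>)" by (rule norm_le_l1_cart)
  also have "\<dots> \<le> (\<Sum>i\<in>(UNIV::'r set). \<Sum>j\<in>(UNIV::'c set). norm x)"
  proof (rule sum_mono)
    fix i :: 'r
    have "\<bar>\<Sum>j\<in>UNIV. x $ (i, j)\<bar> \<le> (\<Sum>j\<in>(UNIV::'c set). \<bar>x $ (i, j)\<bar>)" by (rule sum_abs)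
    also have "\<dots> \<le> (\<Sum>j\<in>(UNIV::'c set). norm x)" by (intro sum_mono component_le_norm_cart)
    finally show "\<bar>?y $ i\<bar> \<le> (\<Sum>j\<in>(UNIV::'c set). norm x)" by simp
  qed
  finally show ?thesis by simp
qed

lemma norm_col_sums: "norm (\<chi> j. \<Sum>i\<in>UNIV. x $ (i, j)) \<le> real (CARD('r) * CARD('c)) * norm (x :: real^('r::finite \<times> 'c::finite))"
  (is "norm ?y \<le> _")
proof -
  have "norm ?y \<le> (\<Sum>j\<in>UNIV. \<bar>?y $ j\<bar>)" by (rule norm_le_l1_cart)
  also have "\<dots> \<le> (\<Sum>j\<in>(UNIV::'c set). \<Sum>i\<in>(UNIV::'r set). norm x)"
  proof (rule sum_mono)
    fix j :: 'c
    have "\<bar>\<Sum>i\<in>UNIV. x $ (i, j)\<bar> \<le> (\<Sum>i\<in>(UNIV::'r set). \<bar>x $ (i, j)\<bar>)" by (rule sum_abs)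
    also have "\<dots> \<le> (\<Sum>i\<in>(UNIV::'r set). norm x)" by (intro sum_mono component_le_norm_cart)
    finally show "\<bar>?y $ j\<bar> \<le> (\<Sum>i\<in>(UNIV::'r set). norm x)" by simp
  qed
  finally show ?thesis by (simp add: mult_ac)
qed

lemma Pi_proj_mult: "Pi_proj *v (x :: real^'k) = x - ((\<Sum>k\<in>UNIV. x $ k) / real CARD('k)) *\<^sub>R 1"
  unfolding Pi_proj_def
  by (simp add: matrix_vector_mult_diff_rdistrib scaleR_matrix_vector_assoc[symmetric])
     (simp add: vec_eq_iff matrix_vector_mult_def)

lemma inner_1_vec: "x \<bullet> (1 :: real^'k) = (\<Sum>k\<in>UNIV. x $ k)"
  by (simp add: inner_vec_def)

lemma Pi_proj_sum_zero: "(\<Sum>k\<in>UNIV. x $ k) = 0 \<Longrightarrow> Pi_proj *v (x :: real^'k) = x"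
  by (simp add: Pi_proj_mult)

lemma Pi_proj_1: "Pi_proj *v (1 :: real^'k) = 0"
  by (simp add: Pi_proj_mult vec_eq_iff)

lemma Pi_proj_inner: "x \<bullet> (Pi_proj *v y) = (Pi_proj *v x) \<bullet> (y :: real^'k)"
  by (simp add: Pi_proj_mult inner_diff_left inner_diff_right inner_1_vec inner_commute[of 1 y])

lemma norm_Pi_proj_le: "norm (Pi_proj *v x) \<le> norm (x :: real^'k)"
proof -
  have "(\<Sum>k\<in>UNIV. (Pi_proj *v x) $ k) = 0"
    by (simp add: Pi_proj_mult sum_subtractf)
  then have "(norm (Pi_proj *v x))\<^sup>2 = x \<bullet> (Pi_proj *v x)"
    by (simp add: power2_norm_eq_inner Pi_proj_inner[symmetric] Pi_proj_sum_zero)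
  also have "\<dots> \<le> norm x * norm (Pi_proj *v x)" by (rule norm_cauchy_schwarz)
  finally show ?thesis
    by (cases "Pi_proj *v x = 0") (auto simp: power2_eq_square)
qed

lemma alpha_pos: "\<epsilon> > 0 \<Longrightarrow> alpha \<epsilon> > 0"
  by (simp add: alpha_def add_pos_pos)

lemma Sigma_bit_sym: "x \<bullet> (Sigma_bit \<epsilon> q *v y) = (Sigma_bit \<epsilon> q *v x) \<bullet> y"
proof -
  have "x \<bullet> (\<chi> k. q $ k * y $ k) = (\<chi> k. q $ k * x $ k) \<bullet> y"
    by (simp add: inner_vec_def mult_ac)
  then show ?thesis
    by (simp add: Sigma_bit_mult inner_add_left inner_add_right inner_diff_left inner_diff_right inner_commute[of q])
qed

text \<open>The multinomial part is \<open>(alpha \<epsilon>)\<^sup>2\<close> times the variance of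
  \<open>x\<close> under the weights \<open>q\<close>, hence nonnegative; the noise part
  remains.\<close>

lemma Sigma_bit_lower:
  fixes q x :: "real^'k"
  assumes q: "q \<in> pos_prob_vectors"
  shows "exp (\<epsilon>/2) / (exp (\<epsilon>/2) + 1)\<^sup>2 * (x \<bullet> x) \<le> x \<bullet> (Sigma_bit \<epsilon> q *v x)"
proof -
  have q1: "(\<Sum>k\<in>UNIV. q $ k) = 1" and q0: "\<And>k. 0 \<le> q $ k"
    using q by (auto simp: pos_prob_vectors_def less_imp_le)
  have "0 \<le> (\<Sum>k\<in>UNIV. q $ k * (x $ k - q \<bullet> x)\<^sup>2)"
    by (intro sum_nonneg mult_nonneg_nonneg q0) auto
  also have "\<dots> = (\<Sum>k\<in>UNIV. q $ k * (x $ k)\<^sup>2 - 2 * (q \<bullet> x) * (q $ k * x $ k) + (q \<bullet> x)\<^sup>2 * q $ k)"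
    by (simp add: algebra_simps power2_eq_square)
  also have "\<dots> = (\<Sum>k\<in>UNIV. q $ k * (x $ k)\<^sup>2) - (q \<bullet> x)\<^sup>2"
    unfolding sum.distrib sum_subtractf sum_distrib_left[symmetric] q1
    by (simp add: inner_vec_def power2_eq_square)
  finally have "0 \<le> (alpha \<epsilon>)\<^sup>2 * ((\<Sum>k\<in>UNIV. q $ k * (x $ k)\<^sup>2) - (q \<bullet> x)\<^sup>2)"
    by simp
  moreover have "x \<bullet> (\<chi> k. q $ k * x $ k) = (\<Sum>k\<in>UNIV. q $ k * (x $ k)\<^sup>2)"
    by (simp add: inner_vec_def power2_eq_square mult_ac)
  ultimately show ?thesis
    by (simp add: Sigma_bit_mult inner_add_right inner_diff_right inner_commute[of x q] power2_eq_square)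
qed

lemma bit_variance_pos: "exp (\<epsilon>/2) / (exp (\<epsilon>/2) + 1)\<^sup>2 > (0 :: real)"
  by (intro divide_pos_pos zero_less_power add_pos_pos) auto

lemma Sigma_bit_pos:
  assumes "q \<in> pos_prob_vectors" "x \<noteq> 0"
  shows "x \<bullet> (Sigma_bit \<epsilon> q *v x) > 0"
  using assms(2)
  by (intro less_le_trans[OF mult_pos_pos[OF bit_variance_pos] Sigma_bit_lower[OF assms(1)]]) simp

text \<open>A constant has variance 0 under \<open>q\<close>, so only the noise acts on
  \<open>1\<close>. With symmetry this makes the sum-zero tables invariant under the
  covariance.\<close>

lemma Sigma_bit_1:
  assumes "q \<in> pos_prob_vectors"
  shows "Sigma_bit \<epsilon> q *v 1 = (exp (\<epsilon>/2) / (exp (\<epsilon>/2) + 1)\<^sup>2) *\<^sub>R 1"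
proof -
  have "q \<bullet> 1 = 1" using assms by (simp add: inner_1_vec pos_prob_vectors_def)
  moreover have "(\<chi> k. q $ k * 1 $ k) = q" by (simp add: vec_eq_iff)
  ultimately show ?thesis by (simp add: Sigma_bit_mult)
qed

lemma invertible_Sigma_bit:
  assumes "q \<in> pos_prob_vectors"
  shows "invertible (Sigma_bit \<epsilon> q)"
proof -
  have "x = 0" if "Sigma_bit \<epsilon> q *v x = 0" for x
    using Sigma_bit_pos[OF assms, of x \<epsilon>] that by auto
  then show ?thesis
    unfolding invertible_left_inverse matrix_left_invertible_ker by blast
qed

text \<open>Derivatives of \<open>outer\<close> at the true margins. The directions sum to 0 because
  perturbed margins must stay probability vectors, which also makes the coordinates
  \<open>u\<close>, \<open>v\<close>, \<open>k\<close> unique.\<close>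

definition model_tangent :: "real^'r \<Rightarrow> real^'c \<Rightarrow> (real^('r \<times> 'c)) set" where
  "model_tangent \<pi>1 \<pi>2 = {outer u \<pi>2 + outer \<pi>1 v + k *\<^sub>R 1 | u v k.
     (\<Sum>i\<in>UNIV. u $ i) = 0 \<and> (\<Sum>j\<in>UNIV. v $ j) = 0}"

text \<open>Margins invert the parametrization of \<open>model_tangent\<close>: the total yields
  \<open>k\<close>, after which row sums yield \<open>u\<close> and column sums \<open>v\<close>.
  Both the dimension and the norm bounds for the coordinates come from this.\<close>

lemma row_sums_tangent:
  fixes \<pi>2 v :: "real^'c"
  assumes "(\<Sum>j\<in>UNIV. \<pi>2 $ j) = 1" "(\<Sum>j\<in>UNIV. v $ j) = 0"
  shows "(\<Sum>j\<in>UNIV. (outer u \<pi>2 + outer \<pi>1 v + k *\<^sub>R 1) $ (i, j)) = u $ i + real CARD('c) * k"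
    using assms by (simp add: sum.distrib sum_distrib_left[symmetric])

lemma col_sums_tangent:
  fixes \<pi>1 u :: "real^'r"
  assumes "(\<Sum>i\<in>UNIV. \<pi>1 $ i) = 1" "(\<Sum>i\<in>UNIV. u $ i) = 0"
  shows "(\<Sum>i\<in>UNIV. (outer u \<pi>2 + outer \<pi>1 v + k *\<^sub>R 1) $ (i, j)) = v $ j + real CARD('r) * k"
    using assms by (simp add: sum.distrib sum_distrib_right[symmetric])

lemma total_sum_tangent:
  fixes \<pi>2 v :: "real^'c" and u :: "real^'r"
  assumes "(\<Sum>j\<in>UNIV. \<pi>2 $ j) = 1" "(\<Sum>j\<in>UNIV. v $ j) = 0" "(\<Sum>i\<in>UNIV. u $ i) = 0"
  shows "(\<Sum>l\<in>UNIV. (outer u \<pi>2 + outer \<pi>1 v + k *\<^sub>R 1) $ l) = real (CARD('r) * CARD('c)) * k"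
    unfolding sum_UNIV_prod row_sums_tangent[OF assms(1,2)] using assms(3) by (simp add: sum.distrib)

lemma subspace_model_tangent: "subspace (model_tangent \<pi>1 \<pi>2)"
proof (rule subspaceI)
  show "0 \<in> model_tangent \<pi>1 \<pi>2"
    unfolding model_tangent_def
    by (rule CollectI, rule exI[of _ 0], rule exI[of _ 0], rule exI[of _ 0]) (simp add: outer_def vec_eq_iff)
next
  fix x y assume "x \<in> model_tangent \<pi>1 \<pi>2" "y \<in> model_tangent \<pi>1 \<pi>2"
  then obtain u v k u' v' k' where
    *: "x = outer u \<pi>2 + outer \<pi>1 v + k *\<^sub>R 1" "y = outer u' \<pi>2 + outer \<pi>1 v' + k' *\<^sub>R 1"
      "(\<Sum>i\<in>UNIV. u $ i) = 0" "(\<Sum>j\<in>UNIV. v $ j) = 0" "(\<Sum>i\<in>UNIV. u' $ i) = 0" "(\<Sum>j\<in>UNIV. v' $ j) = 0"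
    unfolding model_tangent_def by blast
  have "x + y = outer (u + u') \<pi>2 + outer \<pi>1 (v + v') + (k + k') *\<^sub>R 1"
    by (simp add: * outer_add_left outer_add_right algebra_simps)
  then show "x + y \<in> model_tangent \<pi>1 \<pi>2"
    unfolding model_tangent_def using *(3-6) by (force simp: sum.distrib)
next
  fix c x assume "x \<in> model_tangent \<pi>1 \<pi>2"
  then obtain u v k where
    *: "x = outer u \<pi>2 + outer \<pi>1 v + k *\<^sub>R 1" "(\<Sum>i\<in>UNIV. u $ i) = 0" "(\<Sum>j\<in>UNIV. v $ j) = 0"
    unfolding model_tangent_def by blast
  have "c *\<^sub>R x = outer (c *\<^sub>R u) \<pi>2 + outer \<pi>1 (c *\<^sub>R v) + (c * k) *\<^sub>R 1"
    by (simp add: * outer_scale_left outer_scale_right algebra_simps)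
  then show "c *\<^sub>R x \<in> model_tangent \<pi>1 \<pi>2"
    unfolding model_tangent_def using *(2,3) by (force simp: sum_distrib_left[symmetric])
qed

lemma dim_sum_zero: "dim {u :: real^'k. (\<Sum>i\<in>UNIV. u $ i) = 0} = CARD('k) - 1"
proof -
  have "dim {y \<in> UNIV. \<forall>x\<in>span {1 :: real^'k}. orthogonal x y} + dim (span {1 :: real^'k}) = dim (UNIV :: (real^'k) set)"
    by (rule dim_subspace_orthogonal_to_vectors) auto
  moreover have "{y \<in> UNIV. \<forall>x\<in>span {1 :: real^'k}. orthogonal x y} = {u :: real^'k. (\<Sum>i\<in>UNIV. u $ i) = 0}"
    by (auto simp: orthogonal_def span_singleton inner_commute[of 1] inner_1_vec)
  moreover have "dim (span {1 :: real^'k}) = 1"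
    by (simp add: dim_insert vec_eq_iff)
  ultimately show ?thesis by (simp add: dim_UNIV)
qed

lemma dim_model_tangent:
  fixes \<pi>1 :: "real^'r" and \<pi>2 :: "real^'c"
  assumes pi1: "(\<Sum>i\<in>UNIV. \<pi>1 $ i) = 1" and pi2: "(\<Sum>j\<in>UNIV. \<pi>2 $ j) = 1"
  shows "dim (model_tangent \<pi>1 \<pi>2) = (CARD('r) - 1) + (CARD('c) - 1) + 1"
proof -
  let ?X = "{u :: real^'r. (\<Sum>i\<in>UNIV. u $ i) = 0}" and ?Y = "{v :: real^'c. (\<Sum>j\<in>UNIV. v $ j) = 0}"
  define g where "g = (\<lambda>(u, v, k). outer u \<pi>2 + outer \<pi>1 v + k *\<^sub>R (1 :: real^('r \<times> 'c)))"
  let ?D = "?X \<times> (?Y \<times> (UNIV :: real set))"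
  have sub: "subspace ?X" "subspace ?Y"
    by (auto simp: subspace_def sum.distrib sum_distrib_left[symmetric])
  have subD: "subspace ?D" "subspace (?Y \<times> (UNIV :: real set))"
    by (intro subspace_Times sub subspace_UNIV)+
  have lin: "linear g"
    by (rule linearI) (auto simp: g_def outer_add_left outer_add_right outer_scale_left outer_scale_right algebra_simps)
  have "inj_on g ?D"
  proof (subst linear_injective_on_subspace_0[OF lin subD(1)], safe)
    fix u v k assume *: "(\<Sum>i\<in>UNIV. u $ i) = 0" "(\<Sum>j\<in>UNIV. v $ j) = 0" "g (u, v, k) = 0"
    then have g0: "outer u \<pi>2 + outer \<pi>1 v + k *\<^sub>R 1 = 0" by (simp add: g_def)
    have k: "k = 0" using total_sum_tangent[OF pi2 *(2,1), of \<pi>1 k] unfolding g0 by simp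
    have "u $ i = 0" for i using row_sums_tangent[OF pi2 *(2), of u \<pi>1 k i] k unfolding g0 by simp
    moreover have "v $ j = 0" for j using col_sums_tangent[OF pi1 *(1), of \<pi>2 v k j] k unfolding g0 by simp
    ultimately show "(u, v, k) = 0" using k by (simp add: vec_eq_iff zero_prod_def)
  qed
  then have "dim (g ` ?D) = dim ?D"
    by (intro dim_image_eq lin) (simp add: span_eq_iff[THEN iffD2, OF subD(1)])
  also have "\<dots> = (CARD('r) - 1) + (CARD('c) - 1) + 1"
    unfolding dim_Times[OF sub(1) subD(2)] dim_Times[OF sub(2) subspace_UNIV] dim_sum_zero
    by (simp only: dim_UNIV DIM_real add.assoc)
  also have "g ` ?D = model_tangent \<pi>1 \<pi>2"
    by (force simp: g_def model_tangent_def)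
  finally show ?thesis .
qed

lemma dim_orthogonal_model_tangent:
  fixes \<pi>1 :: "real^'r" and \<pi>2 :: "real^'c"
  assumes pi1: "(\<Sum>i\<in>UNIV. \<pi>1 $ i) = 1" and pi2: "(\<Sum>j\<in>UNIV. \<pi>2 $ j) = 1"
  shows "dim ((model_tangent \<pi>1 \<pi>2)\<^sup>\<bottom>) = (CARD('r) - 1) * (CARD('c) - 1)"
proof -
  have "dim {y \<in> UNIV. \<forall>x\<in>model_tangent \<pi>1 \<pi>2. orthogonal x y} + dim (model_tangent \<pi>1 \<pi>2)
      = dim (UNIV :: (real^('r \<times> 'c)) set)"
    by (rule dim_subspace_orthogonal_to_vectors) (auto simp: subspace_model_tangent)
  then have "dim ((model_tangent \<pi>1 \<pi>2)\<^sup>\<bottom>) + ((CARD('r) - 1) + (CARD('c) - 1) + 1) = CARD('r) * CARD('c)"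
    by (simp add: dim_model_tangent[OF assms] orthogonal_comp_def dim_UNIV orthogonal_commute)
  \<comment> \<open>Successors remove the truncated subtractions before the arithmetic.\<close>
  moreover obtain a b where "CARD('r) = Suc a" "CARD('c) = Suc b"
    by (metis zero_less_card_finite gr0_implies_Suc)
  ultimately show ?thesis by (simp add: algebra_simps)
qed

section \<open>The quadratic form of the inverse covariance\<close>

lemma bounded_matrix_vector:
  fixes A :: "real^'k^'k"
  obtains K where "K > 0" "\<And>x. norm (A *v x) \<le> K * norm x"
  using bounded_linear.pos_bounded[OF matrix_vector_mul_bounded_linear[of A]]
  by (auto simp: mult.commute)

text \<open>Pythagoras in the metric of the inverse matrix: \<open>A *v g w\<close> is the
  orthogonal projection of \<open>w\<close> onto the image under \<open>A\<close> of the span of the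
  \<open>l i\<close>. It has the sum of squares as its squared length, and the residual only adds a
  nonnegative amount.\<close>

lemma quadratic_inv_lower:
  fixes A :: "real^'k^'k" and l :: "nat \<Rightarrow> real^'k"
  assumes sym: "\<And>x y. x \<bullet> (A *v y) = (A *v x) \<bullet> y" and pos: "\<And>x. x \<noteq> 0 \<Longrightarrow> x \<bullet> (A *v x) > 0"
    and inv: "invertible A"
    and l: "\<And>i j. i < m \<Longrightarrow> j < m \<Longrightarrow> l i \<bullet> (A *v l j) = of_bool (i = j)"
  defines "g \<equiv> \<lambda>w. \<Sum>i<m. (l i \<bullet> w) *\<^sub>R l i"
  shows "\<And>w j. j < m \<Longrightarrow> l j \<bullet> (w - A *v g w) = 0"
    and "\<And>w. (A *v g w) \<bullet> (matrix_inv A *v (A *v g w)) = (\<Sum>i<m. (l i \<bullet> w)\<^sup>2)"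
    and "\<And>w. (\<Sum>i<m. (l i \<bullet> w)\<^sup>2) \<le> w \<bullet> (matrix_inv A *v w)"
proof -
  note BA = matrix_inv_right_left[OF inv]
  have BA': "matrix_inv A *v (A *v x) = x" "A *v (matrix_inv A *v x) = x" for x
    by (simp_all add: matrix_vector_mul_assoc BA)
  have lg: "l j \<bullet> (A *v g w) = l j \<bullet> w" if "j < m" for j w
  proof -
    have "l j \<bullet> (A *v g w) = (\<Sum>i<m. (l i \<bullet> w) * (l j \<bullet> (A *v l i)))"
      by (simp add: g_def linear_sum[OF matrix_vector_mul_linear] matrix_vector_mult_scaleR inner_sum_right)
    also have "\<dots> = (\<Sum>i<m. if i = j then l j \<bullet> w else 0)"
      by (intro sum.cong) (use l that in auto)
    finally show ?thesis using that by simp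
  qed
  then show ort: "l j \<bullet> (w - A *v g w) = 0" if "j < m" for j w
    using that by (simp add: inner_diff_right)
  show eq: "(A *v g w) \<bullet> (matrix_inv A *v (A *v g w)) = (\<Sum>i<m. (l i \<bullet> w)\<^sup>2)" for w
  proof -
    have "(A *v g w) \<bullet> (matrix_inv A *v (A *v g w)) = g w \<bullet> (A *v g w)"
      by (simp add: BA' inner_commute)
    also have "\<dots> = (\<Sum>i<m. (l i \<bullet> w) * (l i \<bullet> (A *v g w)))"
      by (subst g_def) (simp add: inner_sum_left)
    also have "\<dots> = (\<Sum>i<m. (l i \<bullet> w)\<^sup>2)"
      by (intro sum.cong) (auto simp: lg power2_eq_square)
    finally show ?thesis .
  qed
  show "(\<Sum>i<m. (l i \<bullet> w)\<^sup>2) \<le> w \<bullet> (matrix_inv A *v w)" for w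
  proof -
    \<comment> \<open>\<open>g w + s\<close> is the image of \<open>w\<close> under the inverse; the
      cross terms vanish because \<open>g w\<close> is orthogonal to the residual
      \<open>t\<close>.\<close>
    define t where "t = w - A *v g w"
    define s where "s = matrix_inv A *v t"
    have As: "A *v s = t" by (simp add: s_def BA')
    have "g w \<bullet> t = 0"
      by (simp add: g_def inner_sum_left) (use ort in \<open>auto simp: t_def g_def\<close>)
    moreover have "(A *v g w) \<bullet> s = g w \<bullet> t"
      using sym[of "g w" s] by (simp add: As)
    moreover have "t \<bullet> s \<ge> 0"
      using pos[of s] As by (cases "s = 0") (auto simp: inner_commute less_imp_le)
    moreover have "w \<bullet> (matrix_inv A *v w) = (A *v g w + t) \<bullet> (g w + s)"
      by (simp add: t_def s_def matrix_vector_mult_diff_distrib BA')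
    ultimately have "(A *v g w) \<bullet> g w \<le> w \<bullet> (matrix_inv A *v w)"
      by (simp add: inner_add_left inner_add_right inner_commute)
    then show ?thesis
      using eq[of w] by (simp add: BA')
  qed
qed

text \<open>With y the image of x under the inverse, the form at x equals the covariance form at y.
  That is at least the noise variance times |y|^2, and |x| <= K |y|.\<close>

lemma matrix_inv_Sigma_bit_lower:
  assumes q: "q \<in> pos_prob_vectors"
  obtains c where "c > 0" "\<And>x. c * (norm x)\<^sup>2 \<le> x \<bullet> (matrix_inv (Sigma_bit \<epsilon> q) *v x)"
proof -
  define s where "s = exp (\<epsilon>/2) / (exp (\<epsilon>/2) + 1)\<^sup>2"
  obtain K where K: "K > 0" "\<And>x. norm (Sigma_bit \<epsilon> q *v x) \<le> K * norm x"
    using bounded_matrix_vector by blast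
  have "s / K\<^sup>2 * (norm x)\<^sup>2 \<le> x \<bullet> (matrix_inv (Sigma_bit \<epsilon> q) *v x)" for x
  proof -
    define y where "y = matrix_inv (Sigma_bit \<epsilon> q) *v x"
    have x: "x = Sigma_bit \<epsilon> q *v y"
      using matrix_inv_right_left[OF invertible_Sigma_bit[OF q]] by (simp add: y_def matrix_vector_mul_assoc)
    have "(norm x)\<^sup>2 \<le> (K * norm y)\<^sup>2"
      unfolding x by (intro power_mono K) auto
    then have "s / K\<^sup>2 * (norm x)\<^sup>2 \<le> s / K\<^sup>2 * (K * norm y)\<^sup>2"
      using bit_variance_pos[of \<epsilon>] by (intro mult_left_mono) (auto simp: s_def[symmetric])
    also have "\<dots> = s * (y \<bullet> y)"
      using K(1) by (simp add: power_mult_distrib power2_norm_eq_inner)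
    also have "\<dots> \<le> y \<bullet> (Sigma_bit \<epsilon> q *v y)"
      unfolding s_def by (rule Sigma_bit_lower[OF q])
    also have "\<dots> = x \<bullet> y" using x by (metis inner_commute)
    finally show ?thesis by (simp add: y_def)
  qed
  moreover have "s / K\<^sup>2 > 0"
    using K(1) bit_variance_pos[of \<epsilon>] unfolding s_def by (intro divide_pos_pos) auto
  ultimately show thesis by (rule that[rotated])
qed

lemma norm_1_vec_le: "norm (1 :: real^'k) \<le> real CARD('k)"
  using norm_le_l1_cart[of "1 :: real^'k"] by simp

text \<open>Each coordinate is a margin of \<open>t\<close> corrected by a multiple of
  \<open>1\<close>; both pieces are at most rc times the norm of \<open>t\<close>, which gives 2rc.
  This is relaxed to 2(rc)^2 in the statement.\<close>

lemma model_tangent_coords: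
  fixes \<pi>1 :: "real^'r" and \<pi>2 :: "real^'c" and t :: "real^('r \<times> 'c)"
  assumes pi1: "(\<Sum>i\<in>UNIV. \<pi>1 $ i) = 1" and pi2: "(\<Sum>j\<in>UNIV. \<pi>2 $ j) = 1"
    and t: "t \<in> model_tangent \<pi>1 \<pi>2"
  obtains u v k where "t = outer u \<pi>2 + outer \<pi>1 v + k *\<^sub>R 1"
    "(\<Sum>i\<in>UNIV. u $ i) = 0" "(\<Sum>j\<in>UNIV. v $ j) = 0"
    "norm u \<le> 2 * (real (CARD('r) * CARD('c)))\<^sup>2 * norm t" "norm v \<le> 2 * (real (CARD('r) * CARD('c)))\<^sup>2 * norm t"
proof -
  define m where "m = real (CARD('r) * CARD('c))"
  have r1: "real CARD('r) \<ge> 1" and c1: "real CARD('c) \<ge> 1"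
    by (simp_all add: Suc_le_eq real_of_nat_ge_one_iff)
  have m1: "m \<ge> 1" using mult_mono[OF r1 c1] by (simp add: m_def)
  obtain u v k where *: "t = outer u \<pi>2 + outer \<pi>1 v + k *\<^sub>R 1"
    "(\<Sum>i\<in>UNIV. u $ i) = 0" "(\<Sum>j\<in>UNIV. v $ j) = 0"
    using t unfolding model_tangent_def by blast
  have "m * \<bar>k\<bar> = \<bar>\<Sum>l\<in>UNIV. t $ l\<bar>"
    unfolding *(1) total_sum_tangent[OF pi2 *(3,2)] by (simp add: m_def abs_mult)
  also have "\<dots> \<le> (\<Sum>l\<in>(UNIV :: ('r \<times> 'c) set). norm t)"
    by (intro order_trans[OF sum_abs] sum_mono component_le_norm_cart)
  also have "\<dots> = m * norm t" by (simp add: m_def)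
  finally have k: "\<bar>k\<bar> \<le> norm t" using m1 by simp
  have n1r: "norm (k *\<^sub>R (1 :: real^'r)) \<le> real CARD('r) * norm t"
    and n1c: "norm (k *\<^sub>R (1 :: real^'c)) \<le> real CARD('c) * norm t"
    using mult_mono[OF k norm_1_vec_le] by (simp_all add: mult.commute)
  have mm: "m \<le> m\<^sup>2" using m1 by (simp add: power2_eq_square)
  have "u = (\<chi> i. \<Sum>j\<in>UNIV. t $ (i, j)) - real CARD('c) *\<^sub>R (k *\<^sub>R 1)"
    by (simp only: vec_eq_iff vec_lambda_beta *(1) row_sums_tangent[OF pi2 *(3)]) simp
  then have "norm u \<le> norm (\<chi> i. \<Sum>j\<in>UNIV. t $ (i, j)) + norm (real CARD('c) *\<^sub>R (k *\<^sub>R (1 :: real^'r)))"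
    by (simp only: norm_triangle_ineq4)
  also have "norm (real CARD('c) *\<^sub>R (k *\<^sub>R (1 :: real^'r))) = real CARD('c) * norm (k *\<^sub>R (1 :: real^'r))"
    by (simp only: norm_scaleR[of "real CARD('c)"] abs_of_nat)
  also have "norm (\<chi> i. \<Sum>j\<in>UNIV. t $ (i, j)) + \<dots> \<le> m * norm t + real CARD('c) * (real CARD('r) * norm t)"
    unfolding m_def by (intro add_mono norm_row_sums mult_left_mono n1r) auto
  also have "\<dots> = 2 * m * norm t" by (simp add: m_def)
  also have "\<dots> \<le> 2 * m\<^sup>2 * norm t" using mm by (intro mult_right_mono mult_left_mono) auto
  finally have nu: "norm u \<le> 2 * m\<^sup>2 * norm t" .
  have "v = (\<chi> j. \<Sum>i\<in>UNIV. t $ (i, j)) - real CARD('r) *\<^sub>R (k *\<^sub>R 1)"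
    by (simp only: vec_eq_iff vec_lambda_beta *(1) col_sums_tangent[OF pi1 *(2)]) simp
  then have "norm v \<le> norm (\<chi> j. \<Sum>i\<in>UNIV. t $ (i, j)) + norm (real CARD('r) *\<^sub>R (k *\<^sub>R (1 :: real^'c)))"
    by (simp only: norm_triangle_ineq4)
  also have "norm (real CARD('r) *\<^sub>R (k *\<^sub>R (1 :: real^'c))) = real CARD('r) * norm (k *\<^sub>R (1 :: real^'c))"
    by (simp only: norm_scaleR[of "real CARD('r)"] abs_of_nat)
  also have "norm (\<chi> j. \<Sum>i\<in>UNIV. t $ (i, j)) + \<dots> \<le> m * norm t + real CARD('r) * (real CARD('c) * norm t)"
    unfolding m_def by (intro add_mono norm_col_sums mult_left_mono n1c) auto
  also have "\<dots> = 2 * m * norm t" by (simp add: m_def)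
  also have "\<dots> \<le> 2 * m\<^sup>2 * norm t" using mm by (intro mult_right_mono mult_left_mono) auto
  finally have nv: "norm v \<le> 2 * m\<^sup>2 * norm t" .
  show thesis using that[OF * nu[unfolded m_def] nv[unfolded m_def]] .
qed

text \<open>The noise offset in \<open>p_tilde\<close> cancels in the difference of two models, and
  the prefactor 1/n absorbs the two factors sqrt n.\<close>

lemma T_bitflip_standardized:
  fixes \<epsilon> :: real and \<theta>1 :: "real^'r" and \<theta>2 :: "real^'c" and \<pi>1 :: "real^'r" and \<pi>2 :: "real^'c" and Y :: "real^('r \<times> 'c)"
  assumes n: "n \<ge> 1"
  defines "H \<equiv> real n *\<^sub>R p_tilde \<epsilon> \<pi>1 \<pi>2 + sqrt n *\<^sub>R Y"
  assumes inv: "invertible (Sigma_tilde \<epsilon> n H)"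
  defines "x \<equiv> Pi_proj *v (Y - (sqrt n * alpha \<epsilon>) *\<^sub>R (outer \<theta>1 \<theta>2 - outer \<pi>1 \<pi>2))"
  shows "T_bitflip \<epsilon> n H \<theta>1 \<theta>2 = x \<bullet> (matrix_inv (Sigma_tilde \<epsilon> n H) *v x)"
proof -
  define w where "w = Y - (sqrt n * alpha \<epsilon>) *\<^sub>R (outer \<theta>1 \<theta>2 - outer \<pi>1 \<pi>2)"
  have "H - real n *\<^sub>R p_tilde \<epsilon> \<theta>1 \<theta>2 = sqrt n *\<^sub>R Y - (real n * alpha \<epsilon>) *\<^sub>R (outer \<theta>1 \<theta>2 - outer \<pi>1 \<pi>2)"
    by (simp add: H_def p_tilde_def algebra_simps)
  also have "\<dots> = sqrt n *\<^sub>R w"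
    by (simp add: w_def scaleR_diff_right mult.assoc[symmetric])
  finally have "T_bitflip \<epsilon> n H \<theta>1 \<theta>2 = 1 / real n * ((sqrt n *\<^sub>R w) \<bullet> (M_tilde \<epsilon> n H *v (sqrt n *\<^sub>R w)))"
    using inv by (simp add: T_bitflip_def)
  also have "\<dots> = w \<bullet> (M_tilde \<epsilon> n H *v w)"
    using n by (simp add: matrix_vector_mult_scaleR mult.assoc[symmetric])
  also have "\<dots> = x \<bullet> (matrix_inv (Sigma_tilde \<epsilon> n H) *v x)"
    by (simp add: M_tilde_def matrix_vector_mul_assoc[symmetric] Pi_proj_inner x_def w_def)
  finally show ?thesis .
qed

text \<open>The estimated margins miss the true ones by margins of \<open>Y\<close> divided by alpha
  sqrt n. For bounded \<open>Y\<close> they thus all enter one neighbourhood of the true margins on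
  which inversion is continuous, and this gives the uniformity.\<close>

lemma Sigma_tilde_perturbation:
  fixes \<pi>1 :: "real^'r" and \<pi>2 :: "real^'c"
  assumes eps: "\<epsilon> > 0" and pi1: "\<pi>1 \<in> pos_prob_vectors" and pi2: "\<pi>2 \<in> pos_prob_vectors" and \<delta>: "\<delta> > 0"
  shows "\<forall>\<^sub>F n in sequentially. \<forall>Y :: real^('r \<times> 'c). norm Y \<le> B \<longrightarrow>
    (let S = Sigma_tilde \<epsilon> n (real n *\<^sub>R p_tilde \<epsilon> \<pi>1 \<pi>2 + sqrt n *\<^sub>R Y) in
     invertible S \<and> (\<forall>x. \<bar>x \<bullet> (matrix_inv S *v x) - x \<bullet> (matrix_inv (Sigma_bit \<epsilon> (outer \<pi>1 \<pi>2)) *v x)\<bar> \<le> \<delta> * (norm x)\<^sup>2))"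
proof -
  define A where "A = Sigma_bit \<epsilon> (outer \<pi>1 \<pi>2)"
  define S where "S = (\<lambda>ab. Sigma_bit \<epsilon> (outer (fst ab :: real^'r) (snd ab :: real^'c)))"
  define m where "m = real (CARD('r) * CARD('c))"
  have s1: "(\<Sum>i\<in>UNIV. \<pi>1 $ i) = 1" and s2: "(\<Sum>j\<in>UNIV. \<pi>2 $ j) = 1"
    using pi1 pi2 by (auto simp: pos_prob_vectors_def)
  have \<alpha>: "alpha \<epsilon> > 0" using eps by (rule alpha_pos)
  have inv: "invertible A"
    unfolding A_def by (intro invertible_Sigma_bit outer_pos_prob_vectors pi1 pi2)
  have S_lim: "(S \<longlongrightarrow> A) (nhds (\<pi>1, \<pi>2))"
  proof -
    have "((\<lambda>ab. Sigma_bit \<epsilon> (outer (fst ab :: real^'r) (snd ab :: real^'c)) $ k $ l)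
        \<longlongrightarrow> Sigma_bit \<epsilon> (outer \<pi>1 \<pi>2) $ k $ l) (nhds (\<pi>1, \<pi>2))" for k l
    proof -
      have 1: "((\<lambda>ab. fst ab $ i) \<longlongrightarrow> \<pi>1 $ i) (nhds (\<pi>1, \<pi>2))" for i
        using tendsto_vec_nth[OF tendsto_fst[OF filterlim_ident]] by fastforce
      have 2: "((\<lambda>ab. snd ab $ j) \<longlongrightarrow> \<pi>2 $ j) (nhds (\<pi>1, \<pi>2))" for j
        using tendsto_vec_nth[OF tendsto_snd[OF filterlim_ident]] by fastforce
      show ?thesis
        by (auto simp: Sigma_bit_def Diag_def outer_def intro!: tendsto_intros 1 2)
    qed
    then show ?thesis
      unfolding S_def A_def by (intro vec_tendstoI)
  qed
  have "((\<lambda>E. onorm ((*v) (E - matrix_inv A))) \<longlongrightarrow> 0) (nhds (matrix_inv A))"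
  proof -
    \<comment> \<open>Entrywise convergence of the inverses becomes convergence in operator norm,
      which bounds the quadratic forms for all \<open>x\<close> at once.\<close>
    have b: "onorm ((*v) E) \<le> (\<Sum>i\<in>UNIV. \<Sum>j\<in>UNIV. \<bar>E $ i $ j\<bar>)" for E :: "real^('r \<times> 'c)^('r \<times> 'c)"
      by (rule onorm_le_matrix_component_sum)
    have "((\<lambda>E. \<Sum>i\<in>UNIV. \<Sum>j\<in>UNIV. \<bar>(E - matrix_inv A) $ i $ j\<bar>) \<longlongrightarrow>
        (\<Sum>i\<in>UNIV. \<Sum>j\<in>UNIV. \<bar>(matrix_inv A - matrix_inv A) $ i $ j\<bar>)) (nhds (matrix_inv A))"
      by (intro tendsto_intros filterlim_ident)
    then have "((\<lambda>E. \<Sum>i\<in>UNIV. \<Sum>j\<in>UNIV. \<bar>(E - matrix_inv A) $ i $ j\<bar>) \<longlongrightarrow> 0) (nhds (matrix_inv A))"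
      by simp
    then show ?thesis
      by (rule Lim_null_comparison[rotated])
         (use b[of "_ - matrix_inv A"] in \<open>auto intro!: always_eventually simp: onorm_pos_le matrix_vector_mul_bounded_linear\<close>)
  qed
  then have "\<forall>\<^sub>F E in nhds (matrix_inv A). onorm ((*v) (E - matrix_inv A)) < \<delta>"
    by (rule order_tendstoD) (rule \<delta>)
  then have "\<forall>\<^sub>F ab in nhds (\<pi>1, \<pi>2). onorm ((*v) (matrix_inv (S ab) - matrix_inv A)) < \<delta>"
    by (rule eventually_compose_filterlim) (rule tendsto_matrix_inv(2)[OF S_lim inv])
  with tendsto_matrix_inv(1)[OF S_lim inv]
  have "\<forall>\<^sub>F ab in nhds (\<pi>1, \<pi>2). invertible (S ab) \<and> onorm ((*v) (matrix_inv (S ab) - matrix_inv A)) < \<delta>"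
    by eventually_elim auto
  then obtain d where d: "d > 0" "\<And>ab. dist ab (\<pi>1, \<pi>2) < d \<Longrightarrow>
      invertible (S ab) \<and> onorm ((*v) (matrix_inv (S ab) - matrix_inv A)) < \<delta>"
    unfolding eventually_nhds_metric by blast
  \<comment> \<open>The factor 2 accounts for the errors of both margins.\<close>
  have "(\<lambda>n. 2 * (m * B / alpha \<epsilon>) / sqrt (real n)) \<longlonglongrightarrow> 0"
    by (intro tendsto_divide_0[OF tendsto_const] filterlim_at_top_imp_at_infinity
        filterlim_compose[OF sqrt_at_top] filterlim_real_sequentially)
  then have "\<forall>\<^sub>F n in sequentially. 2 * (m * B / alpha \<epsilon>) / sqrt (real n) < d"
    by (rule order_tendstoD) (rule d)
  with eventually_ge_at_top[of 1] show ?thesis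
  proof eventually_elim
    case (elim n)
    show ?case
    proof (intro allI impI)
      fix Y :: "real^('r \<times> 'c)" assume Y: "norm Y \<le> B"
      define H where "H = real n *\<^sub>R p_tilde \<epsilon> \<pi>1 \<pi>2 + sqrt n *\<^sub>R Y"
      have n: "real n > 0" using elim by simp
      have sq: "sqrt (real n) / real n = 1 / sqrt (real n)"
        using n by (simp add: field_simps)
      have p1: "pi1_tilde \<epsilon> n H - \<pi>1 = (1 / (alpha \<epsilon> * sqrt n)) *\<^sub>R (\<chi> i. \<Sum>j\<in>UNIV. Y $ (i, j))"
      proof (rule vec_eq_iff[THEN iffD2], rule allI)
        fix i
        have "(\<Sum>j\<in>UNIV. H $ (i, j)) = real n * (alpha \<epsilon> * \<pi>1 $ i + real CARD('c) / (exp (\<epsilon>/2) + 1)) + sqrt n * (\<Sum>j\<in>UNIV. Y $ (i, j))"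
          by (simp add: H_def p_tilde_def sum.distrib sum_distrib_left[symmetric] s2)
        then have "(\<Sum>j\<in>UNIV. H $ (i, j)) / real n = alpha \<epsilon> * \<pi>1 $ i + real CARD('c) / (exp (\<epsilon>/2) + 1) + (sqrt n / real n) * (\<Sum>j\<in>UNIV. Y $ (i, j))"
          using n by (simp add: add_divide_distrib)
        then show "(pi1_tilde \<epsilon> n H - \<pi>1) $ i = ((1 / (alpha \<epsilon> * sqrt n)) *\<^sub>R (\<chi> i. \<Sum>j\<in>UNIV. Y $ (i, j))) $ i"
          using \<alpha> by (simp add: pi1_tilde_def sq add_divide_distrib)
      qed
      have p2: "pi2_tilde \<epsilon> n H - \<pi>2 = (1 / (alpha \<epsilon> * sqrt n)) *\<^sub>R (\<chi> j. \<Sum>i\<in>UNIV. Y $ (i, j))"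
      proof (rule vec_eq_iff[THEN iffD2], rule allI)
        fix j
        have "(\<Sum>i\<in>UNIV. H $ (i, j)) = real n * (alpha \<epsilon> * \<pi>2 $ j + real CARD('r) / (exp (\<epsilon>/2) + 1)) + sqrt n * (\<Sum>i\<in>UNIV. Y $ (i, j))"
          by (simp add: H_def p_tilde_def sum.distrib sum_distrib_left[symmetric] sum_distrib_right[symmetric] s1)
        then have "(\<Sum>i\<in>UNIV. H $ (i, j)) / real n = alpha \<epsilon> * \<pi>2 $ j + real CARD('r) / (exp (\<epsilon>/2) + 1) + (sqrt n / real n) * (\<Sum>i\<in>UNIV. Y $ (i, j))"
          using n by (simp add: add_divide_distrib)
        then show "(pi2_tilde \<epsilon> n H - \<pi>2) $ j = ((1 / (alpha \<epsilon> * sqrt n)) *\<^sub>R (\<chi> j. \<Sum>i\<in>UNIV. Y $ (i, j))) $ j"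
          using \<alpha> by (simp add: pi2_tilde_def sq add_divide_distrib)
      qed
      have m0: "m \<ge> 0" by (simp add: m_def)
      have n1: "norm (pi1_tilde \<epsilon> n H - \<pi>1) \<le> (m * B / alpha \<epsilon>) / sqrt (real n)"
      proof -
        have "norm (pi1_tilde \<epsilon> n H - \<pi>1) \<le> 1 / (alpha \<epsilon> * sqrt n) * (m * norm Y)"
          unfolding p1 using \<alpha> n norm_row_sums[of Y] by (simp add: m_def divide_right_mono)
        also have "\<dots> \<le> 1 / (alpha \<epsilon> * sqrt n) * (m * B)"
          using \<alpha> n Y m0 by (intro mult_left_mono) auto
        finally show ?thesis by simp
      qed
      have n2: "norm (pi2_tilde \<epsilon> n H - \<pi>2) \<le> (m * B / alpha \<epsilon>) / sqrt (real n)"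
      proof -
        have "norm (pi2_tilde \<epsilon> n H - \<pi>2) \<le> 1 / (alpha \<epsilon> * sqrt n) * (m * norm Y)"
          unfolding p2 using \<alpha> n norm_col_sums[of Y] by (simp add: m_def divide_right_mono)
        also have "\<dots> \<le> 1 / (alpha \<epsilon> * sqrt n) * (m * B)"
          using \<alpha> n Y m0 by (intro mult_left_mono) auto
        finally show ?thesis by simp
      qed
      have "dist (pi1_tilde \<epsilon> n H, pi2_tilde \<epsilon> n H) (\<pi>1, \<pi>2) \<le> norm (pi1_tilde \<epsilon> n H - \<pi>1) + norm (pi2_tilde \<epsilon> n H - \<pi>2)"
        unfolding dist_norm by (simp add: norm_Pair sqrt_sum_squares_le_sum)
      also have "\<dots> < d" using n1 n2 elim by linarith
      finally have *: "invertible (Sigma_tilde \<epsilon> n H)" "onorm ((*v) (matrix_inv (Sigma_tilde \<epsilon> n H) - matrix_inv A)) < \<delta>"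
        using d(2) by (auto simp: S_def Sigma_tilde_def)
      have "\<bar>x \<bullet> (matrix_inv (Sigma_tilde \<epsilon> n H) *v x) - x \<bullet> (matrix_inv A *v x)\<bar> \<le> \<delta> * (norm x)\<^sup>2" for x
      proof -
        have "\<bar>x \<bullet> (matrix_inv (Sigma_tilde \<epsilon> n H) *v x) - x \<bullet> (matrix_inv A *v x)\<bar>
            = \<bar>x \<bullet> ((matrix_inv (Sigma_tilde \<epsilon> n H) - matrix_inv A) *v x)\<bar>"
          by (simp add: matrix_vector_mult_diff_rdistrib inner_diff_right)
        also have "\<dots> \<le> norm x * norm ((matrix_inv (Sigma_tilde \<epsilon> n H) - matrix_inv A) *v x)"
          by (rule Cauchy_Schwarz_ineq2)
        also have "\<dots> \<le> norm x * (onorm ((*v) (matrix_inv (Sigma_tilde \<epsilon> n H) - matrix_inv A)) * norm x)"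
          by (intro mult_left_mono onorm matrix_vector_mul_bounded_linear) auto
        also have "\<dots> \<le> norm x * (\<delta> * norm x)"
          using * by (intro mult_left_mono mult_right_mono) auto
        finally show ?thesis by (simp add: power2_eq_square mult_ac)
      qed
      with * show "let S = Sigma_tilde \<epsilon> n (real n *\<^sub>R p_tilde \<epsilon> \<pi>1 \<pi>2 + sqrt n *\<^sub>R Y) in
         invertible S \<and> (\<forall>x. \<bar>x \<bullet> (matrix_inv S *v x) - x \<bullet> (matrix_inv (Sigma_bit \<epsilon> (outer \<pi>1 \<pi>2)) *v x)\<bar> \<le> \<delta> * (norm x)\<^sup>2)"
        by (simp add: H_def[symmetric] A_def)
    qed
  qed
qed

section \<open>Approximation of the minimized statistic\<close>

lemma pos_prob_vectors_norm_le: "\<theta> \<in> pos_prob_vectors \<Longrightarrow> norm \<theta> \<le> 1"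
  using norm_le_l1_cart[of \<theta>] by (simp add: pos_prob_vectors_def abs_of_pos)

lemma outer_zero [simp]: "outer 0 b = 0" "outer a 0 = 0"
  by (simp_all add: outer_def vec_eq_iff)

lemma outer_perturb:
  "outer (a + x) (b + y) - outer a b = outer x b + outer a y + outer x y"
  by (simp add: outer_add_left outer_add_right)

lemma sum_zero_outer_diff:
  assumes "a \<in> pos_prob_vectors" "a' \<in> pos_prob_vectors" "b \<in> pos_prob_vectors" "b' \<in> pos_prob_vectors"
  shows "(\<Sum>k\<in>UNIV. (outer a' b' - outer a b) $ k) = 0"
  using outer_pos_prob_vectors[OF assms(2,4)] outer_pos_prob_vectors[OF assms(1,3)]
  by (simp add: sum_subtractf pos_prob_vectors_def)

text \<open>The \<open>l i\<close> span the orthogonal complement of the tangent space, so they see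
  a change of parameters only through its quadratic remainder, of order 1/sqrt n after scaling.
  Conversely, the tangent component of \<open>Y\<close> can be cancelled by an admissible shift of
  order 1/sqrt n.\<close>

lemma INF_T_bitflip_approx:
  fixes \<epsilon> :: real and \<pi>1 :: "real^'r" and \<pi>2 :: "real^'c"
  assumes eps: "\<epsilon> > 0" and pi1: "\<pi>1 \<in> pos_prob_vectors" and pi2: "\<pi>2 \<in> pos_prob_vectors"
  defines "\<nu> \<equiv> (CARD('r) - 1) * (CARD('c) - 1)"
  obtains l :: "nat \<Rightarrow> real^('r \<times> 'c)" where
    "\<And>i j. i < \<nu> \<Longrightarrow> j < \<nu> \<Longrightarrow> l i \<bullet> (Sigma_bit \<epsilon> (outer \<pi>1 \<pi>2) *v l j) = of_bool (i = j)"
    "\<And>B \<eta>. \<eta> > 0 \<Longrightarrow> \<forall>\<^sub>F n in sequentially. \<forall>Y. norm Y \<le> B \<longrightarrow>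
       \<bar>(INF (\<theta>1, \<theta>2) \<in> pos_prob_vectors \<times> pos_prob_vectors.
          T_bitflip \<epsilon> n (real n *\<^sub>R p_tilde \<epsilon> \<pi>1 \<pi>2 + sqrt n *\<^sub>R Y) \<theta>1 \<theta>2) - (\<Sum>i<\<nu>. (l i \<bullet> Y)\<^sup>2)\<bar> \<le> \<eta>"
proof -

  \<comment> \<open>Projection along the tangent space in the limiting metric\<close>
  define q where "q = outer \<pi>1 \<pi>2"
  define A where "A = Sigma_bit \<epsilon> q"
  define A' where "A' = matrix_inv A"
  define W where "W = model_tangent \<pi>1 \<pi>2"
  define m where "m = real (CARD('r) * CARD('c))"
  have m0: "m \<ge> 0" by (simp add: m_def)
  have q: "q \<in> pos_prob_vectors" unfolding q_def by (intro outer_pos_prob_vectors pi1 pi2)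
  have s1: "(\<Sum>i\<in>UNIV. \<pi>1 $ i) = 1" and s2: "(\<Sum>j\<in>UNIV. \<pi>2 $ j) = 1"
    using pi1 pi2 by (auto simp: pos_prob_vectors_def)
  have \<alpha>: "alpha \<epsilon> > 0" using eps by (rule alpha_pos)
  have sym: "\<And>x y. x \<bullet> (A *v y) = (A *v x) \<bullet> y" unfolding A_def by (rule Sigma_bit_sym)
  have pos: "\<And>x. x \<noteq> 0 \<Longrightarrow> x \<bullet> (A *v x) > 0" unfolding A_def by (rule Sigma_bit_pos[OF q])
  have inv: "invertible A" unfolding A_def by (rule invertible_Sigma_bit[OF q])
  have dimN: "dim (W\<^sup>\<bottom>) = \<nu>" unfolding W_def \<nu>_def by (rule dim_orthogonal_model_tangent[OF s1 s2])
  obtain l :: "nat \<Rightarrow> real^('r \<times> 'c)" where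
    l: "\<And>i j. i < \<nu> \<Longrightarrow> j < \<nu> \<Longrightarrow> l i \<bullet> (A *v l j) = of_bool (i = j)"
    and span_l: "span (l ` {..<\<nu>}) = W\<^sup>\<bottom>"
    using orthonormal_basis_wrt[OF sym pos subspace_orthogonal_comp, of W] unfolding dimN by metis
  define g where "g w = (\<Sum>i<\<nu>. (l i \<bullet> w) *\<^sub>R l i)" for w
  define Q where "Q w = (\<Sum>i<\<nu>. (l i \<bullet> w)\<^sup>2)" for w
  note inv_lower = quadratic_inv_lower[where A = A and m = \<nu> and l = l]
  have quad1: "l j \<bullet> (w - A *v g w) = 0" if "j < \<nu>" for w j
    unfolding g_def by (rule inv_lower(1)) (fact sym pos inv l that)+
  have quad2: "(A *v g w) \<bullet> (A' *v (A *v g w)) = Q w" for w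
    unfolding g_def Q_def A'_def by (rule inv_lower(2)) (fact sym pos inv l)+
  have quad3: "Q w \<le> w \<bullet> (A' *v w)" for w
    unfolding Q_def A'_def by (rule inv_lower(3)) (fact sym pos inv l)+
  have l_orth: "l i \<bullet> t = 0" if "i < \<nu>" "t \<in> W" for i t
  proof -
    have "l i \<in> W\<^sup>\<bottom>" using that(1) unfolding span_l[symmetric] by (intro span_base) auto
    then show ?thesis using that(2) by (auto simp: orthogonal_comp_def orthogonal_def inner_commute)
  qed
  have tangent_W: "outer u \<pi>2 + outer \<pi>1 v + k *\<^sub>R 1 \<in> W"
    if "(\<Sum>i\<in>UNIV. u $ i) = 0" "(\<Sum>j\<in>UNIV. v $ j) = 0" for u v k
    unfolding W_def model_tangent_def using that by blast
  have one_W: "1 \<in> W" using tangent_W[of 0 0 1] by simp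
  have l_Pi: "l i \<bullet> (Pi_proj *v x) = l i \<bullet> x" if "i < \<nu>" for i x
    using l_orth[OF that one_W] by (simp add: Pi_proj_mult inner_diff_right)
  \<comment> \<open>The part of \<open>Y\<close> that no parameter can remove already sums to 0, so
    projecting does not change it.\<close>
  have Pi_Ag: "Pi_proj *v (A *v g w) = A *v g w" for w
  proof (rule Pi_proj_sum_zero)
    have "g w \<bullet> 1 = 0" by (auto simp: g_def inner_sum_left l_orth one_W)
    then show "(\<Sum>k\<in>UNIV. (A *v g w) $ k) = 0"
      using sym[of "g w" 1] by (simp add: inner_1_vec[symmetric] A_def Sigma_bit_1[OF q])
  qed
  \<comment> \<open>The residual is orthogonal to the complement of \<open>W\<close>, hence lies in
    the double complement \<open>W\<close>: it is a direction that parameters can follow.\<close>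
  have t_W: "Y - A *v g Y \<in> W" for Y
  proof -
    have "orthogonal (Y - A *v g Y) y" if "y \<in> W\<^sup>\<bottom>" for y
      using that unfolding span_l[symmetric] 
      by (rule orthogonal_to_span) (auto simp: orthogonal_def quad1 inner_commute)
    then have "Y - A *v g Y \<in> W\<^sup>\<bottom>\<^sup>\<bottom>"
      unfolding orthogonal_comp_def[of "W\<^sup>\<bottom>"] by (auto simp: orthogonal_commute)
    then show ?thesis
      using orthogonal_comp_self[OF subspace_model_tangent, of \<pi>1 \<pi>2] by (simp add: W_def)
  qed
  obtain KA where KA: "KA > 0" "\<And>x. norm (A *v x) \<le> KA * norm x"
    using bounded_matrix_vector by blast
  obtain K where K: "K > 0" "\<And>x. norm (A' *v x) \<le> K * norm x"
    using bounded_matrix_vector by blast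
  obtain c0 where c0: "c0 > 0" "\<And>x. c0 * (norm x)\<^sup>2 \<le> x \<bullet> (A' *v x)"
    unfolding A'_def A_def using matrix_inv_Sigma_bit_lower[OF q] by blast
  define L where "L = (\<Sum>i<\<nu>. (norm (l i))\<^sup>2)"
  have L0: "L \<ge> 0" by (auto simp: L_def intro: sum_nonneg)
  have l_ip: "\<bar>l i \<bullet> w\<bar> \<le> norm (l i) * norm w" for i w by (rule Cauchy_Schwarz_ineq2)
  have Q_le: "Q w \<le> L * (norm w)\<^sup>2" for w
  proof -
    have "(l i \<bullet> w)\<^sup>2 \<le> (norm (l i))\<^sup>2 * (norm w)\<^sup>2" for i
      using power_mono[OF l_ip abs_ge_zero, of i w 2] by (simp add: power_mult_distrib)
    then show ?thesis unfolding Q_def L_def sum_distrib_right by (intro sum_mono)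
  qed
  have g_le: "norm (g w) \<le> L * norm w" for w
  proof -
    have "norm (g w) \<le> (\<Sum>i<\<nu>. norm ((l i \<bullet> w) *\<^sub>R l i))" unfolding g_def by (rule norm_sum)
    also have "\<dots> \<le> (\<Sum>i<\<nu>. (norm (l i))\<^sup>2 * norm w)"
    proof (rule sum_mono)
      fix i
      show "norm ((l i \<bullet> w) *\<^sub>R l i) \<le> (norm (l i))\<^sup>2 * norm w"
        using mult_right_mono[OF l_ip norm_ge_zero, of i w "l i"] by (simp add: power2_eq_square mult_ac)
    qed
    finally show ?thesis by (simp add: L_def sum_distrib_right)
  qed
  have Ag_le: "norm (A *v g w) \<le> KA * L * norm w" for w
    using order_trans[OF KA(2) mult_left_mono[OF g_le, of KA]] KA(1) by (simp add: mult.assoc)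
  have approx: "\<forall>\<^sub>F n in sequentially. \<forall>Y. norm Y \<le> B \<longrightarrow>
       \<bar>(INF (\<theta>1, \<theta>2) \<in> pos_prob_vectors \<times> pos_prob_vectors.
          T_bitflip \<epsilon> n (real n *\<^sub>R p_tilde \<epsilon> \<pi>1 \<pi>2 + sqrt n *\<^sub>R Y) \<theta>1 \<theta>2) - Q Y\<bar> \<le> \<eta>"
    if \<eta>: "\<eta> > 0" for B \<eta>
  proof -

    \<comment> \<open>Constants for a given radius and tolerance\<close>
    define B' where "B' = max B 0"
    have B'0: "B' \<ge> 0" by (simp add: B'_def)
    \<comment> \<open>Beyond radius \<open>R\<close>, half of the coercivity constant
      \<open>c0\<close> already exceeds the largest possible \<open>Q Y\<close>; the other half pays
      for the estimated matrix.\<close>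
    define R where "R = sqrt (2 * L * B'\<^sup>2 / c0)"
    have R0: "R \<ge> 0" using L0 c0 by (simp add: R_def)
    have R2: "c0 / 2 * R\<^sup>2 = L * B'\<^sup>2" using L0 c0 by (simp add: R_def)
    \<comment> \<open>Within radius \<open>R\<close>, this bounds the scaled deviation of the model
      table from the true one.\<close>
    define G where "G = B' + R"
    have G0: "G \<ge> 0" using B'0 R0 by (simp add: G_def)
    \<comment> \<open>\<open>C * B'\<close> bounds the unscaled shifts of the margins: 2m^2 comes
      from the tangent coordinates, \<open>1 + KA * L\<close> from the residual, and the division by
      alpha undoes the factor in \<open>p_tilde\<close>. Then \<open>E / sqrt n\<close> bounds the
      quadratic remainder and \<open>Gb\<close> bounds \<open>A *v g Y\<close>.\<close>
    define C where "C = 2 * m\<^sup>2 * (1 + KA * L) / alpha \<epsilon>"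
    have C0: "C \<ge> 0" using KA L0 \<alpha> by (simp add: C_def)
    define E where "E = alpha \<epsilon> * (C * B')\<^sup>2"
    have E0: "E \<ge> 0" using \<alpha> by (simp add: E_def)
    define Gb where "Gb = KA * L * B'"
    have Gb0: "Gb \<ge> 0" using KA L0 B'0 by (simp add: Gb_def)
    \<comment> \<open>The first bound preserves coercivity. The second makes the matrix error at
      most half the tolerance, both for vectors below \<open>R\<close> in the lower bound and for
      those below \<open>Gb + E\<close> in the upper bound.\<close>
    define \<delta> where "\<delta> = min (c0 / 2) (\<eta> / 2 / (R\<^sup>2 + (Gb + E)\<^sup>2 + 1))"
    have \<eta>2: "\<eta> / 2 > 0" using \<eta> by simp
    have den: "R\<^sup>2 + (Gb + E)\<^sup>2 + 1 > 0" by (simp add: add_nonneg_pos)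
    have \<delta>0: "\<delta> > 0" using c0 \<eta> den by (simp add: \<delta>_def)
    have \<delta>c: "\<delta> \<le> c0 / 2" unfolding \<delta>_def by (rule min.cobounded1)
    have \<delta>\<eta>: "\<delta> * (R\<^sup>2 + (Gb + E)\<^sup>2 + 1) \<le> \<eta> / 2"
    proof -
      have "\<delta> \<le> \<eta> / 2 / (R\<^sup>2 + (Gb + E)\<^sup>2 + 1)" unfolding \<delta>_def by (rule min.cobounded2)
      then show ?thesis by (simp only: pos_le_divide_eq[OF den])
    qed
    have \<delta>R: "\<delta> * R\<^sup>2 \<le> \<eta> / 2"
      by (rule order_trans[OF mult_left_mono \<delta>\<eta>]) (use \<delta>0 in simp_all)
    have \<delta>E: "\<delta> * (Gb + E)\<^sup>2 \<le> \<eta> / 2"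
      by (rule order_trans[OF mult_left_mono \<delta>\<eta>]) (use \<delta>0 in simp_all)
    \<comment> \<open>A uniform margin of positivity: shifts with entries smaller than
      \<open>d\<close> keep all probabilities positive.\<close>
    have pos_min: "\<exists>d>0. (\<forall>i. d < \<pi>1 $ i) \<and> (\<forall>j. d < \<pi>2 $ j)"
    proof -
      define d where "d = min (Min (range (($) \<pi>1))) (Min (range (($) \<pi>2)))"
      have d0: "d > 0" using pi1 pi2 by (auto simp: d_def pos_prob_vectors_def)
      then have half: "d / 2 < d" by simp
      have "Min (range (($) \<pi>1)) \<le> \<pi>1 $ i" for i by (rule Min_le) auto
      then have "d \<le> \<pi>1 $ i" for i unfolding d_def by (rule min.coboundedI1)
      moreover have "Min (range (($) \<pi>2)) \<le> \<pi>2 $ j" for j by (rule Min_le) auto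
      then have "d \<le> \<pi>2 $ j" for j unfolding d_def by (rule min.coboundedI2)
      ultimately have "\<forall>i. d / 2 < \<pi>1 $ i" "\<forall>j. d / 2 < \<pi>2 $ j"
        using half by (meson less_le_trans)+
      with d0 show ?thesis by (intro exI[of _ "d / 2"]) simp
    qed
    then obtain d where d: "d > 0" "\<And>i. d < \<pi>1 $ i" "\<And>j. d < \<pi>2 $ j" by blast
    have lim: "(\<lambda>n. a / sqrt (real n)) \<longlonglongrightarrow> 0" for a
      by (intro tendsto_divide_0[OF tendsto_const] filterlim_at_top_imp_at_infinity
          filterlim_compose[OF sqrt_at_top] filterlim_real_sequentially)
    have ev: "\<forall>\<^sub>F n in sequentially. a / sqrt (real n) < b" if "b > 0" for a b
      using order_tendstoD(2)[OF lim that] .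
    show ?thesis
      \<comment> \<open>The last three thresholds serve, in this order, positivity of the shifted
        margins, the second-order error of the upper bound, and that of the lower bound.\<close>
      using eventually_ge_at_top[of 1] Sigma_tilde_perturbation[OF eps pi1 pi2 \<delta>0, of B]
        ev[OF d(1), of "C * B'"] ev[OF \<eta>2, of "2 * K * Gb * E + K * E\<^sup>2"]
        ev[OF \<eta>2, of "2 * L * B' * (m\<^sup>2 * G\<^sup>2 / alpha \<epsilon>)"]
    proof eventually_elim
      case (elim n)
      have n: "n \<ge> 1" by fact
      define rn where "rn = sqrt (real n)"
      have rn: "rn \<ge> 1" using n by (simp add: rn_def)
      have rn2: "rn * rn = real n" by (simp add: rn_def)
      have ev1: "C * B' / rn < d" and ev2: "(2 * K * Gb * E + K * E\<^sup>2) / rn < \<eta> / 2"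
        and ev3: "2 * L * B' * (m\<^sup>2 * G\<^sup>2 / alpha \<epsilon>) / rn < \<eta> / 2"
        using elim \<eta> by (auto simp: rn_def)
      show ?case
      proof (intro allI impI)
        fix Y :: "real^('r \<times> 'c)" assume YB: "norm Y \<le> B"
        then have Y: "norm Y \<le> B'" by (simp add: B'_def)
        define H where "H = real n *\<^sub>R p_tilde \<epsilon> \<pi>1 \<pi>2 + sqrt n *\<^sub>R Y"
        define S' where "S' = matrix_inv (Sigma_tilde \<epsilon> n H)"
        have invS: "invertible (Sigma_tilde \<epsilon> n H)"
          and S': "\<And>x. \<bar>x \<bullet> (S' *v x) - x \<bullet> (A' *v x)\<bar> \<le> \<delta> * (norm x)\<^sup>2"
          using elim(2) YB by (auto simp: H_def S'_def Let_def A'_def A_def q_def)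
        have T: "T_bitflip \<epsilon> n H \<theta>1 \<theta>2 = x \<bullet> (S' *v x)"
          if "x = Pi_proj *v (Y - (rn * alpha \<epsilon>) *\<^sub>R (outer \<theta>1 \<theta>2 - q))" for \<theta>1 \<theta>2 x
          using T_bitflip_standardized[OF n invS[unfolded H_def], of \<theta>1 \<theta>2]
          by (simp add: that H_def S'_def q_def rn_def)
        have lower: "Q Y - \<eta> \<le> T_bitflip \<epsilon> n H \<theta>1 \<theta>2"
          if th: "\<theta>1 \<in> pos_prob_vectors" "\<theta>2 \<in> pos_prob_vectors" for \<theta>1 \<theta>2
        proof -
          define D where "D = outer \<theta>1 \<theta>2 - q"
          define x where "x = Pi_proj *v (Y - (rn * alpha \<epsilon>) *\<^sub>R D)"
          have D0: "(\<Sum>k\<in>UNIV. D $ k) = 0"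
            unfolding D_def q_def by (rule sum_zero_outer_diff[OF pi1 th(1) pi2 th(2)])
          have x: "x = Pi_proj *v Y - (rn * alpha \<epsilon>) *\<^sub>R D"
            by (simp add: x_def matrix_vector_mult_diff_distrib matrix_vector_mult_scaleR Pi_proj_sum_zero[OF D0])
          have Tx: "T_bitflip \<epsilon> n H \<theta>1 \<theta>2 = x \<bullet> (S' *v x)"
            by (rule T) (simp add: x_def D_def)
          have S'x: "x \<bullet> (A' *v x) - \<delta> * (norm x)\<^sup>2 \<le> x \<bullet> (S' *v x)"
            using S'[of x] by linarith
          show ?thesis
          proof (cases "norm x \<ge> R")
            case True
            have "Q Y \<le> L * B'\<^sup>2"
              using order_trans[OF Q_le mult_left_mono[OF power_mono[OF Y norm_ge_zero] L0]] .
            also have "\<dots> = c0 / 2 * R\<^sup>2" using R2 by simp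
            also have "\<dots> \<le> c0 / 2 * (norm x)\<^sup>2"
              using True R0 c0 by (intro mult_left_mono power_mono) auto
            also have "\<dots> \<le> c0 * (norm x)\<^sup>2 - \<delta> * (norm x)\<^sup>2"
              using mult_right_mono[OF \<delta>c, of "(norm x)\<^sup>2"] by simp
            also have "\<dots> \<le> x \<bullet> (S' *v x)" using c0(2)[of x] S'x by linarith
            finally show ?thesis using Tx \<eta> by simp
          next
            case False
            have "norm ((rn * alpha \<epsilon>) *\<^sub>R D) = norm (Pi_proj *v Y - x)" by (simp add: x)
            also have "\<dots> \<le> norm (Pi_proj *v Y) + norm x" by (rule norm_triangle_ineq4)
            also have "\<dots> \<le> G" using norm_Pi_proj_le[of Y] Y False by (simp add: G_def)
            finally have nD: "rn * alpha \<epsilon> * norm D \<le> G" using rn \<alpha> by simp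
            define \<Delta>1 where "\<Delta>1 = \<theta>1 - \<pi>1"
            define \<Delta>2 where "\<Delta>2 = \<theta>2 - \<pi>2"
            have \<Delta>s: "(\<Sum>i\<in>UNIV. \<Delta>1 $ i) = 0" "(\<Sum>j\<in>UNIV. \<Delta>2 $ j) = 0"
              using th s1 s2 by (auto simp: \<Delta>1_def \<Delta>2_def sum_subtractf pos_prob_vectors_def)
            have st: "(\<Sum>i\<in>UNIV. \<theta>1 $ i) = 1" "(\<Sum>j\<in>UNIV. \<theta>2 $ j) = 1"
              using th by (auto simp: pos_prob_vectors_def)
            \<comment> \<open>Margins of the table difference return the parameter differences,
              since all vectors involved sum to 1. A small \<open>D\<close> thus forces both
              parameters to be close to the true ones.\<close>
            have "\<Delta>1 = (\<chi> i. \<Sum>j\<in>UNIV. D $ (i, j))"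
              by (simp add: vec_eq_iff \<Delta>1_def D_def q_def sum_subtractf sum_distrib_left[symmetric] st s2)
            then have n1: "norm \<Delta>1 \<le> m * norm D" using norm_row_sums[of D] by (simp add: m_def)
            have "\<Delta>2 = (\<chi> j. \<Sum>i\<in>UNIV. D $ (i, j))"
              by (simp add: vec_eq_iff \<Delta>2_def D_def q_def sum_subtractf sum_distrib_right[symmetric] st s1)
            then have n2: "norm \<Delta>2 \<le> m * norm D" using norm_col_sums[of D] by (simp add: m_def)
            have D_eq: "D = (outer \<Delta>1 \<pi>2 + outer \<pi>1 \<Delta>2 + 0 *\<^sub>R 1) + outer \<Delta>1 \<Delta>2"
              using outer_perturb[of \<pi>1 \<Delta>1 \<pi>2 \<Delta>2] by (simp add: D_def q_def \<Delta>1_def \<Delta>2_def)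
            \<comment> \<open>The first-order part of \<open>D\<close> is tangent, so
              \<open>l i\<close> sees only the product of the two parameter differences.\<close>
            have lD: "l i \<bullet> D = l i \<bullet> outer \<Delta>1 \<Delta>2" if "i < \<nu>" for i
              by (subst D_eq, subst inner_add_right) (simp only: l_orth[OF that tangent_W[OF \<Delta>s]] add_0)
            \<comment> \<open>Both differences are of order 1/rn, so their product, scaled by rn, is
              still of order 1/rn.\<close>
            have big: "rn * alpha \<epsilon> * norm (outer \<Delta>1 \<Delta>2) \<le> m\<^sup>2 * G\<^sup>2 / alpha \<epsilon> / rn"
            proof -
              have ar: "alpha \<epsilon> * rn > 0" using \<alpha> rn by simp
              have "norm \<Delta>1 * norm \<Delta>2 \<le> (m * norm D) * (m * norm D)"
                using n1 n2 m0 by (intro mult_mono) auto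
              then have "(alpha \<epsilon> * rn) * (rn * alpha \<epsilon> * norm (outer \<Delta>1 \<Delta>2)) \<le> (alpha \<epsilon> * rn) * (rn * alpha \<epsilon> * ((m * norm D) * (m * norm D)))"
                unfolding norm_outer using \<alpha> rn by (intro mult_left_mono) auto
              also have "\<dots> = m\<^sup>2 * (rn * alpha \<epsilon> * norm D)\<^sup>2"
                by (simp add: power2_eq_square mult_ac)
              also have "\<dots> \<le> m\<^sup>2 * G\<^sup>2"
                using nD \<alpha> rn by (intro mult_left_mono power_mono) auto
              finally have "rn * alpha \<epsilon> * norm (outer \<Delta>1 \<Delta>2) \<le> m\<^sup>2 * G\<^sup>2 / (alpha \<epsilon> * rn)"
                using ar by (simp add: pos_le_divide_eq mult.commute)
              then show ?thesis by (simp add: divide_divide_eq_left)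
            qed
            have "Q Y - 2 * L * B' * (m\<^sup>2 * G\<^sup>2 / alpha \<epsilon>) / rn \<le> Q x"
            proof -
              define e where "e i = rn * alpha \<epsilon> * (l i \<bullet> D)" for i
              have "(l i \<bullet> Y)\<^sup>2 - (norm (l i))\<^sup>2 * (2 * B' * (m\<^sup>2 * G\<^sup>2 / alpha \<epsilon>) / rn) \<le> (l i \<bullet> x)\<^sup>2" if i: "i < \<nu>" for i
              proof -
                have lx: "l i \<bullet> x = l i \<bullet> Y - e i"
                  by (simp add: x inner_diff_right l_Pi[OF i] e_def)
                have "\<bar>e i\<bar> = rn * alpha \<epsilon> * \<bar>l i \<bullet> outer \<Delta>1 \<Delta>2\<bar>"
                  unfolding e_def lD[OF i] using rn \<alpha> by (simp add: abs_mult)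
                also have "\<dots> \<le> rn * alpha \<epsilon> * (norm (l i) * norm (outer \<Delta>1 \<Delta>2))"
                  using rn \<alpha> by (intro mult_left_mono l_ip) auto
                also have "\<dots> = norm (l i) * (rn * alpha \<epsilon> * norm (outer \<Delta>1 \<Delta>2))" by simp
                also have "\<dots> \<le> norm (l i) * (m\<^sup>2 * G\<^sup>2 / alpha \<epsilon> / rn)"
                  by (intro mult_left_mono big) auto
                finally have e: "\<bar>e i\<bar> \<le> norm (l i) * (m\<^sup>2 * G\<^sup>2 / alpha \<epsilon> / rn)" .
                have "\<bar>l i \<bullet> Y\<bar> \<le> norm (l i) * B'"
                  using order_trans[OF l_ip mult_left_mono[OF Y norm_ge_zero]] .
                then have "\<bar>l i \<bullet> Y\<bar> * \<bar>e i\<bar> \<le> (norm (l i) * B') * (norm (l i) * (m\<^sup>2 * G\<^sup>2 / alpha \<epsilon> / rn))"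
                  using e B'0 by (intro mult_mono) auto
                then have "\<bar>(l i \<bullet> Y) * e i\<bar> \<le> (norm (l i))\<^sup>2 * (B' * (m\<^sup>2 * G\<^sup>2 / alpha \<epsilon>) / rn)"
                  by (simp add: abs_mult power2_eq_square mult_ac)
                then have le: "(l i \<bullet> Y) * e i \<le> (norm (l i))\<^sup>2 * (B' * (m\<^sup>2 * G\<^sup>2 / alpha \<epsilon>) / rn)"
                  by linarith
                \<comment> \<open>The square of \<open>e i\<close> is discarded for the lower bound,
                  so only the cross term has to be small.\<close>
                have sq: "(l i \<bullet> x)\<^sup>2 = (l i \<bullet> Y)\<^sup>2 - 2 * ((l i \<bullet> Y) * e i) + (e i)\<^sup>2"
                  unfolding lx by (simp add: power2_diff)
                have two: "(norm (l i))\<^sup>2 * (2 * B' * (m\<^sup>2 * G\<^sup>2 / alpha \<epsilon>) / rn) = 2 * ((norm (l i))\<^sup>2 * (B' * (m\<^sup>2 * G\<^sup>2 / alpha \<epsilon>) / rn))"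
                  by simp
                have "y - c \<le> z" if "x \<le> b" "z = y - 2 * x + t" "c = 2 * b" "0 \<le> t" for x b z y t c :: real
                  using that by linarith
                from this[OF le sq two zero_le_power2] show ?thesis .
              qed
              then have "(\<Sum>i<\<nu>. (l i \<bullet> Y)\<^sup>2 - (norm (l i))\<^sup>2 * (2 * B' * (m\<^sup>2 * G\<^sup>2 / alpha \<epsilon>) / rn)) \<le> Q x"
                unfolding Q_def by (intro sum_mono) auto
              moreover have "(\<Sum>i<\<nu>. (l i \<bullet> Y)\<^sup>2 - (norm (l i))\<^sup>2 * (2 * B' * (m\<^sup>2 * G\<^sup>2 / alpha \<epsilon>) / rn))
                 = Q Y - L * (2 * B' * (m\<^sup>2 * G\<^sup>2 / alpha \<epsilon>) / rn)"
                by (simp only: sum_subtractf Q_def L_def sum_distrib_right)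
              ultimately show ?thesis by (simp add: mult_ac)
            qed
            moreover have "Q x \<le> x \<bullet> (A' *v x)" by (rule quad3)
            moreover have "\<delta> * (norm x)\<^sup>2 \<le> \<delta> * R\<^sup>2"
              using False \<delta>0 by (intro mult_left_mono power_mono) auto
            ultimately show ?thesis using S'x Tx ev3 \<delta>R by linarith
          qed
        qed

        \<comment> \<open>Upper bound from one explicit parameter\<close>
        have upper: "\<exists>\<theta>1\<in>pos_prob_vectors. \<exists>\<theta>2\<in>pos_prob_vectors. T_bitflip \<epsilon> n H \<theta>1 \<theta>2 \<le> Q Y + \<eta>"
        proof -
          define t where "t = Y - A *v g Y"
          obtain u0 v0 k where uv0: "t = outer u0 \<pi>2 + outer \<pi>1 v0 + k *\<^sub>R 1"
            "(\<Sum>i\<in>UNIV. u0 $ i) = 0" "(\<Sum>j\<in>UNIV. v0 $ j) = 0"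
            "norm u0 \<le> 2 * m\<^sup>2 * norm t" "norm v0 \<le> 2 * m\<^sup>2 * norm t"
            using model_tangent_coords[OF s1 s2 t_W[of Y, unfolded W_def]] unfolding t_def m_def by blast
          have "norm t \<le> norm Y + norm (A *v g Y)" unfolding t_def by (rule norm_triangle_ineq4)
          also have "\<dots> \<le> (1 + KA * L) * norm Y" using Ag_le[of Y] by (simp add: algebra_simps)
          also have "\<dots> \<le> (1 + KA * L) * B'" using Y KA L0 by (intro mult_left_mono) auto
          finally have nt: "norm t \<le> (1 + KA * L) * B'" .
          have scale: "norm ((1 / alpha \<epsilon>) *\<^sub>R w) \<le> C * B'" if "norm w \<le> 2 * m\<^sup>2 * norm t" for w :: "real^'d"
          proof -
            have "norm w \<le> 2 * m\<^sup>2 * ((1 + KA * L) * B')"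
              using that mult_left_mono[OF nt, of "2 * m\<^sup>2"] by simp
            then have "norm w / alpha \<epsilon> \<le> 2 * m\<^sup>2 * ((1 + KA * L) * B') / alpha \<epsilon>"
              using \<alpha> by (intro divide_right_mono) auto
            then show ?thesis using \<alpha> by (simp add: C_def mult.assoc)
          qed
          define u where "u = (1 / alpha \<epsilon>) *\<^sub>R u0"
          define v where "v = (1 / alpha \<epsilon>) *\<^sub>R v0"
          have nu: "norm u \<le> C * B'" unfolding u_def by (rule scale[OF uv0(4)])
          have nv: "norm v \<le> C * B'" unfolding v_def by (rule scale[OF uv0(5)])
          have u0: "(\<Sum>i\<in>UNIV. u $ i) = 0" and v0: "(\<Sum>j\<in>UNIV. v $ j) = 0"
            using uv0(2,3) by (simp_all add: u_def v_def sum_divide_distrib[symmetric])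
          have t: "t = alpha \<epsilon> *\<^sub>R (outer u \<pi>2 + outer \<pi>1 v) + k *\<^sub>R 1"
            using \<alpha> by (simp add: uv0(1) u_def v_def outer_scale_left outer_scale_right scaleR_add_right)
          \<comment> \<open>The shift that cancels the tangent part of \<open>Y\<close> to first
            order. What remains is \<open>A *v g Y\<close>, a multiple of \<open>1\<close> that
            \<open>Pi_proj\<close> removes, and the quadratic remainder \<open>f\<close> of order
            1/rn.\<close>
          define \<theta>1 where "\<theta>1 = \<pi>1 + (1 / rn) *\<^sub>R u"
          define \<theta>2 where "\<theta>2 = \<pi>2 + (1 / rn) *\<^sub>R v"
          have small: "\<bar>w $ i\<bar> / rn < d" if "norm w \<le> C * B'" for w :: "real^'d" and i
          proof -
            have "\<bar>w $ i\<bar> / rn \<le> C * B' / rn"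
              using order_trans[OF component_le_norm_cart that] rn by (intro divide_right_mono) auto
            then show ?thesis using ev1 by linarith
          qed
          have th1: "\<theta>1 \<in> pos_prob_vectors"
          proof -
            have "0 < \<theta>1 $ i" for i
              using small[OF nu, of i] d(2)[of i] abs_ge_minus_self[of "u $ i / rn"] rn by (simp add: \<theta>1_def)
            then show ?thesis using s1 u0 by (simp add: pos_prob_vectors_def \<theta>1_def sum.distrib sum_divide_distrib[symmetric])
          qed
          have th2: "\<theta>2 \<in> pos_prob_vectors"
          proof -
            have "0 < \<theta>2 $ j" for j
              using small[OF nv, of j] d(3)[of j] abs_ge_minus_self[of "v $ j / rn"] rn by (simp add: \<theta>2_def)
            then show ?thesis using s2 v0 by (simp add: pos_prob_vectors_def \<theta>2_def sum.distrib sum_divide_distrib[symmetric])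
          qed
          define f where "f = Pi_proj *v ((alpha \<epsilon> / rn) *\<^sub>R outer u v)"
          define a where "a = A *v g Y"
          define x where "x = Pi_proj *v (Y - (rn * alpha \<epsilon>) *\<^sub>R (outer \<theta>1 \<theta>2 - q))"
          have "(rn * alpha \<epsilon>) *\<^sub>R (outer \<theta>1 \<theta>2 - q) = alpha \<epsilon> *\<^sub>R (outer u \<pi>2 + outer \<pi>1 v) + (alpha \<epsilon> / rn) *\<^sub>R outer u v"
            unfolding \<theta>1_def \<theta>2_def q_def outer_perturb
            using rn by (simp add: outer_scale_left outer_scale_right scaleR_add_right)
          then have "Y - (rn * alpha \<epsilon>) *\<^sub>R (outer \<theta>1 \<theta>2 - q) = a + k *\<^sub>R 1 - (alpha \<epsilon> / rn) *\<^sub>R outer u v"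
            using t by (simp add: t_def a_def algebra_simps)
          then have x: "x = a - f"
            by (simp add: x_def matrix_vector_mult_diff_distrib matrix_vector_right_distrib matrix_vector_mult_scaleR
                Pi_proj_1 f_def) (simp add: a_def Pi_Ag)
          have nf: "norm f \<le> E / rn"
          proof -
            have "norm f \<le> norm ((alpha \<epsilon> / rn) *\<^sub>R outer u v)" unfolding f_def by (rule norm_Pi_proj_le)
            also have "\<dots> = alpha \<epsilon> / rn * (norm u * norm v)" using \<alpha> rn by (simp add: norm_outer)
            also have "\<dots> \<le> alpha \<epsilon> / rn * ((C * B') * (C * B'))"
              using nu nv \<alpha> rn C0 B'0 by (intro mult_left_mono mult_mono) auto
            finally show ?thesis by (simp add: E_def power2_eq_square)
          qed
          have "E / rn \<le> E" using mult_left_mono[OF rn E0] rn by (simp add: pos_divide_le_eq)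
          then have nf': "norm f \<le> E" using nf by linarith
          have na: "norm a \<le> Gb"
            using order_trans[OF Ag_le mult_left_mono[OF Y]] KA L0 by (simp add: a_def Gb_def)
          have nx: "norm x \<le> Gb + E"
            using norm_triangle_ineq4[of a f] na nf' by (simp add: x)
          have ip: "\<bar>y \<bullet> (A' *v z)\<bar> \<le> K * (norm y * norm z)" for y z
            using order_trans[OF Cauchy_Schwarz_ineq2 mult_left_mono[OF K(2) norm_ge_zero], of y z]
            by (simp add: mult_ac)
          have "x \<bullet> (A' *v x) = a \<bullet> (A' *v a) - a \<bullet> (A' *v f) - f \<bullet> (A' *v a) + f \<bullet> (A' *v f)"
            by (simp add: x matrix_vector_mult_diff_distrib inner_diff_left inner_diff_right)
          also have "a \<bullet> (A' *v a) = Q Y" unfolding a_def by (rule quad2)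
          also have "Q Y - a \<bullet> (A' *v f) - f \<bullet> (A' *v a) + f \<bullet> (A' *v f)
             \<le> Q Y + K * (norm a * norm f) + K * (norm f * norm a) + K * (norm f * norm f)"
            using ip[of a f] ip[of f a] ip[of f f] by linarith
          also have "\<dots> \<le> Q Y + K * (Gb * (E / rn)) + K * ((E / rn) * Gb) + K * ((E / rn) * E)"
            using K(1) na nf nf' Gb0 E0 rn by (intro add_mono mult_left_mono mult_mono order_refl) auto
          also have "\<dots> = Q Y + (2 * K * Gb * E + K * E\<^sup>2) / rn"
            by (simp add: add_divide_distrib power2_eq_square)
          finally have "x \<bullet> (A' *v x) \<le> Q Y + \<eta> / 2" using ev2 by linarith
          moreover have "\<delta> * (norm x)\<^sup>2 \<le> \<delta> * (Gb + E)\<^sup>2"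
            using nx \<delta>0 by (intro mult_left_mono power_mono) auto
          moreover have "T_bitflip \<epsilon> n H \<theta>1 \<theta>2 = x \<bullet> (S' *v x)"
            by (rule T) (simp add: x_def)
          ultimately have "T_bitflip \<epsilon> n H \<theta>1 \<theta>2 \<le> Q Y + \<eta>"
            using S'[of x] \<delta>E by linarith
          with th1 th2 show ?thesis by blast
        qed
        let ?T = "\<lambda>\<theta>. case \<theta> of (\<theta>1, \<theta>2) \<Rightarrow> T_bitflip \<epsilon> n H \<theta>1 \<theta>2"
        let ?P = "pos_prob_vectors \<times> pos_prob_vectors :: ((real^'r) \<times> (real^'c)) set"
        have "Q Y - \<eta> \<le> (INF \<theta>\<in>?P. ?T \<theta>)"
          by (rule cINF_greatest) (use pi1 pi2 lower in auto)
        moreover have "(INF \<theta>\<in>?P. ?T \<theta>) \<le> Q Y + \<eta>"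
        proof -
          obtain \<theta>1 \<theta>2 where th: "\<theta>1 \<in> pos_prob_vectors" "\<theta>2 \<in> pos_prob_vectors" "T_bitflip \<epsilon> n H \<theta>1 \<theta>2 \<le> Q Y + \<eta>"
            using upper by blast
          have "bdd_below (?T ` ?P)"
            by (rule bdd_belowI2[where m = "Q Y - \<eta>"]) (use lower in auto)
          then show ?thesis
            by (rule cINF_lower2[of _ _ "(\<theta>1, \<theta>2)"]) (use th in auto)
        qed
        ultimately show "\<bar>(INF \<theta>\<in>?P. case \<theta> of (\<theta>1, \<theta>2) \<Rightarrow>
            T_bitflip \<epsilon> n (real n *\<^sub>R p_tilde \<epsilon> \<pi>1 \<pi>2 + sqrt n *\<^sub>R Y) \<theta>1 \<theta>2) - Q Y\<bar> \<le> \<eta>"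
          unfolding H_def[symmetric] by linarith
      qed
    qed
  qed
  show thesis
    by (rule that[OF l[unfolded A_def q_def] approx[unfolded Q_def]])
qed

section \<open>Measurability and weak convergence\<close>

lemma tendsto_inner_matrix_vector:
  fixes A :: "'b \<Rightarrow> real^'k^'k"
  assumes "(A \<longlongrightarrow> A0) F" "(x \<longlongrightarrow> x0) F"
  shows "((\<lambda>t. x t \<bullet> (A t *v x t)) \<longlongrightarrow> x0 \<bullet> (A0 *v x0)) F"
  unfolding inner_vec_def matrix_vector_mult_def
  by (auto intro!: tendsto_intros assms)

lemma tendsto_Sigma_tilde:
  fixes H0 :: "real^('r::finite \<times> 'c::finite)"
  shows "(Sigma_tilde \<epsilon> n \<longlongrightarrow> Sigma_tilde \<epsilon> n H0) (nhds H0)"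
proof (rule vec_tendstoI, rule vec_tendstoI)
  fix k l :: "'r \<times> 'c"
  have H: "((\<lambda>H. H $ i) \<longlongrightarrow> H0 $ i) (nhds H0)" for i
    by (rule tendsto_vec_nth[OF filterlim_ident])
  have 1: "((\<lambda>H. pi1_tilde \<epsilon> n H $ i) \<longlongrightarrow> pi1_tilde \<epsilon> n H0 $ i) (nhds H0)" for i
    \<comment> \<open>Division by \<open>real n\<close> becomes multiplication by a constant, so n =
      0 is no exception.\<close>
    unfolding pi1_tilde_def vector_scaleR_component vec_lambda_beta divide_inverse
    by (intro tendsto_scaleR tendsto_diff tendsto_mult tendsto_sum tendsto_const H)
  have 2: "((\<lambda>H. pi2_tilde \<epsilon> n H $ j) \<longlongrightarrow> pi2_tilde \<epsilon> n H0 $ j) (nhds H0)" for j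
    unfolding pi2_tilde_def vector_scaleR_component vec_lambda_beta divide_inverse
    by (intro tendsto_scaleR tendsto_diff tendsto_mult tendsto_sum tendsto_const H)
  have entry: "Sigma_tilde \<epsilon> n H $ k $ l = (alpha \<epsilon>)\<^sup>2 *
      ((if k = l then 1 else 0) * (pi1_tilde \<epsilon> n H $ fst k * pi2_tilde \<epsilon> n H $ snd k)
        - pi1_tilde \<epsilon> n H $ fst k * pi2_tilde \<epsilon> n H $ snd k * (pi1_tilde \<epsilon> n H $ fst l * pi2_tilde \<epsilon> n H $ snd l))
      + exp (\<epsilon>/2) / (exp (\<epsilon>/2) + 1)\<^sup>2 * mat 1 $ k $ l" for H
    by (simp add: Sigma_tilde_def Sigma_bit_def Diag_def outer_def)
  show "((\<lambda>H. Sigma_tilde \<epsilon> n H $ k $ l) \<longlongrightarrow> Sigma_tilde \<epsilon> n H0 $ k $ l) (nhds H0)"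
    unfolding entry by (intro tendsto_add tendsto_diff tendsto_mult tendsto_const 1 2)
qed

lemma tendsto_T_bitflip:
  fixes H0 :: "real^('r::finite \<times> 'c::finite)"
  assumes inv: "invertible (Sigma_tilde \<epsilon> n H0)"
  shows "\<forall>\<^sub>F H in nhds H0. invertible (Sigma_tilde \<epsilon> n H)"
    and "((\<lambda>H. T_bitflip \<epsilon> n H \<theta>1 \<theta>2) \<longlongrightarrow> T_bitflip \<epsilon> n H0 \<theta>1 \<theta>2) (nhds H0)"
proof -
  note lim = tendsto_matrix_inv[OF tendsto_Sigma_tilde inv]
  show ev: "\<forall>\<^sub>F H in nhds H0. invertible (Sigma_tilde \<epsilon> n H)" by (rule lim(1))
  define w where "w H = Pi_proj *v (H - real n *\<^sub>R p_tilde \<epsilon> \<theta>1 \<theta>2)" for H :: "real^('r \<times> 'c)"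
  have T: "T_bitflip \<epsilon> n H \<theta>1 \<theta>2 = 1 / real n * (w H \<bullet> (matrix_inv (Sigma_tilde \<epsilon> n H) *v w H))"
    if "invertible (Sigma_tilde \<epsilon> n H)" for H
    using that by (simp add: T_bitflip_def M_tilde_def matrix_vector_mul_assoc[symmetric] Pi_proj_inner w_def)
  have "(w \<longlongrightarrow> w H0) (nhds H0)"
    unfolding w_def by (intro bounded_linear.tendsto[OF matrix_vector_mul_bounded_linear] tendsto_intros filterlim_ident)
  then have "((\<lambda>H. 1 / real n * (w H \<bullet> (matrix_inv (Sigma_tilde \<epsilon> n H) *v w H))) \<longlongrightarrow> T_bitflip \<epsilon> n H0 \<theta>1 \<theta>2) (nhds H0)"
    unfolding T[OF inv] by (intro tendsto_mult tendsto_const tendsto_inner_matrix_vector lim(2))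
  then show "((\<lambda>H. T_bitflip \<epsilon> n H \<theta>1 \<theta>2) \<longlongrightarrow> T_bitflip \<epsilon> n H0 \<theta>1 \<theta>2) (nhds H0)"
    by (rule Lim_transform_eventually) (use ev in eventually_elim, simp add: T)
qed

text \<open>For an arbitrary \<open>H\<close> the quadratic form may be indefinite. Boundedness
  comes from the parameters, which range over a bounded set; without it the real infimum would carry
  no information.\<close>

lemma bdd_below_T_bitflip:
  fixes H :: "real^('r::finite \<times> 'c::finite)"
  shows "bdd_below ((\<lambda>(\<theta>1, \<theta>2). T_bitflip \<epsilon> n H \<theta>1 \<theta>2) ` (pos_prob_vectors \<times> pos_prob_vectors))"
proof -
  obtain K where K: "K > 0" "\<And>x. norm (M_tilde \<epsilon> n H *v x) \<le> K * norm x"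
    using bounded_matrix_vector by blast
  define b where "b = norm H + real n * (\<bar>alpha \<epsilon>\<bar> + \<bar>1 / (exp (\<epsilon>/2) + 1)\<bar> * norm (1 :: real^('r \<times> 'c)))"
  have b0: "b \<ge> 0" by (simp add: b_def)
  have "- (1 / real n * (b * (K * b))) \<le> T_bitflip \<epsilon> n H \<theta>1 \<theta>2"
    if th: "\<theta>1 \<in> pos_prob_vectors" "\<theta>2 \<in> pos_prob_vectors" for \<theta>1 \<theta>2
  proof -
    define w where "w = H - real n *\<^sub>R p_tilde \<epsilon> \<theta>1 \<theta>2"
    have "norm (outer \<theta>1 \<theta>2) \<le> 1"
      unfolding norm_outer using th by (intro mult_le_one pos_prob_vectors_norm_le) auto
    then have o: "norm (alpha \<epsilon> *\<^sub>R outer \<theta>1 \<theta>2) \<le> \<bar>alpha \<epsilon>\<bar>"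
      by (simp add: mult_left_le)
    have "norm (p_tilde \<epsilon> \<theta>1 \<theta>2) \<le> norm (alpha \<epsilon> *\<^sub>R outer \<theta>1 \<theta>2) + norm ((1 / (exp (\<epsilon>/2) + 1)) *\<^sub>R (1 :: real^('r \<times> 'c)))"
      unfolding p_tilde_def by (rule norm_triangle_ineq)
    also have "\<dots> \<le> \<bar>alpha \<epsilon>\<bar> + \<bar>1 / (exp (\<epsilon>/2) + 1)\<bar> * norm (1 :: real^('r \<times> 'c))"
      using o by (intro add_mono) (simp_all only: norm_scaleR order_refl)
    finally have p: "norm (real n *\<^sub>R p_tilde \<epsilon> \<theta>1 \<theta>2) \<le> real n * (\<bar>alpha \<epsilon>\<bar> + \<bar>1 / (exp (\<epsilon>/2) + 1)\<bar> * norm (1 :: real^('r \<times> 'c)))"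
      by (simp only: norm_scaleR abs_of_nat) (rule mult_left_mono, auto)
    have w: "norm w \<le> b"
      unfolding w_def b_def by (rule order_trans[OF norm_triangle_ineq4 add_left_mono[OF p]])
    have "\<bar>w \<bullet> (M_tilde \<epsilon> n H *v w)\<bar> \<le> norm w * norm (M_tilde \<epsilon> n H *v w)" by (rule Cauchy_Schwarz_ineq2)
    also have "\<dots> \<le> norm w * (K * norm w)" by (intro mult_left_mono K) auto
    also have "\<dots> \<le> b * (K * b)" using w b0 K by (intro mult_mono) auto
    finally have "\<bar>1 / real n * (w \<bullet> (M_tilde \<epsilon> n H *v w))\<bar> \<le> 1 / real n * (b * (K * b))"
      unfolding abs_mult by (simp add: divide_right_mono)
    moreover have "0 \<le> 1 / real n * (b * (K * b))" using b0 K by simp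
    ultimately show ?thesis unfolding T_bitflip_def w_def[symmetric] by (auto simp del: times_divide_eq_left)
  qed
  then show ?thesis by (intro bdd_belowI2[where m = "- (1 / real n * (b * (K * b)))"]) auto
qed

text \<open>The infimum runs over uncountably many parameters, but it lies below y exactly when some
  single statistic does. On the open set of invertible cases these conditions are open, and a union
  of open sets is open; elsewhere the statistic is constantly 0.\<close>

lemma borel_measurable_INF_T_bitflip:
  assumes ne: "(pos_prob_vectors :: (real^'r) set) \<noteq> {}" "(pos_prob_vectors :: (real^'c) set) \<noteq> {}"
  shows "(\<lambda>H :: real^('r \<times> 'c). INF (\<theta>1, \<theta>2) \<in> pos_prob_vectors \<times> pos_prob_vectors. T_bitflip \<epsilon> n H \<theta>1 \<theta>2)
    \<in> borel_measurable borel"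
proof -
  let ?P = "pos_prob_vectors \<times> pos_prob_vectors :: ((real^'r) \<times> (real^'c)) set"
  define f where "f H = (INF (\<theta>1, \<theta>2) \<in> ?P. T_bitflip \<epsilon> n H \<theta>1 \<theta>2)" for H :: "real^('r \<times> 'c)"
  define Inv where "Inv = {H :: real^('r \<times> 'c). invertible (Sigma_tilde \<epsilon> n H)}"
  have neP: "?P \<noteq> {}" using ne by auto
  have open_Inv: "open Inv"
  proof (subst open_subopen, safe)
    fix H assume "H \<in> Inv"
    then have "\<forall>\<^sub>F H' in nhds H. H' \<in> Inv"
      using tendsto_T_bitflip(1)[of \<epsilon> n H] by (simp add: Inv_def)
    then show "\<exists>T. open T \<and> H \<in> T \<and> T \<subseteq> Inv"
      unfolding eventually_nhds by blast
  qed
  have open_less: "open {H \<in> Inv. T_bitflip \<epsilon> n H \<theta>1 \<theta>2 < y}" for \<theta>1 \<theta>2 y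
  proof (subst open_subopen, safe)
    fix H assume H: "H \<in> Inv" "T_bitflip \<epsilon> n H \<theta>1 \<theta>2 < y"
    have "\<forall>\<^sub>F H' in nhds H. T_bitflip \<epsilon> n H' \<theta>1 \<theta>2 < y"
      using H by (intro order_tendstoD[OF tendsto_T_bitflip(2)]) (auto simp: Inv_def)
    moreover have "\<forall>\<^sub>F H' in nhds H. H' \<in> Inv"
      using H open_Inv by (auto simp: eventually_nhds)
    ultimately have "\<forall>\<^sub>F H' in nhds H. H' \<in> Inv \<and> T_bitflip \<epsilon> n H' \<theta>1 \<theta>2 < y"
      by eventually_elim simp
    then show "\<exists>T. open T \<and> H \<in> T \<and> T \<subseteq> {H \<in> Inv. T_bitflip \<epsilon> n H \<theta>1 \<theta>2 < y}"
      unfolding eventually_nhds by blast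
  qed
  have "f \<in> borel_measurable borel"
  proof (rule borel_measurableI_less)
    fix y
    have inv: "f H < y \<longleftrightarrow> (\<exists>(\<theta>1, \<theta>2)\<in>?P. T_bitflip \<epsilon> n H \<theta>1 \<theta>2 < y)" if "H \<in> Inv" for H
      unfolding f_def using cINF_less_iff[OF neP bdd_below_T_bitflip] by (simp add: case_prod_beta)
    have not_inv: "f H = 0" if "H \<notin> Inv" for H
      using that neP by (simp add: f_def T_bitflip_def Inv_def case_prod_beta)
    have "{x. f x < y} = (\<Union>(\<theta>1, \<theta>2)\<in>?P. {H \<in> Inv. T_bitflip \<epsilon> n H \<theta>1 \<theta>2 < y}) \<union> (if 0 < y then - Inv else {})"
      (is "?L = ?R")
    proof (rule set_eqI)
      fix H show "H \<in> ?L \<longleftrightarrow> H \<in> ?R"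
        by (cases "H \<in> Inv") (auto simp: inv not_inv)
    qed
    moreover have "(\<Union>(\<theta>1, \<theta>2)\<in>?P. {H \<in> Inv. T_bitflip \<epsilon> n H \<theta>1 \<theta>2 < y}) \<in> sets borel"
      using open_less by (intro borel_open open_UN) auto
    moreover have "(if 0 < y then - Inv else {}) \<in> sets borel"
      using borel_closed[OF closed_Compl[OF open_Inv]] by simp
    ultimately have "{x. f x < y} \<in> sets borel" by (simp only: sets.Un)
    then show "{x \<in> space borel. f x < y} \<in> sets borel" by simp
  qed
  then show ?thesis unfolding f_def .
qed

text \<open>Continuous steps are bounded and uniformly continuous, so the uniform approximation
  settles bounded \<open>Y\<close>, and a Chebyshev estimate handles the rest.\<close>

lemma INF_T_bitflip_cts_step_tendsto:
  fixes \<epsilon> :: real and \<pi>1 :: "real^'r" and \<pi>2 :: "real^'c" and P :: "('r \<times> 'c) pmf"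
  assumes eps: "\<epsilon> > 0" and pi1: "\<pi>1 \<in> pos_prob_vectors" and pi2: "\<pi>2 \<in> pos_prob_vectors"
    and P: "\<And>k. pmf P k = outer \<pi>1 \<pi>2 $ k" and ab: "a < b"
  shows "(\<lambda>n. measure_pmf.expectation (Pi_pmf {1..n} 0 (\<lambda>_. bit_output \<epsilon> P))
      (\<lambda>z. cts_step a b (INF (\<theta>1, \<theta>2) \<in> pos_prob_vectors \<times> pos_prob_vectors. T_bitflip \<epsilon> n (\<Sum>l=1..n. z l) \<theta>1 \<theta>2)))
    \<longlonglongrightarrow> integral\<^sup>L (chi_square_distribution ((CARD('r) - 1) * (CARD('c) - 1))) (cts_step a b)"
proof -
  define \<nu> where "\<nu> = (CARD('r) - 1) * (CARD('c) - 1)"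
  define A where "A = Sigma_bit \<epsilon> (outer \<pi>1 \<pi>2)"
  obtain l :: "nat \<Rightarrow> real^('r \<times> 'c)" where
    l: "\<And>i j. i < \<nu> \<Longrightarrow> j < \<nu> \<Longrightarrow> l i \<bullet> (A *v l j) = of_bool (i = j)" and
    approx: "\<And>B \<eta>. \<eta> > 0 \<Longrightarrow> \<forall>\<^sub>F n in sequentially. \<forall>Y. norm Y \<le> B \<longrightarrow>
       \<bar>(INF (\<theta>1, \<theta>2) \<in> pos_prob_vectors \<times> pos_prob_vectors.
          T_bitflip \<epsilon> n (real n *\<^sub>R p_tilde \<epsilon> \<pi>1 \<pi>2 + sqrt n *\<^sub>R Y) \<theta>1 \<theta>2) - (\<Sum>i<\<nu>. (l i \<bullet> Y)\<^sup>2)\<bar> \<le> \<eta>"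
    using INF_T_bitflip_approx[OF eps pi1 pi2] unfolding A_def \<nu>_def by blast
  define Q where "Q n = Pi_pmf {1..n} 0 (\<lambda>_. bit_output \<epsilon> P)" for n :: nat
  have finQ: "finite (set_pmf (Q n))" for n
    by (auto simp: Q_def set_Pi_pmf finite_set_bit_output intro!: finite_PiE_dflt)
  note [simp] = integrable_measure_pmf_finite[OF finQ]
  define m where "m = p_tilde \<epsilon> \<pi>1 \<pi>2"
  have p: "(\<chi> k. pmf P k) = outer \<pi>1 \<pi>2" by (simp add: vec_eq_iff P)
  have mean: "measure_pmf.expectation (bit_output \<epsilon> P) (\<lambda>z. v \<bullet> (z - m)) = 0"
    and var: "measure_pmf.expectation (bit_output \<epsilon> P) (\<lambda>z. (v \<bullet> (z - m))\<^sup>2) = v \<bullet> (A *v v)" for v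
    using bit_output_moments[of \<epsilon> P v] by (simp_all add: p m_def p_tilde_def A_def)
  define Y where "Y n z = (1 / sqrt (real n)) *\<^sub>R (\<Sum>l=1..n. z l - m)" for n :: nat and z :: "nat \<Rightarrow> real^('r \<times> 'c)"
  have v_Y: "v \<bullet> Y n z = (\<Sum>l=1..n. v \<bullet> (z l - m)) / sqrt (real n)" for v n z
    by (simp add: Y_def inner_sum_right)
  have Y_sum: "real n *\<^sub>R m + sqrt n *\<^sub>R Y n z = (\<Sum>l=1..n. z l)" if "n \<ge> 1" for n z
    using that by (simp add: Y_def sum_subtractf sum_constant_scaleR del: sum_constant)
  have char: "(\<lambda>n. measure_pmf.expectation (Q n) (\<lambda>z. iexp (\<Sum>i<\<nu>. c i * (l i \<bullet> Y n z))))
      \<longlonglongrightarrow> complex_of_real (exp (- (\<Sum>i<\<nu>. (c i)\<^sup>2) / 2))" for c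
  proof -
    \<comment> \<open>Reduction to one dimension: the combination of coordinates is a single
      projection of \<open>Y\<close>, and orthonormality with respect to \<open>A\<close> turns its
      variance into the sum of the squared coefficients.\<close>
    define v where "v = (\<Sum>i<\<nu>. c i *\<^sub>R l i)"
    have "v \<bullet> (A *v v) = (\<Sum>i<\<nu>. c i * (\<Sum>j<\<nu>. c j * (l j \<bullet> (A *v l i))))"
      by (simp add: v_def linear_sum[OF matrix_vector_mul_linear] matrix_vector_mult_scaleR inner_sum_left inner_sum_right)
    also have "\<dots> = (\<Sum>i<\<nu>. c i * (\<Sum>j<\<nu>. if j = i then c i else 0))"
      by (intro sum.cong arg_cong2[where f = "(*)"] refl) (use l in auto)
    finally have vAv: "v \<bullet> (A *v v) = (\<Sum>i<\<nu>. (c i)\<^sup>2)" by (simp add: power2_eq_square)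
    have sum_v: "(\<Sum>i<\<nu>. c i * (l i \<bullet> Y n z)) = (\<Sum>l=1..n. v \<bullet> (z l - m)) / sqrt (real n)" for n z
      unfolding v_Y[symmetric] by (simp add: v_def inner_sum_left)
    show ?thesis
      unfolding sum_v Q_def by (rule char_clt_Pi_pmf) (use mean var vAv in \<open>auto simp: finite_set_bit_output\<close>)
  qed
  have lim: "(\<lambda>n. measure_pmf.expectation (Q n) (\<lambda>z. cts_step a b (\<Sum>i<\<nu>. (l i \<bullet> Y n z)\<^sup>2)))
      \<longlonglongrightarrow> integral\<^sup>L (chi_square_distribution \<nu>) (cts_step a b)"
    by (rule cts_step_sum_squares_tendsto[OF finQ char ab])
  \<comment> \<open>The trace of \<open>A\<close>, which is the second moment of the norm of
    \<open>Y\<close> for every n >= 1.\<close>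
  define V where "V = (\<Sum>k\<in>UNIV. axis k 1 \<bullet> (A *v axis k (1::real)))"
  have second_moment: "measure_pmf.expectation (Q n) (\<lambda>z. (norm (Y n z))\<^sup>2) = V" if n: "n \<ge> 1" for n
  proof -
    have comp: "measure_pmf.expectation (Q n) (\<lambda>z. (v \<bullet> Y n z)\<^sup>2) = v \<bullet> (A *v v)" for v
    proof -
      have "measure_pmf.expectation (Q n) (\<lambda>z. (\<Sum>l=1..n. v \<bullet> (z l - m))\<^sup>2) = real n * (v \<bullet> (A *v v))"
        unfolding Q_def by (subst expectation_square_sum_Pi_pmf) (auto simp: finite_set_bit_output mean var)
      then show ?thesis using n by (simp add: v_Y power_divide)
    qed
    have "(norm (Y n z))\<^sup>2 = (\<Sum>k\<in>UNIV. (axis k 1 \<bullet> Y n z)\<^sup>2)" for z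
      unfolding power2_norm_eq_inner inner_vec_def[of "Y n z" "Y n z"]
      by (simp add: inner_axis' power2_eq_square)
    then show ?thesis by (simp add: Bochner_Integration.integral_sum comp V_def)
  qed
  have V0: "V \<ge> 0"
    unfolding second_moment[of 1, OF order_refl, symmetric] by (rule Bochner_Integration.integral_nonneg) simp
  define R where "R n H = (INF (\<theta>1, \<theta>2) \<in> pos_prob_vectors \<times> pos_prob_vectors. T_bitflip \<epsilon> n H \<theta>1 \<theta>2)" for n and H :: "real^('r \<times> 'c)"
  define E where "E n h = measure_pmf.expectation (Q n) h" for n and h :: "(nat \<Rightarrow> real^('r \<times> 'c)) \<Rightarrow> real"
  have "(\<lambda>n. E n (\<lambda>z. cts_step a b (R n (\<Sum>l=1..n. z l)))) \<longlonglongrightarrow> integral\<^sup>L (chi_square_distribution \<nu>) (cts_step a b)"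
    unfolding LIMSEQ_iff
  proof (intro allI impI)
    fix e :: real assume e: "e > 0"
    obtain d where d: "d > 0" "\<And>x y. \<bar>x - y\<bar> < d \<Longrightarrow> \<bar>cts_step a b x - cts_step a b y\<bar> < e / 4"
      using cts_step_uniformly_continuous[OF ab] e unfolding uniformly_continuous_on_def dist_real_def
      by (metis UNIV_I divide_pos_pos zero_less_numeral)
    \<comment> \<open>Makes the Chebyshev term at most e/4; adding 1 to \<open>V\<close> keeps
      \<open>B\<close> positive when \<open>V\<close> is 0.\<close>
    define B where "B = sqrt (4 * (V + 1) / e)"
    have B2: "B\<^sup>2 = 4 * (V + 1) / e" and B0: "B > 0" using V0 e by (simp_all add: B_def)
    have VB: "V / B\<^sup>2 \<le> e / 4"
      using V0 e unfolding B2 by (simp add: field_simps)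
    have step01: "0 \<le> cts_step a b x \<and> cts_step a b x \<le> 1" for x
      using ab by (auto simp: cts_step_def field_simps)
    have "\<forall>\<^sub>F n in sequentially. \<bar>E n (\<lambda>z. cts_step a b (\<Sum>i<\<nu>. (l i \<bullet> Y n z)\<^sup>2))
        - integral\<^sup>L (chi_square_distribution \<nu>) (cts_step a b)\<bar> < e / 2"
      using tendstoD[OF lim, of "e / 2"] e by (simp add: dist_real_def E_def)
    moreover have "\<forall>\<^sub>F n in sequentially. \<forall>Y. norm Y \<le> B \<longrightarrow>
       \<bar>R n (real n *\<^sub>R m + sqrt n *\<^sub>R Y) - (\<Sum>i<\<nu>. (l i \<bullet> Y)\<^sup>2)\<bar> \<le> d / 2"
      unfolding R_def m_def using d by (intro approx) auto
    ultimately have "\<forall>\<^sub>F n in sequentially. \<bar>E n (\<lambda>z. cts_step a b (R n (\<Sum>l=1..n. z l)))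
        - integral\<^sup>L (chi_square_distribution \<nu>) (cts_step a b)\<bar> < e"
      using eventually_ge_at_top[of 1]
    proof eventually_elim
      case (elim n)
      have n: "n \<ge> 1" by fact
      let ?g = "\<lambda>z. cts_step a b (R n (\<Sum>l=1..n. z l))" and ?h = "\<lambda>z. cts_step a b (\<Sum>i<\<nu>. (l i \<bullet> Y n z)\<^sup>2)"
      \<comment> \<open>Chebyshev's inequality in pointwise form: outside the ball the steps differ
        by at most 1, and there the last summand is at least 1.\<close>
      have pt: "\<bar>?g z - ?h z\<bar> \<le> e / 4 + (norm (Y n z))\<^sup>2 / B\<^sup>2" for z
      proof (cases "norm (Y n z) \<le> B")
        case True
        then have "\<bar>R n (\<Sum>l=1..n. z l) - (\<Sum>i<\<nu>. (l i \<bullet> Y n z)\<^sup>2)\<bar> < d"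
          using elim(2)[rule_format, of "Y n z"] d(1) unfolding Y_sum[OF n] by linarith
        then have "\<bar>?g z - ?h z\<bar> < e / 4" by (rule d(2))
        moreover have "0 \<le> (norm (Y n z))\<^sup>2 / B\<^sup>2" by simp
        ultimately show ?thesis by linarith
      next
        case False
        then have "B\<^sup>2 \<le> (norm (Y n z))\<^sup>2" using B0 by (intro power_mono) auto
        then have "1 \<le> (norm (Y n z))\<^sup>2 / B\<^sup>2" using B0 by (simp add: pos_le_divide_eq)
        moreover have "\<bar>?g z - ?h z\<bar> \<le> 1"
          using step01[of "R n (\<Sum>l=1..n. z l)"] step01[of "\<Sum>i<\<nu>. (l i \<bullet> Y n z)\<^sup>2"] by linarith
        ultimately show ?thesis using e by linarith
      qed
      have "\<bar>E n ?g - E n ?h\<bar> = \<bar>E n (\<lambda>z. ?g z - ?h z)\<bar>"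
        unfolding E_def by simp
      also have "\<dots> \<le> E n (\<lambda>z. \<bar>?g z - ?h z\<bar>)"
        unfolding E_def by (rule integral_abs_bound)
      also have "\<dots> \<le> E n (\<lambda>z. e / 4 + (norm (Y n z))\<^sup>2 / B\<^sup>2)"
        unfolding E_def by (rule integral_mono) (simp, simp, rule pt)
      also have "\<dots> = e / 4 + V / B\<^sup>2"
        unfolding E_def by (subst Bochner_Integration.integral_add) (auto simp: second_moment[OF n])
      finally have "\<bar>E n ?g - E n ?h\<bar> \<le> e / 2" using VB by linarith
      then show ?case using elim(1) by linarith
    qed
    then show "\<exists>no. \<forall>n\<ge>no. norm (E n (\<lambda>z. cts_step a b (R n (\<Sum>l=1..n. z l)))
        - integral\<^sup>L (chi_square_distribution \<nu>) (cts_step a b)) < e"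
      by (simp add: eventually_sequentially)
  qed
  then show ?thesis unfolding E_def Q_def R_def \<nu>_def .
qed

lemma real_distribution_chi_square: "real_distribution (chi_square_distribution \<nu>)"
proof -
  interpret product_prob_space "\<lambda>_::nat. std_normal_distribution"
    by (rule product_prob_space_std_normal)
  interpret N: prob_space "Pi\<^sub>M {..<\<nu>} (\<lambda>_. std_normal_distribution)"
    by (rule prob_space_PiM) (rule prob_space)
  have [measurable]: "(\<lambda>x. x i) \<in> borel_measurable (Pi\<^sub>M {..<\<nu>} (\<lambda>_. std_normal_distribution))" if "i < \<nu>" for i
    using measurable_component_singleton[of i "{..<\<nu>}" "\<lambda>_. std_normal_distribution"] that by simp
  show ?thesis
    unfolding chi_square_distribution_def by (rule N.real_distribution_distr) measurable
qed

theorem theorem6p7: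
  fixes \<epsilon> :: real
    and \<pi>1 :: "real^'r" and \<pi>2 :: "real^'c"
    and M :: "nat \<Rightarrow> 'a measure"
    and U :: "nat \<Rightarrow> nat \<Rightarrow> 'a \<Rightarrow> real^'r"
    and V :: "nat \<Rightarrow> nat \<Rightarrow> 'a \<Rightarrow> real^'c"
    and Z :: "nat \<Rightarrow> nat \<Rightarrow> 'a \<Rightarrow> real^('r \<times> 'c)"
  assumes eps: "\<epsilon> > 0"
    and pi1: "\<pi>1 \<in> pos_prob_vectors" and pi2: "\<pi>2 \<in> pos_prob_vectors"
    and prob: "\<And>n. prob_space (M n)"
    and iid: "\<And>n. iid_vars (M n) borel (\<lambda>l \<omega>. (U n l \<omega>, V n l \<omega>)) {1..n}"
    and U_dist: "\<And>n l. l \<in> {1..n} \<Longrightarrow> multinomial1_rv (M n) \<pi>1 (U n l)"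
    and V_dist: "\<And>n l. l \<in> {1..n} \<Longrightarrow> multinomial1_rv (M n) \<pi>2 (V n l)"
    and Z_meas: "\<And>n l. l \<in> {1..n} \<Longrightarrow> Z n l \<in> borel_measurable (M n)"
    and Z_mech: "\<And>n. mechanism_outputs (M n) (\<lambda>x. bit_mech x \<epsilon>)
                        (\<lambda>l \<omega>. cell_table (U n l \<omega>) (V n l \<omega>)) (Z n) {1..n}"
    and UV_indep: "\<And>n l. l \<in> {1..n} \<Longrightarrow> indep_pair (M n) borel (U n l) borel (V n l)"
  shows "weak_conv_m
           (\<lambda>n. distr (M n) borel
              (\<lambda>\<omega>. INF (\<theta>1, \<theta>2) \<in> pos_prob_vectors \<times> pos_prob_vectors.
                      T_bitflip \<epsilon> n (\<Sum>l=1..n. Z n l \<omega>) \<theta>1 \<theta>2))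
           (chi_square_distribution ((CARD('r) - 1) * (CARD('c) - 1)))"
proof -
  define f where "f n H = (INF (\<theta>1, \<theta>2) \<in> pos_prob_vectors \<times> pos_prob_vectors. T_bitflip \<epsilon> n H \<theta>1 \<theta>2)"
    for n and H :: "real^('r \<times> 'c)"
  have f_meas: "f n \<in> borel_measurable borel" for n
    using borel_measurable_INF_T_bitflip[of \<epsilon> n] pi1 pi2 unfolding f_def[abs_def] by blast
  have Z_sum: "(\<lambda>\<omega>. \<Sum>l=1..n. Z n l \<omega>) \<in> borel_measurable (M n)" for n
    by (intro borel_measurable_sum Z_meas)
  have fZ: "(\<lambda>\<omega>. f n (\<Sum>l=1..n. Z n l \<omega>)) \<in> borel_measurable (M n)" for n
    by (rule measurable_compose[OF Z_sum f_meas])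
  obtain P :: "('r \<times> 'c) pmf" where P: "\<And>k. pmf P k = outer \<pi>1 \<pi>2 $ k"
    using pos_prob_vectors_pmf[OF outer_pos_prob_vectors[OF pi1 pi2]] by blast
  have "weak_conv_m (\<lambda>n. distr (M n) borel (\<lambda>\<omega>. f n (\<Sum>l=1..n. Z n l \<omega>)))
      (chi_square_distribution ((CARD('r) - 1) * (CARD('c) - 1)))"
  \<comment> \<open>Continuous steps squeeze the indicators of half-lines, so their integrals
    determine convergence at continuity points of the limit. The point mass for zero degrees of
    freedom is covered as well.\<close>
  proof (rule integral_cts_step_conv_imp_weak_conv)
    show "real_distribution (distr (M n) borel (\<lambda>\<omega>. f n (\<Sum>l=1..n. Z n l \<omega>)))" for n
      by (rule prob_space.real_distribution_distr[OF prob fZ])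
    fix a b :: real assume ab: "a < b"
    have step: "cts_step a b \<in> borel_measurable borel"
      unfolding cts_step_def[abs_def] by measurable
    \<comment> \<open>The transfer to the product law is for nonempty index sets; n = 0 does not
      affect the limit.\<close>
    have eq: "integral\<^sup>L (distr (M n) borel (\<lambda>\<omega>. f n (\<Sum>l=1..n. Z n l \<omega>))) (cts_step a b) =
        measure_pmf.expectation (Pi_pmf {1..n} 0 (\<lambda>_. bit_output \<epsilon> P)) (\<lambda>z. cts_step a b (f n (\<Sum>l=1..n. z l)))"
      if "n \<ge> 1" for n
    proof -
      have "integral\<^sup>L (distr (M n) borel (\<lambda>\<omega>. f n (\<Sum>l=1..n. Z n l \<omega>))) (cts_step a b)
          = integral\<^sup>L (M n) (\<lambda>\<omega>. cts_step a b (f n (\<Sum>l=1..n. Z n l \<omega>)))"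
        by (rule integral_distr[OF fZ step])
      also have "\<dots> = measure_pmf.expectation (Pi_pmf {1..n} 0 (\<lambda>_. bit_output \<epsilon> P)) (\<lambda>z. cts_step a b (f n (\<Sum>l=1..n. z l)))"
        by (rule prob_space.expectation_mechanism_outputs[OF prob, where F = "\<lambda>H. cts_step a b (f n H)"])
           (use that pi1 pi2 iid[of n] U_dist V_dist UV_indep Z_meas Z_mech P
             measurable_compose[OF f_meas step] in \<open>auto simp: iid_vars_def\<close>)
      finally show ?thesis .
    qed
    have "(\<lambda>n. measure_pmf.expectation (Pi_pmf {1..n} 0 (\<lambda>_. bit_output \<epsilon> P)) (\<lambda>z. cts_step a b (f n (\<Sum>l=1..n. z l))))
      \<longlonglongrightarrow> integral\<^sup>L (chi_square_distribution ((CARD('r) - 1) * (CARD('c) - 1))) (cts_step a b)"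
      unfolding f_def by (rule INF_T_bitflip_cts_step_tendsto[OF eps pi1 pi2 P ab])
    then show "(\<lambda>n. integral\<^sup>L (distr (M n) borel (\<lambda>\<omega>. f n (\<Sum>l=1..n. Z n l \<omega>))) (cts_step a b))
      \<longlonglongrightarrow> integral\<^sup>L (chi_square_distribution ((CARD('r) - 1) * (CARD('c) - 1))) (cts_step a b)"
      by (rule Lim_transform_eventually) (rule eventually_mono[OF eventually_ge_at_top[of 1] eq[symmetric]])
  qed (rule real_distribution_chi_square)
  then show ?thesis unfolding f_def .
qed

end
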